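(* Let $X$ be an affine (not necessarily normal) toric variety over $\mathbb{K}$, with weight monoid $P$ and cone $\sigma^\vee$ as in the context. Then the closure of each $\mathrm{Aut}(X)^0$-orbit on $X$ has the form $\overline{O_\tau}$, where $\tau$ is a face of $\sigma^\vee$ such that there are no admissible $\tau$-roots.
   Context: $\mathbb{K}$ is an algebraically closed field of characteristic zero. Neutral component. A family $\{\varphi_b\}_{b\in B}$ of automorphisms of $X$, with $B$ an algebraic variety, is algebraic if $B\times X\to X$, $(b,x)\mapsto\varphi_b(x)$, is a morphism. $\mathrm{Aut}(X)^0$ is the subgroup of those automorphisms of $X$ that belong to an algebraic family with irreducible base $B$ such that $\varphi_{b_0}=\mathrm{id}_X$ for some $b_0\in B$. Toric varieties. A toric variety is an irreducible variety $X$ with an action of an algebraic torus $T\cong(\mathbb{K}^\times)^n$ having an open orbit; normality is not assumed. If $X$ is affine, then $\mathbb{K}[X]=\bigoplus_{m\in P}\mathbb{K}\chi^m$, where $P$ is a finitely generated submonoid of the character lattice of $T$ and $\chi^m$ is the character corresponding to $m$. Let $M$ be the group generated by $P$, and let $\sigma^\vee\subset M_{\mathbb{Q}}=M\otimes\mathbb{Q}$ be the cone spanned by $P$. The $T$-orbits of $X$ are in bijection with the faces $\tau$ of $\sigma^\vee$ (including $\sigma^\vee$ itself): the orbit $O_\tau$ is the one whose closure $\overline{O_\tau}$ has vanishing ideal $\bigoplus_{m\in P\setminus\tau}\mathbb{K}\chi^m$. Demazure roots. Let $N=\mathrm{Hom}(M,\mathbb{Z})$ with pairing $\langle\cdot,\cdot\rangle$,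 let $\sigma\subset N_{\mathbb{Q}}$ be the dual cone of $\sigma^\vee$ (it is pointed), $\sigma(1)$ its set of rays, and $p_\rho$ the primitive lattice vector on a ray $\rho$. An element $e\in M$ is a Demazure root of $\sigma$ if for some $\rho\in\sigma(1)$ one has $\langle e,p_\rho\rangle=-1$ and $\langle e,p_{\rho'}\rangle\ge 0$ for all $\rho'\in\sigma(1)$, $\rho'\ne\rho$. For a face $\tau$ of $\sigma^\vee$, let $p_1,\dots,p_k$ be the primitive vectors on all rays of $\sigma$ that are normal to $\tau$ (i.e. vanish on $\tau$). A Demazure root $e$ is a $\tau$-root if, for some $i\in\{1,\dots,k\}$, $\langle e,p_i\rangle=-1$ and $\langle e,p_j\rangle=0$ for all $j\ne i$, $1\le j\le k$. A Demazure root $e$ is admissible if $(e+P)\cap\sigma^\vee\subset P$. *)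

theory Defs
  imports
    "HOL-Analysis.Abstract_Topology"
    "HOL-Library.Function_Algebras"
    "HOL-Computational_Algebra.Polynomial"
begin

section \<open>Polynomial functions and the Zariski topology\<close>

text \<open>The \<open>'k\<close>-algebra of functions generated by a set \<open>G\<close> of coordinate functions.\<close>

inductive_set gen_algebra :: "('a \<Rightarrow> 'k::field) set \<Rightarrow> ('a \<Rightarrow> 'k) set" for G where
  const: "(\<lambda>_. c) \<in> gen_algebra G"
| gen: "g \<in> G \<Longrightarrow> g \<in> gen_algebra G"
| add: "p \<in> gen_algebra G \<Longrightarrow> q \<in> gen_algebra G \<Longrightarrow> p + q \<in> gen_algebra G"
| mult: "p \<in> gen_algebra G \<Longrightarrow> q \<in> gen_algebra G \<Longrightarrow> p * q \<in> gen_algebra G"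

definition zariski :: "('a \<Rightarrow> 'k::field) set \<Rightarrow> 'a topology" where
  "zariski G = topology (\<lambda>W. \<exists>S \<subseteq> gen_algebra G. W = {x. \<exists>p\<in>S. p x \<noteq> 0})"

lemma istopology_zariski:
  "istopology (\<lambda>W. \<exists>S \<subseteq> gen_algebra G. W = {x. \<exists>p\<in>S. p x \<noteq> 0})"
  unfolding istopology_def
proof (intro conjI allI impI)
  fix V W
  assume "\<exists>S \<subseteq> gen_algebra G. V = {x. \<exists>p\<in>S. p x \<noteq> 0}"
    and "\<exists>S \<subseteq> gen_algebra G. W = {x. \<exists>p\<in>S. p x \<noteq> 0}"
  then obtain S R where S: "S \<subseteq> gen_algebra G" "V = {x. \<exists>p\<in>S. p x \<noteq> 0}"
    and R: "R \<subseteq> gen_algebra G" "W = {x. \<exists>p\<in>R. p x \<noteq> 0}"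
    by blast
  have "{p * q |p q. p \<in> S \<and> q \<in> R} \<subseteq> gen_algebra G"
    using S(1) R(1) by (auto intro: gen_algebra.mult)
  moreover have "V \<inter> W = {x. \<exists>r \<in> {p * q |p q. p \<in> S \<and> q \<in> R}. r x \<noteq> 0}"
  proof (intro set_eqI iffI)
    fix x assume "x \<in> V \<inter> W"
    then obtain p q where "p \<in> S" "p x \<noteq> 0" "q \<in> R" "q x \<noteq> 0"
      unfolding S(2) R(2) by blast
    moreover from this have "(p * q) x \<noteq> 0" by (simp add: times_fun_def)
    ultimately show "x \<in> {x. \<exists>r \<in> {p * q |p q. p \<in> S \<and> q \<in> R}. r x \<noteq> 0}"
      by blast
  next
    fix x assume "x \<in> {x. \<exists>r \<in> {p * q |p q. p \<in> S \<and> q \<in> R}. r x \<noteq> 0}"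
    then obtain p q where "p \<in> S" "q \<in> R" "(p * q) x \<noteq> 0" by blast
    moreover from this have "p x \<noteq> 0" "q x \<noteq> 0" by (simp_all add: times_fun_def)
    ultimately show "x \<in> V \<inter> W" unfolding S(2) R(2) by blast
  qed
  ultimately show "\<exists>S \<subseteq> gen_algebra G. V \<inter> W = {x. \<exists>p\<in>S. p x \<noteq> 0}"
    by blast
next
  fix \<W>
  assume *: "\<forall>W\<in>\<W>. \<exists>S \<subseteq> gen_algebra G. W = {x. \<exists>p\<in>S. p x \<noteq> 0}"
  define R where "R = {p \<in> gen_algebra G. \<forall>x. p x \<noteq> 0 \<longrightarrow> x \<in> \<Union>\<W>}"
  have "x \<in> \<Union>\<W> \<longleftrightarrow> (\<exists>p\<in>R. p x \<noteq> 0)" for x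
  proof
    assume "x \<in> \<Union>\<W>"
    then obtain W where W: "W \<in> \<W>" "x \<in> W" by (rule UnionE)
    with * obtain S where S: "S \<subseteq> gen_algebra G" "W = {x. \<exists>p\<in>S. p x \<noteq> 0}" by meson
    then have "x \<in> {x. \<exists>p\<in>S. p x \<noteq> 0}" using W(2) by simp
    then obtain p where p: "p \<in> S" "p x \<noteq> 0" by (elim CollectE bexE)
    have "y \<in> W" if "p y \<noteq> 0" for y
      unfolding S(2) using p(1) that by (intro CollectI bexI)
    then have "p \<in> R"
      unfolding R_def using p(1) S(1) W(1) by (intro CollectI conjI allI impI) auto
    then show "\<exists>p\<in>R. p x \<noteq> 0" using p(2) by (intro bexI)
  next
    assume "\<exists>p\<in>R. p x \<noteq> 0"
    then show "x \<in> \<Union>\<W>" by (elim bexE) (simp add: R_def)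
  qed
  then have "\<Union>\<W> = {x. \<exists>p\<in>R. p x \<noteq> 0}" by (intro set_eqI) simp
  moreover have "R \<subseteq> gen_algebra G" unfolding R_def by (rule Collect_restrict)
  ultimately show "\<exists>S \<subseteq> gen_algebra G. \<Union>\<W> = {x. \<exists>p\<in>S. p x \<noteq> 0}"
    by (intro exI[of _ R] conjI)
qed

lemma openin_zariski:
  "openin (zariski G) W \<longleftrightarrow> (\<exists>S \<subseteq> gen_algebra G. W = {x. \<exists>p\<in>S. p x \<noteq> 0})"
  unfolding zariski_def topology_inverse'[OF istopology_zariski] ..

definition irreducible_space :: "'a topology \<Rightarrow> bool" where
  "irreducible_space T \<longleftrightarrow> topspace T \<noteq> {} \<and>
     (\<forall>C D. closedin T C \<and> closedin T D \<and> topspace T = C \<union> D \<longrightarrow>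
            topspace T = C \<or> topspace T = D)"

text \<open>Affine \<open>n\<close>-space is the set of sequences vanishing from index \<open>n\<close> on. On it, only the
  first \<open>n\<close> coordinate functions matter.\<close>

definition affine_space :: "nat \<Rightarrow> (nat \<Rightarrow> 'k::field) set" where
  "affine_space n = {x. \<forall>i\<ge>n. x i = 0}"

definition coords :: "((nat \<Rightarrow> 'k::field) \<Rightarrow> 'k) set" where
  "coords = range (\<lambda>i x. x i)"

definition coords2 :: "((nat \<Rightarrow> 'k::field) \<times> (nat \<Rightarrow> 'k) \<Rightarrow> 'k) set" where
  "coords2 = range (\<lambda>i (x, y). x i) \<union> range (\<lambda>j (x, y). y j)"

abbreviation zariski_on :: "(nat \<Rightarrow> 'k::field) set \<Rightarrow> (nat \<Rightarrow> 'k) topology" where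
  "zariski_on V \<equiv> subtopology (zariski coords) V"

definition affine_variety :: "(nat \<Rightarrow> 'k::field) set \<Rightarrow> bool" where
  "affine_variety V \<longleftrightarrow> (\<exists>n. V \<subseteq> affine_space n) \<and> closedin (zariski coords) V"

text \<open>Maps whose components agree on \<open>D\<close> with elements of the algebra generated by \<open>G\<close>.\<close>

definition poly_map :: "('a \<Rightarrow> 'k::field) set \<Rightarrow> 'a set \<Rightarrow> ('a \<Rightarrow> nat \<Rightarrow> 'k) \<Rightarrow> bool" where
  "poly_map G D f \<longleftrightarrow> (\<forall>j. \<exists>p\<in>gen_algebra G. \<forall>x\<in>D. f x j = p x)"

text \<open>Regular maps on a locally closed set \<open>W\<close>: the components are locally fractions.\<close>

definition regular_map_on :: "(nat \<Rightarrow> 'k::field) set \<Rightarrow> ((nat \<Rightarrow> 'k) \<Rightarrow> nat \<Rightarrow> 'k) \<Rightarrow> bool" where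
  "regular_map_on W f \<longleftrightarrow> (\<forall>j. \<forall>w\<in>W. \<exists>Q p q. openin (zariski_on W) Q \<and> w \<in> Q \<and>
     p \<in> gen_algebra coords \<and> q \<in> gen_algebra coords \<and>
     (\<forall>v\<in>Q. q v \<noteq> 0 \<and> f v j = p v / q v))"


section \<open>Algebraic varieties and algebraic families of automorphisms\<close>

text \<open>An algebraic variety is a set \<open>B\<close> with a finite atlas \<open>\<A>\<close> of charts \<open>(U, \<phi>)\<close>, each
  identifying \<open>U \<subseteq> B\<close> with an affine variety, such that overlaps are open, transition maps are
  regular and the diagonal is closed (Serre's axioms). Varieties may be reducible.\<close>

definition variety :: "'b set \<Rightarrow> ('b set \<times> ('b \<Rightarrow> nat \<Rightarrow> 'k::field)) set \<Rightarrow> bool" where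
  "variety B \<A> \<longleftrightarrow> finite \<A> \<and> B = (\<Union>(U, \<phi>)\<in>\<A>. U) \<and>
     (\<forall>(U, \<phi>)\<in>\<A>. inj_on \<phi> U \<and> affine_variety (\<phi> ` U)) \<and>
     (\<forall>(U, \<phi>)\<in>\<A>. \<forall>(U', \<phi>')\<in>\<A>.
        openin (zariski_on (\<phi> ` U)) (\<phi> ` (U \<inter> U')) \<and>
        regular_map_on (\<phi> ` (U \<inter> U')) (\<lambda>v. \<phi>' (inv_into U \<phi> v)) \<and>
        closedin (zariski coords2) ((\<lambda>b. (\<phi> b, \<phi>' b)) ` (U \<inter> U')))"

definition variety_topology ::
  "'b set \<Rightarrow> ('b set \<times> ('b \<Rightarrow> nat \<Rightarrow> 'k::field)) set \<Rightarrow> 'b topology" where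
  "variety_topology B \<A> = topology (\<lambda>W. W \<subseteq> B \<and>
     (\<forall>(U, \<phi>)\<in>\<A>. openin (pullback_topology U \<phi> (zariski coords)) (W \<inter> U)))"

lemma istopology_variety_topology:
  "istopology (\<lambda>W. W \<subseteq> B \<and>
     (\<forall>(U, \<phi>)\<in>\<A>. openin (pullback_topology U \<phi> (zariski coords)) (W \<inter> U)))"
  unfolding istopology_def
proof (intro conjI allI impI)
  fix V W
  assume V: "V \<subseteq> B \<and> (\<forall>(U, \<phi>)\<in>\<A>. openin (pullback_topology U \<phi> (zariski coords)) (V \<inter> U))"
    and W: "W \<subseteq> B \<and> (\<forall>(U, \<phi>)\<in>\<A>. openin (pullback_topology U \<phi> (zariski coords)) (W \<inter> U))"
  show "V \<inter> W \<subseteq> B" using V by blast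
  show "\<forall>(U, \<phi>)\<in>\<A>. openin (pullback_topology U \<phi> (zariski coords)) (V \<inter> W \<inter> U)"
  proof (intro ballI, clarify)
    fix U \<phi> assume A: "(U, \<phi>) \<in> \<A>"
    have "openin (pullback_topology U \<phi> (zariski coords)) ((V \<inter> U) \<inter> (W \<inter> U))"
      using bspec[OF conjunct2[OF V] A] bspec[OF conjunct2[OF W] A]
      by (simp only: prod.case openin_Int)
    moreover have "(V \<inter> U) \<inter> (W \<inter> U) = V \<inter> W \<inter> U" by blast
    ultimately show "openin (pullback_topology U \<phi> (zariski coords)) (V \<inter> W \<inter> U)" by simp
  qed
next
  fix \<W>
  assume *: "\<forall>W\<in>\<W>. W \<subseteq> B \<and>
    (\<forall>(U, \<phi>)\<in>\<A>. openin (pullback_topology U \<phi> (zariski coords)) (W \<inter> U))"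
  then show "\<Union>\<W> \<subseteq> B" by blast
  show "\<forall>(U, \<phi>)\<in>\<A>. openin (pullback_topology U \<phi> (zariski coords)) (\<Union>\<W> \<inter> U)"
  proof (intro ballI, clarify)
    fix U \<phi> assume "(U, \<phi>) \<in> \<A>"
    then have "openin (pullback_topology U \<phi> (zariski coords)) (W \<inter> U)" if "W \<in> \<W>" for W
      using bspec[OF * that] by fastforce
    then have "openin (pullback_topology U \<phi> (zariski coords)) (\<Union>W\<in>\<W>. W \<inter> U)"
      by (intro openin_Union ballI) (elim imageE, simp)
    then show "openin (pullback_topology U \<phi> (zariski coords)) (\<Union>\<W> \<inter> U)"
      by (simp only: Int_Union2)
  qed
qed

lemma openin_variety_topology:
  "openin (variety_topology B \<A>) W \<longleftrightarrow> W \<subseteq> B \<and>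
     (\<forall>(U, \<phi>)\<in>\<A>. openin (pullback_topology U \<phi> (zariski coords)) (W \<inter> U))"
  unfolding variety_topology_def topology_inverse'[OF istopology_variety_topology] ..

definition automorphism :: "(nat \<Rightarrow> 'k::field) set \<Rightarrow> ((nat \<Rightarrow> 'k) \<Rightarrow> nat \<Rightarrow> 'k) \<Rightarrow> bool" where
  "automorphism X \<phi> \<longleftrightarrow> bij_betw \<phi> X X \<and> poly_map coords X \<phi> \<and> poly_map coords X (inv_into X \<phi>)"

text \<open>The affine varieties \<open>U \<times> X\<close>, for the charts \<open>U\<close> of \<open>B\<close>, form an affine open cover of
  \<open>B \<times> X\<close>, and a morphism from an affine variety to the affine variety \<open>X\<close> is a polynomial map.\<close>

definition algebraic_family :: "'b set \<Rightarrow> ('b set \<times> ('b \<Rightarrow> nat \<Rightarrow> 'k::field)) set \<Rightarrow>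
    (nat \<Rightarrow> 'k) set \<Rightarrow> ('b \<Rightarrow> (nat \<Rightarrow> 'k) \<Rightarrow> nat \<Rightarrow> 'k) \<Rightarrow> bool" where
  "algebraic_family B \<A> X f \<longleftrightarrow> (\<forall>b\<in>B. automorphism X (f b)) \<and>
     (\<forall>(U, \<phi>)\<in>\<A>. poly_map coords2 (\<phi> ` U \<times> X) (\<lambda>(v, x). f (inv_into U \<phi> v) x))"

text \<open>Automorphisms are identified if they agree on \<open>X\<close>. Taking the points of the base in
  \<open>nat \<Rightarrow> 'k\<close> is no restriction: a point of a variety is determined by the number of a chart and
  its coordinates there, and an infinite field contains the natural numbers up to injection.\<close>

definition Aut0 :: "(nat \<Rightarrow> 'k::field) set \<Rightarrow> ((nat \<Rightarrow> 'k) \<Rightarrow> nat \<Rightarrow> 'k) set" where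
  "Aut0 X = {\<phi>. automorphism X \<phi> \<and>
     (\<exists>(B :: (nat \<Rightarrow> 'k) set) \<A> f. variety B \<A> \<and> irreducible_space (variety_topology B \<A>) \<and>
        algebraic_family B \<A> X f \<and>
        (\<exists>b\<^sub>0\<in>B. \<forall>x\<in>X. f b\<^sub>0 x = x) \<and> (\<exists>b\<in>B. \<forall>x\<in>X. f b x = \<phi> x))}"

definition Aut0_orbit :: "(nat \<Rightarrow> 'k::field) set \<Rightarrow> (nat \<Rightarrow> 'k) \<Rightarrow> (nat \<Rightarrow> 'k) set" where
  "Aut0_orbit X x = {\<phi> x |\<phi>. \<phi> \<in> Aut0 X}"


section \<open>Affine toric varieties\<close>

text \<open>The torus of rank \<open>d\<close>; entries from index \<open>d\<close> on are \<open>1\<close>, so that multiplication and unit are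
  pointwise.\<close>

definition torus :: "nat \<Rightarrow> (nat \<Rightarrow> 'k::field) set" where
  "torus d = {t. (\<forall>i<d. t i \<noteq> 0) \<and> (\<forall>i\<ge>d. t i = 1)}"

definition torus_coords :: "((nat \<Rightarrow> 'k::field) \<times> (nat \<Rightarrow> 'k) \<Rightarrow> 'k) set" where
  "torus_coords = range (\<lambda>i (t, x). t i) \<union> range (\<lambda>i (t, x). inverse (t i)) \<union>
     range (\<lambda>j (t, x). x j)"

definition torus_action ::
  "nat \<Rightarrow> (nat \<Rightarrow> 'k::field) set \<Rightarrow> ((nat \<Rightarrow> 'k) \<Rightarrow> (nat \<Rightarrow> 'k) \<Rightarrow> nat \<Rightarrow> 'k) \<Rightarrow> bool" where
  "torus_action d X act \<longleftrightarrow>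
     (\<forall>t\<in>torus d. \<forall>x\<in>X. act t x \<in> X) \<and>
     (\<forall>x\<in>X. act 1 x = x) \<and>
     (\<forall>s\<in>torus d. \<forall>t\<in>torus d. \<forall>x\<in>X. act (s * t) x = act s (act t x)) \<and>
     poly_map torus_coords (torus d \<times> X) (\<lambda>(t, x). act t x)"

definition torus_orbit ::
  "nat \<Rightarrow> ((nat \<Rightarrow> 'k::field) \<Rightarrow> (nat \<Rightarrow> 'k) \<Rightarrow> nat \<Rightarrow> 'k) \<Rightarrow> (nat \<Rightarrow> 'k) \<Rightarrow> (nat \<Rightarrow> 'k) set" where
  "torus_orbit d act x = {act t x |t. t \<in> torus d}"

definition affine_toric_variety ::
  "nat \<Rightarrow> (nat \<Rightarrow> 'k::field) set \<Rightarrow> ((nat \<Rightarrow> 'k) \<Rightarrow> (nat \<Rightarrow> 'k) \<Rightarrow> nat \<Rightarrow> 'k) \<Rightarrow> bool" where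
  "affine_toric_variety d X act \<longleftrightarrow>
     affine_variety X \<and> irreducible_space (zariski_on X) \<and> torus_action d X act \<and>
     (\<exists>x\<in>X. openin (zariski_on X) (torus_orbit d act x))"

definition char_lattice :: "nat \<Rightarrow> (nat \<Rightarrow> int) set" where
  "char_lattice d = {m. \<forall>i\<ge>d. m i = 0}"

definition character :: "nat \<Rightarrow> (nat \<Rightarrow> int) \<Rightarrow> (nat \<Rightarrow> 'k::field) \<Rightarrow> 'k" where
  "character d m t = (\<Prod>i<d. t i powi m i)"

text \<open>The homogeneous component of weight \<open>m\<close> of the coordinate ring, which is spanned by the
  regular function \<open>\<chi>\<^sup>m\<close> if nonzero. Regular functions on \<open>X\<close> are represented by polynomial
  functions on the ambient space.\<close>

definition weight_space :: "nat \<Rightarrow> (nat \<Rightarrow> 'k::field) set \<Rightarrow>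
    ((nat \<Rightarrow> 'k) \<Rightarrow> (nat \<Rightarrow> 'k) \<Rightarrow> nat \<Rightarrow> 'k) \<Rightarrow> (nat \<Rightarrow> int) \<Rightarrow> ((nat \<Rightarrow> 'k) \<Rightarrow> 'k) set" where
  "weight_space d X act m = {f \<in> gen_algebra coords.
     \<forall>t\<in>torus d. \<forall>x\<in>X. f (act t x) = character d m t * f x}"

definition weight_monoid :: "nat \<Rightarrow> (nat \<Rightarrow> 'k::field) set \<Rightarrow>
    ((nat \<Rightarrow> 'k) \<Rightarrow> (nat \<Rightarrow> 'k) \<Rightarrow> nat \<Rightarrow> 'k) \<Rightarrow> (nat \<Rightarrow> int) set" where
  "weight_monoid d X act = {m \<in> char_lattice d. \<exists>f\<in>weight_space d X act m. \<exists>x\<in>X. f x \<noteq> 0}"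


section \<open>Cones and Demazure roots of a monoid of characters\<close>

text \<open>The rational vector space \<open>M\<^sub>\<rat>\<close> is realised as the span of \<open>M\<close> in the space of rational
  sequences.\<close>

definition rat_vec :: "(nat \<Rightarrow> int) \<Rightarrow> nat \<Rightarrow> rat" where
  "rat_vec m i = of_int (m i)"

definition lattice_gen :: "(nat \<Rightarrow> int) set \<Rightarrow> (nat \<Rightarrow> int) set" where
  "lattice_gen P = \<Inter>{H. P \<subseteq> H \<and> 0 \<in> H \<and> (\<forall>a\<in>H. \<forall>b\<in>H. a - b \<in> H)}"

definition lattice_rat :: "(nat \<Rightarrow> int) set \<Rightarrow> (nat \<Rightarrow> rat) set" where
  "lattice_rat P = {(\<lambda>i. \<Sum>m\<in>F. c m * rat_vec m i) |F c. finite F \<and> F \<subseteq> lattice_gen P}"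

definition weight_cone :: "(nat \<Rightarrow> int) set \<Rightarrow> (nat \<Rightarrow> rat) set" where
  "weight_cone P = {(\<lambda>i. \<Sum>m\<in>F. c m * rat_vec m i) |F c. finite F \<and> F \<subseteq> P \<and> (\<forall>m\<in>F. 0 \<le> c m)}"

text \<open>\<open>N\<^sub>\<rat>\<close> is the space of linear forms on \<open>M\<^sub>\<rat>\<close>, extended by \<open>0\<close> off \<open>M\<^sub>\<rat>\<close> to make them
  unique as functions, so the pairing is application. \<open>N\<close> consists of the forms that are
  integral on \<open>M\<close>.\<close>

definition dual_rat :: "(nat \<Rightarrow> int) set \<Rightarrow> ((nat \<Rightarrow> rat) \<Rightarrow> rat) set" where
  "dual_rat P = {u. (\<forall>v\<in>lattice_rat P. \<forall>w\<in>lattice_rat P. u (v + w) = u v + u w) \<and>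
     (\<forall>c. \<forall>v\<in>lattice_rat P. u (\<lambda>i. c * v i) = c * u v) \<and>
     (\<forall>v. v \<notin> lattice_rat P \<longrightarrow> u v = 0)}"

definition dual_lattice :: "(nat \<Rightarrow> int) set \<Rightarrow> ((nat \<Rightarrow> rat) \<Rightarrow> rat) set" where
  "dual_lattice P = {u \<in> dual_rat P. \<forall>m\<in>lattice_gen P. u (rat_vec m) \<in> \<int>}"

definition dual_cone :: "(nat \<Rightarrow> int) set \<Rightarrow> ((nat \<Rightarrow> rat) \<Rightarrow> rat) set" where
  "dual_cone P = {u \<in> dual_rat P. \<forall>v\<in>weight_cone P. 0 \<le> u v}"

definition is_face :: "(nat \<Rightarrow> int) set \<Rightarrow> (nat \<Rightarrow> rat) set \<Rightarrow> bool" where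
  "is_face P \<tau> \<longleftrightarrow> (\<exists>u\<in>dual_cone P. \<tau> = {v \<in> weight_cone P. u v = 0})"

text \<open>Rays are the one-dimensional faces of the dual cone.\<close>

definition is_ray :: "(nat \<Rightarrow> int) set \<Rightarrow> ((nat \<Rightarrow> rat) \<Rightarrow> rat) set \<Rightarrow> bool" where
  "is_ray P \<rho> \<longleftrightarrow> (\<exists>v\<in>weight_cone P. \<rho> = {u \<in> dual_cone P. u v = 0}) \<and>
     (\<exists>u. u \<noteq> 0 \<and> \<rho> = {(\<lambda>v. c * u v) |c. 0 \<le> c})"

definition primitive :: "(nat \<Rightarrow> int) set \<Rightarrow> ((nat \<Rightarrow> rat) \<Rightarrow> rat) \<Rightarrow> bool" where
  "primitive P p \<longleftrightarrow> p \<in> dual_lattice P \<and> p \<noteq> 0 \<and>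
     (\<forall>q\<in>dual_lattice P. \<forall>k::nat. p = (\<lambda>v. of_nat k * q v) \<longrightarrow> k = 1)"

text \<open>Each ray contains exactly one primitive vector and different rays have different ones, so
  rays are represented below by their primitive vectors.\<close>

definition ray_vectors :: "(nat \<Rightarrow> int) set \<Rightarrow> ((nat \<Rightarrow> rat) \<Rightarrow> rat) set" where
  "ray_vectors P = {p. primitive P p \<and> (\<exists>\<rho>. is_ray P \<rho> \<and> p \<in> \<rho>)}"

definition demazure_root :: "(nat \<Rightarrow> int) set \<Rightarrow> (nat \<Rightarrow> int) \<Rightarrow> bool" where
  "demazure_root P e \<longleftrightarrow> e \<in> lattice_gen P \<and>
     (\<exists>p\<in>ray_vectors P. p (rat_vec e) = -1 \<and>
        (\<forall>p'\<in>ray_vectors P. p' \<noteq> p \<longrightarrow> 0 \<le> p' (rat_vec e)))"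

definition normal_vectors :: "(nat \<Rightarrow> int) set \<Rightarrow> (nat \<Rightarrow> rat) set \<Rightarrow> ((nat \<Rightarrow> rat) \<Rightarrow> rat) set" where
  "normal_vectors P \<tau> = {p \<in> ray_vectors P. \<forall>v\<in>\<tau>. p v = 0}"

definition tau_root :: "(nat \<Rightarrow> int) set \<Rightarrow> (nat \<Rightarrow> rat) set \<Rightarrow> (nat \<Rightarrow> int) \<Rightarrow> bool" where
  "tau_root P \<tau> e \<longleftrightarrow> demazure_root P e \<and>
     (\<exists>p\<in>normal_vectors P \<tau>. p (rat_vec e) = -1 \<and>
        (\<forall>p'\<in>normal_vectors P \<tau>. p' \<noteq> p \<longrightarrow> p' (rat_vec e) = 0))"

definition admissible :: "(nat \<Rightarrow> int) set \<Rightarrow> (nat \<Rightarrow> int) \<Rightarrow> bool" where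
  "admissible P e \<longleftrightarrow> demazure_root P e \<and>
     (\<forall>m\<in>P. rat_vec (e + m) \<in> weight_cone P \<longrightarrow> e + m \<in> P)"

text \<open>\<open>Q\<close> is the orbit \<open>O\<^sub>\<tau>\<close>: the vanishing ideal of its closure is the sum of the homogeneous
  components with weights in \<open>P \<setminus> \<tau>\<close>.\<close>

definition orbit_of_face :: "nat \<Rightarrow> (nat \<Rightarrow> 'k::field) set \<Rightarrow>
    ((nat \<Rightarrow> 'k) \<Rightarrow> (nat \<Rightarrow> 'k) \<Rightarrow> nat \<Rightarrow> 'k) \<Rightarrow> (nat \<Rightarrow> rat) set \<Rightarrow> (nat \<Rightarrow> 'k) set \<Rightarrow> bool" where
  "orbit_of_face d X act \<tau> Q \<longleftrightarrow> (\<exists>x\<in>X. Q = torus_orbit d act x) \<and>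
     (\<forall>f\<in>gen_algebra coords.
        (\<forall>x\<in>zariski_on X closure_of Q. f x = 0) \<longleftrightarrow>
        (\<exists>F c. finite F \<and> F \<subseteq> {m \<in> weight_monoid d X act. rat_vec m \<notin> \<tau>} \<and>
           (\<forall>m\<in>F. c m \<in> weight_space d X act m) \<and> (\<forall>x\<in>X. f x = (\<Sum>m\<in>F. c m x))))"

end

theory Submission
  imports Defs
begin

text \<open>Points of \<open>X\<close> are monoid homomorphisms \<open>\<gamma>\<close> from \<open>P\<close> to the ground field, and the support of \<open>\<gamma>\<close> is
  the intersection of \<open>P\<close> with a face of the cone. Since \<open>Aut(X)\<^sup>0\<close> consists of members of irreducible
  families and is closed under composition, the supports on one orbit are directed, so the orbit contains a
  point \<open>z\<close> of largest support; as the torus lies in \<open>Aut(X)\<^sup>0\<close>, the orbit has the same closure as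
  \<open>T z = O\<^sub>\<tau>\<close>. An admissible \<open>\<tau>\<close>-root \<open>e\<close> with ray vector \<open>p\<close> gives the automorphisms
  \<open>\<gamma> \<mapsto> (m \<mapsto> \<Sum>\<^sub>k binom(p(m), k) s\<^sup>k \<gamma>(m + k e))\<close>. Convex geometry provides a weight in \<open>P\<close> that is positive
  on \<open>p\<close> and zero on the other normals of \<open>\<tau>\<close>; descending from it along \<open>e\<close>, which stays in \<open>P\<close> by
  admissibility, yields \<open>m \<in> P\<close> with \<open>p(m) = 1\<close> and \<open>m + e \<in> \<tau>\<close>. The automorphisms then add \<open>m \<notin> \<tau>\<close> to the
  support of \<open>z\<close>, a contradiction.\<close>


section \<open>Rational cones\<close>

text \<open>Since X need not be normal, P may miss lattice points of its cone, and a point of the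
  cone with prescribed values on the rays need not be a weight. The weight for a \<tau>-root is
  therefore extracted: for w far inside \<tau> the point w - e lies in the cone, has value 1 on p
  and 0 on the other normals of \<tau>. Written as a conical combination of elements of P, it has a
  summand that is positive on p, and every summand with positive coefficient vanishes on the other
  normals. Its value on p may exceed 1, hence the descent. The binomial formula is the exponential
  of s times the derivation sending \<chi>^m to p(m) \<chi>^(m+e): p drops by one at each
  application, so the k-th divided power has coefficient binom(p(m), k). A largest support exists
  because a support is determined by its trace on finitely many generators of P. It fixes the
  closure for the following reason: if a function vanishes on T z, independence of characters kills
  its coefficients on the support of z, and all remaining characters vanish on the whole
  orbit.\<close>

definition linear_form :: "(('n \<Rightarrow> 'a::field) \<Rightarrow> 'a) \<Rightarrow> bool" where
  "linear_form f \<longleftrightarrow> (\<forall>v w. f (v + w) = f v + f w) \<and> (\<forall>c v. f (\<lambda>k. c * v k) = c * f v)"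

lemma linear_form_add: "linear_form f \<Longrightarrow> f (v + w) = f v + f w"
  and linear_form_scale: "linear_form f \<Longrightarrow> f (\<lambda>k. c * v k) = c * f v"
  by (auto simp: linear_form_def)

text \<open>Induction on the index set, for all vectors at once, so that the coordinate type may be
  infinite. If the form separating v from the smaller cone is negative on the new vector, the
  induction hypothesis is applied a second time, to the images under the projection onto the kernel
  of that form.\<close>

lemma farkas:
  fixes a :: "'i \<Rightarrow> 'n \<Rightarrow> 'a::linordered_field"
  assumes "finite I"
  shows "(\<exists>c. (\<forall>i\<in>I. 0 \<le> c i) \<and> v = (\<lambda>k. \<Sum>i\<in>I. c i * a i k)) \<or>
         (\<exists>f. linear_form f \<and> (\<forall>i\<in>I. 0 \<le> f (a i)) \<and> f v < 0)"
  using assms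
proof (induction I arbitrary: a v rule: finite_induct)
  case empty
  show ?case
  proof (cases "v = (\<lambda>_. 0)")
    case True then show ?thesis by auto
  next
    case False
    then obtain k where k: "v k \<noteq> 0" by auto
    \<comment> \<open>The factor \<open>v k\<close> makes the value at \<open>v\<close> minus a
      square, whatever the sign of \<open>v k\<close>.\<close>
    have "linear_form (\<lambda>x. - (v k * x k))"
      by (auto simp: linear_form_def plus_fun_def algebra_simps)
    moreover have "- (v k * v k) < 0" using k by (auto simp: zero_less_mult_iff linorder_neq_iff)
    ultimately show ?thesis by (intro disjI2 exI[of _ "\<lambda>x. - (v k * x k)"]) auto
  qed
next
  case (insert j I)
  show ?case
  proof (cases "\<exists>c. (\<forall>i\<in>I. 0 \<le> c i) \<and> v = (\<lambda>k. \<Sum>i\<in>I. c i * a i k)")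
    case True
    then obtain c where c: "\<forall>i\<in>I. 0 \<le> c i" "v = (\<lambda>k. \<Sum>i\<in>I. c i * a i k)" by blast
    have "v = (\<lambda>k. \<Sum>i\<in>insert j I. (c(j := 0)) i * a i k)"
      using insert.hyps unfolding c(2) by (auto intro!: sum.cong)
    then show ?thesis using c(1) by (intro disjI1 exI[of _ "c(j := 0)"]) auto
  next
    case False
    with insert.IH obtain f where f: "linear_form f" "\<forall>i\<in>I. 0 \<le> f (a i)" "f v < 0" by blast
    show ?thesis
    proof (cases "0 \<le> f (a j)")
      case True then show ?thesis using f by blast
    next
      case neg: False
      \<comment> \<open>Project along \<open>a j\<close> onto the kernel of \<open>f\<close>.\<close>
      define pr where "pr x = (\<lambda>k. x k - f x / f (a j) * a j k)" for x
      from insert.IH[of "pr v" "\<lambda>i. pr (a i)"] show ?thesis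
      proof (elim disjE exE conjE)
        fix c assume c: "\<forall>i\<in>I. 0 \<le> c i" "pr v = (\<lambda>k. \<Sum>i\<in>I. c i * pr (a i) k)"
        \<comment> \<open>Undoing the projection forces this coefficient of \<open>a j\<close>: the
          multiple removed from \<open>v\<close> minus those removed from the \<open>a i\<close>. It
          is nonnegative because \<open>f v\<close> and \<open>f (a j)\<close> are negative and the
          sum is not.\<close>
        define b where "b = f v / f (a j) - (\<Sum>i\<in>I. c i * f (a i)) / f (a j)"
        have "0 \<le> (\<Sum>i\<in>I. c i * f (a i))" using c(1) f(2) by (intro sum_nonneg) auto
        then have "0 \<le> b" using neg f(3) unfolding b_def
          by (simp add: divide_simps)
        moreover have "v k = (\<Sum>i\<in>insert j I. (c(j := b)) i * a i k)" for k
        proof -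
          have "v k = f v / f (a j) * a j k + pr v k" by (simp add: pr_def)
          also have "\<dots> = f v / f (a j) * a j k + (\<Sum>i\<in>I. c i * (a i k - f (a i) / f (a j) * a j k))"
            unfolding c(2) by (simp add: pr_def)
          also have "\<dots> = b * a j k + (\<Sum>i\<in>I. c i * a i k)"
            by (simp add: b_def algebra_simps sum_subtractf sum_divide_distrib sum_distrib_left)
          also have "(\<Sum>i\<in>I. c i * a i k) = (\<Sum>i\<in>I. (c(j := b)) i * a i k)"
            using insert.hyps by (intro sum.cong) auto
          finally show ?thesis using insert.hyps by simp
        qed
        ultimately show ?thesis using c(1) by (intro disjI1 exI[of _ "c(j := b)"]) auto
      next
        fix g assume g: "linear_form g" "\<forall>i\<in>I. 0 \<le> g (pr (a i))" "g (pr v) < 0"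
        have "pr (v + w) = pr v + pr w" for v w
          by (auto simp: pr_def plus_fun_def linear_form_add[OF f(1), unfolded plus_fun_def]
              algebra_simps add_divide_distrib)
        moreover have "pr (\<lambda>k. c * v k) = (\<lambda>k. c * pr v k)" for c v
          by (auto simp: pr_def linear_form_scale[OF f(1)] algebra_simps)
        \<comment> \<open>Composed with the projection, \<open>g\<close> vanishes on
          \<open>a j\<close> and keeps its signs on the other vectors and on
          \<open>v\<close>.\<close>
        ultimately have "linear_form (\<lambda>x. g (pr x))"
          using g(1) by (simp add: linear_form_def)
        moreover have "g (pr (a j)) = 0"
          using neg linear_form_scale[OF g(1), of 0 "\<lambda>_. 0"] by (simp add: pr_def)
        ultimately show ?thesis using g by (intro disjI2 exI[of _ "\<lambda>x. g (pr x)"]) auto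
      qed
    qed
  qed
qed

lemma common_denominator:
  fixes q :: "'i \<Rightarrow> rat"
  assumes "finite I"
  shows "\<exists>N::nat. 0 < N \<and> (\<forall>i\<in>I. of_nat N * q i \<in> \<int>)"
  using assms
proof (induction I rule: finite_induct)
  case empty then show ?case by (intro exI[of _ 1]) simp
next
  case (insert j I)
  then obtain N where N: "0 < N" "\<forall>i\<in>I. of_nat N * q i \<in> \<int>" by blast
  obtain a b where ab: "q j = of_int a / of_int b" "0 < b"
    by (cases "q j") (auto simp: Fract_of_int_quotient)
  have b: "of_nat (nat b) = (of_int b :: rat)" using ab(2) by simp
  have "of_nat (N * nat b) * q j = of_int (int N * a)" using ab by (simp add: b)
  then have "of_nat (N * nat b) * q j \<in> \<int>" by (metis Ints_of_int)
  moreover have "of_nat (N * nat b) * q i \<in> \<int>" if "i \<in> I" for i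
    using N(2) that Ints_mult[of "of_int b" "of_nat N * q i"] by (simp add: b algebra_simps)
  ultimately show ?case using N(1) ab(2) by (intro exI[of _ "N * nat b"]) auto
qed

section \<open>Lattice, rational span and cone of a set of characters\<close>

lemma sum_fun_apply: "(\<Sum>i\<in>I. f i) x = (\<Sum>i\<in>I. f i x)"
  by (induction I rule: infinite_finite_induct) (auto simp: zero_fun_def plus_fun_def)

lemma rat_vec_add: "rat_vec (a + b) = rat_vec a + rat_vec b"
  and rat_vec_0: "rat_vec 0 = 0"
  by (auto simp: rat_vec_def plus_fun_def zero_fun_def)

lemma lattice_gen_superset: "P \<subseteq> lattice_gen P"
  by (auto simp: lattice_gen_def)

lemma lattice_gen_0: "0 \<in> lattice_gen P"
  by (auto simp: lattice_gen_def)

lemma lattice_gen_diff: "a \<in> lattice_gen P \<Longrightarrow> b \<in> lattice_gen P \<Longrightarrow> a - b \<in> lattice_gen P"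
  by (auto simp: lattice_gen_def)

lemma lattice_gen_add: "a \<in> lattice_gen P \<Longrightarrow> b \<in> lattice_gen P \<Longrightarrow> a + b \<in> lattice_gen P"
  using lattice_gen_diff[of a P "0 - b"] lattice_gen_diff[OF lattice_gen_0, of b P] by simp

lemma lattice_gen_least:
  assumes "P \<subseteq> H" "0 \<in> H" "\<And>a b. a \<in> H \<Longrightarrow> b \<in> H \<Longrightarrow> a - b \<in> H"
  shows "lattice_gen P \<subseteq> H"
  using assms by (auto simp: lattice_gen_def)

lemma combination_add:
  fixes c c' :: "'m \<Rightarrow> 'a::comm_ring_1"
  assumes "finite F" "finite F'"
  defines "c'' \<equiv> \<lambda>m. (if m \<in> F then c m else 0) + (if m \<in> F' then c' m else 0)"
  shows "(\<lambda>i. \<Sum>m\<in>F. c m * r m i) + (\<lambda>i. \<Sum>m\<in>F'. c' m * r m i) = (\<lambda>i. \<Sum>m\<in>F \<union> F'. c'' m * r m i)"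
proof
  fix i
  have "(\<Sum>m\<in>F. c m * r m i) = (\<Sum>m\<in>F \<union> F'. (if m \<in> F then c m else 0) * r m i)"
    using assms(1,2) by (intro sum.mono_neutral_cong_left) auto
  moreover have "(\<Sum>m\<in>F'. c' m * r m i) = (\<Sum>m\<in>F \<union> F'. (if m \<in> F' then c' m else 0) * r m i)"
    using assms(1,2) by (intro sum.mono_neutral_cong_left) auto
  ultimately show "((\<lambda>i. \<Sum>m\<in>F. c m * r m i) + (\<lambda>i. \<Sum>m\<in>F'. c' m * r m i)) i
      = (\<Sum>m\<in>F \<union> F'. c'' m * r m i)"
    unfolding c''_def by (simp only: plus_fun_def distrib_right sum.distrib)
qed

lemma lattice_rat_add:
  assumes "v \<in> lattice_rat P" "w \<in> lattice_rat P"
  shows "v + w \<in> lattice_rat P"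
proof -
  obtain F c F' c' where v: "v = (\<lambda>i. \<Sum>m\<in>F. c m * rat_vec m i)" "finite F" "F \<subseteq> lattice_gen P"
    and w: "w = (\<lambda>i. \<Sum>m\<in>F'. c' m * rat_vec m i)" "finite F'" "F' \<subseteq> lattice_gen P"
    using assms unfolding lattice_rat_def by blast
  show ?thesis
    unfolding v(1) w(1) combination_add[OF v(2) w(2)] lattice_rat_def using v w
    by (intro CollectI exI[of _ "F \<union> F'"] exI conjI refl) auto
qed

lemma lattice_rat_scale:
  assumes "v \<in> lattice_rat P"
  shows "(\<lambda>i. k * v i) \<in> lattice_rat P"
proof -
  obtain F c where v: "v = (\<lambda>i. \<Sum>m\<in>F. c m * rat_vec m i)" "finite F" "F \<subseteq> lattice_gen P"
    using assms unfolding lattice_rat_def by blast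
  have "(\<lambda>i. k * v i) = (\<lambda>i. \<Sum>m\<in>F. (k * c m) * rat_vec m i)"
    unfolding v(1) by (simp add: sum_distrib_left mult.assoc)
  then show ?thesis using v(2,3) unfolding lattice_rat_def
    by (intro CollectI exI[of _ F] exI[of _ "\<lambda>m. k * c m"]) auto
qed

lemma rat_vec_in_lattice_rat:
  assumes "m \<in> lattice_gen P"
  shows "rat_vec m \<in> lattice_rat P"
  unfolding lattice_rat_def using assms
  by (intro CollectI exI[of _ "{m}"] exI[of _ "\<lambda>_. 1"]) auto

lemma lattice_rat_0: "0 \<in> lattice_rat P"
  using rat_vec_in_lattice_rat[OF lattice_gen_0] by (simp add: rat_vec_0)

lemma weight_cone_add:
  assumes "v \<in> weight_cone P" "w \<in> weight_cone P"
  shows "v + w \<in> weight_cone P"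
proof -
  obtain F c F' c' where v: "v = (\<lambda>i. \<Sum>m\<in>F. c m * rat_vec m i)" "finite F" "F \<subseteq> P" "\<forall>m\<in>F. 0 \<le> c m"
    and w: "w = (\<lambda>i. \<Sum>m\<in>F'. c' m * rat_vec m i)" "finite F'" "F' \<subseteq> P" "\<forall>m\<in>F'. 0 \<le> c' m"
    using assms unfolding weight_cone_def by blast
  show ?thesis
    unfolding v(1) w(1) combination_add[OF v(2) w(2)] weight_cone_def using v w
    by (intro CollectI exI[of _ "F \<union> F'"] exI conjI refl) auto
qed

lemma rat_vec_in_weight_cone: "m \<in> P \<Longrightarrow> rat_vec m \<in> weight_cone P"
  unfolding weight_cone_def by (intro CollectI exI[of _ "{m}"] exI[of _ "\<lambda>_. 1"]) auto

lemma weight_cone_0: "0 \<in> weight_cone P"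
  unfolding weight_cone_def by (intro CollectI exI[of _ "{}"]) (auto simp: zero_fun_def)

lemma weight_cone_sum:
  assumes "\<And>i. i \<in> I \<Longrightarrow> v i \<in> weight_cone P"
  shows "(\<Sum>i\<in>I. v i) \<in> weight_cone P"
  using assms by (induction I rule: infinite_finite_induct) (auto intro: weight_cone_0 weight_cone_add)

lemma weight_cone_subset: "weight_cone P \<subseteq> lattice_rat P"
  unfolding weight_cone_def lattice_rat_def using lattice_gen_superset by blast

section \<open>Linear forms on the span and the dual cone\<close>

lemma dual_rat_add:
  "u \<in> dual_rat P \<Longrightarrow> v \<in> lattice_rat P \<Longrightarrow> w \<in> lattice_rat P \<Longrightarrow> u (v + w) = u v + u w"
  and dual_rat_scale: "u \<in> dual_rat P \<Longrightarrow> v \<in> lattice_rat P \<Longrightarrow> u (\<lambda>i. c * v i) = c * u v"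
  and dual_rat_outside: "u \<in> dual_rat P \<Longrightarrow> v \<notin> lattice_rat P \<Longrightarrow> u v = 0"
  by (auto simp: dual_rat_def)

lemma dual_rat_0: "u \<in> dual_rat P \<Longrightarrow> u 0 = 0"
  using dual_rat_scale[OF _ lattice_rat_0, of u P 0] by (simp add: zero_fun_def)

lemma dual_rat_combination:
  assumes "u \<in> dual_rat P" "finite F" "F \<subseteq> lattice_gen P"
  shows "u (\<lambda>i. \<Sum>m\<in>F. c m * rat_vec m i) = (\<Sum>m\<in>F. c m * u (rat_vec m))"
proof -
  have "(\<lambda>i. \<Sum>m\<in>F. c m * rat_vec m i) \<in> lattice_rat P \<and> ?thesis" using assms(2,3)
  proof (induction F rule: finite_induct)
    case empty
    then show ?case using dual_rat_0[OF assms(1)] lattice_rat_0 by (simp add: zero_fun_def)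
  next
    case (insert m F)
    have eq: "(\<lambda>i. \<Sum>m\<in>insert m F. c m * rat_vec m i)
        = (\<lambda>i. c m * rat_vec m i) + (\<lambda>i. \<Sum>m\<in>F. c m * rat_vec m i)"
      using insert.hyps by (auto simp: plus_fun_def)
    have "rat_vec m \<in> lattice_rat P" using insert.prems by (simp add: rat_vec_in_lattice_rat)
    then show ?case
      using insert lattice_rat_scale[of "rat_vec m" P "c m"] unfolding eq
      by (auto intro: lattice_rat_add simp: dual_rat_add[OF assms(1)] dual_rat_scale[OF assms(1)])
  qed
  then show ?thesis by blast
qed

lemma dual_rat_rat_vec_add:
  assumes "u \<in> dual_rat P" "a \<in> lattice_gen P" "b \<in> lattice_gen P"
  shows "u (rat_vec (a + b)) = u (rat_vec a) + u (rat_vec b)"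
  using assms by (simp add: rat_vec_add dual_rat_add rat_vec_in_lattice_rat)

lemma dual_rat_rat_vec_diff:
  assumes "u \<in> dual_rat P" "a \<in> lattice_gen P" "b \<in> lattice_gen P"
  shows "u (rat_vec (a - b)) = u (rat_vec a) - u (rat_vec b)"
  using dual_rat_rat_vec_add[OF assms(1) lattice_gen_diff[OF assms(2,3)] assms(3)] by simp

text \<open>P generates the lattice, the lattice spans \<open>lattice_rat P\<close>, and off this
  span both forms are 0 by convention.\<close>

lemma dual_rat_eqI:
  assumes "u \<in> dual_rat P" "w \<in> dual_rat P" "\<And>m. m \<in> P \<Longrightarrow> u (rat_vec m) = w (rat_vec m)"
  shows "u = w"
proof
  fix v
  have "lattice_gen P \<subseteq> {m \<in> lattice_gen P. u (rat_vec m) = w (rat_vec m)}"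
    using assms lattice_gen_superset[of P] dual_rat_rat_vec_diff[OF assms(1)]
      dual_rat_rat_vec_diff[OF assms(2)] lattice_gen_diff lattice_gen_0
      dual_rat_0[OF assms(1)] dual_rat_0[OF assms(2)]
    by (intro lattice_gen_least) (auto simp: rat_vec_0)
  then have eq: "u (rat_vec m) = w (rat_vec m)" if "m \<in> lattice_gen P" for m using that by blast
  show "u v = w v"
  proof (cases "v \<in> lattice_rat P")
    case True
    then obtain F c where v: "v = (\<lambda>i. \<Sum>m\<in>F. c m * rat_vec m i)" "finite F" "F \<subseteq> lattice_gen P"
      unfolding lattice_rat_def by blast
    show ?thesis
      unfolding v(1) dual_rat_combination[OF assms(1) v(2,3)] dual_rat_combination[OF assms(2) v(2,3)]
      using v(3) eq by (intro sum.cong) auto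
  next
    case False then show ?thesis using assms(1,2) by (simp add: dual_rat_outside)
  qed
qed

lemma dual_rat_linear_combination:
  assumes "u \<in> dual_rat P" "w \<in> dual_rat P"
  shows "(\<lambda>v. a * u v + b * w v) \<in> dual_rat P"
  using assms unfolding dual_rat_def by (auto simp: algebra_simps)

lemma dual_rat_sum:
  assumes "\<And>i. i \<in> I \<Longrightarrow> U i \<in> dual_rat P"
  shows "(\<lambda>v. \<Sum>i\<in>I. U i v) \<in> dual_rat P"
  unfolding dual_rat_def
proof (intro CollectI conjI ballI allI impI)
  show "(\<Sum>i\<in>I. U i (v + w)) = (\<Sum>i\<in>I. U i v) + (\<Sum>i\<in>I. U i w)"
    if "v \<in> lattice_rat P" "w \<in> lattice_rat P" for v w
    unfolding sum.distrib[symmetric] using dual_rat_add[OF assms] that by (intro sum.cong) auto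
  show "(\<Sum>i\<in>I. U i (\<lambda>i. c * v i)) = c * (\<Sum>i\<in>I. U i v)" if "v \<in> lattice_rat P" for c v
    unfolding sum_distrib_left using dual_rat_scale[OF assms] that by (intro sum.cong) auto
  show "(\<Sum>i\<in>I. U i v) = 0" if "v \<notin> lattice_rat P" for v
    using dual_rat_outside[OF assms] that by (intro sum.neutral) auto
qed

lemma dual_rat_multiple: "u \<in> dual_rat P \<Longrightarrow> (\<lambda>v. a * u v) \<in> dual_rat P"
  using dual_rat_linear_combination[of u P u a 0] by simp

lemma dual_coneD: "u \<in> dual_cone P \<Longrightarrow> u \<in> dual_rat P"
  "u \<in> dual_cone P \<Longrightarrow> v \<in> weight_cone P \<Longrightarrow> 0 \<le> u v"
  "u \<in> dual_cone P \<Longrightarrow> m \<in> P \<Longrightarrow> 0 \<le> u (rat_vec m)"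
  by (auto simp: dual_cone_def rat_vec_in_weight_cone)

lemma dual_coneI:
  assumes "u \<in> dual_rat P" "\<And>m. m \<in> P \<Longrightarrow> 0 \<le> u (rat_vec m)"
  shows "u \<in> dual_cone P"
proof -
  have "0 \<le> u v" if "v \<in> weight_cone P" for v
  proof -
    obtain F c where v: "v = (\<lambda>i. \<Sum>m\<in>F. c m * rat_vec m i)" "finite F" "F \<subseteq> P" "\<forall>m\<in>F. 0 \<le> c m"
      using \<open>v \<in> weight_cone P\<close> unfolding weight_cone_def by blast
    have "u v = (\<Sum>m\<in>F. c m * u (rat_vec m))"
      unfolding v(1) using v(3) lattice_gen_superset[of P]
      by (intro dual_rat_combination[OF assms(1) v(2)]) blast
    also have "0 \<le> \<dots>" using v(3,4) assms(2) by (intro sum_nonneg) auto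
    finally show ?thesis .
  qed
  then show ?thesis using assms(1) by (simp add: dual_cone_def)
qed

text \<open>Adapts the forms on all rational sequences that \<open>farkas\<close> produces to the
  convention that a dual form is 0 off the span.\<close>

lemma linear_form_restrict:
  assumes "linear_form f"
  shows "(\<lambda>v. if v \<in> lattice_rat P then f v else 0) \<in> dual_rat P"
  using assms lattice_rat_scale
  by (auto simp: dual_rat_def linear_form_add linear_form_scale lattice_rat_add)

lemma ray_vectors_dual_cone: "p \<in> ray_vectors P \<Longrightarrow> p \<in> dual_cone P"
  by (auto simp: ray_vectors_def is_ray_def)

lemma ray_vectors_integral:
  "p \<in> ray_vectors P \<Longrightarrow> m \<in> lattice_gen P \<Longrightarrow> p (rat_vec m) \<in> \<int>"
  by (auto simp: ray_vectors_def primitive_def dual_lattice_def)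

text \<open>Generation is stated as minimality: a property that holds at 0 and on G and is inherited
  by sums holds on P. All arguments about generators below take this form.\<close>

locale fg_monoid =
  fixes P G :: "(nat \<Rightarrow> int) set"
  assumes finite_G: "finite G" and G_subset: "G \<subseteq> P"
    and zero_in_P: "0 \<in> P" and add_in_P: "a \<in> P \<Longrightarrow> b \<in> P \<Longrightarrow> a + b \<in> P"
    and P_least: "G \<subseteq> H \<Longrightarrow> 0 \<in> H \<Longrightarrow> (\<And>a b. a \<in> H \<Longrightarrow> b \<in> H \<Longrightarrow> a + b \<in> H) \<Longrightarrow> P \<subseteq> H"
begin

section \<open>Biduality for the finitely generated cone\<close>

lemma P_lattice: "m \<in> P \<Longrightarrow> m \<in> lattice_gen P"
  using lattice_gen_superset by blast

lemma add_P: "u \<in> dual_rat P \<Longrightarrow> a \<in> P \<Longrightarrow> b \<in> P \<Longrightarrow> u (rat_vec (a + b)) = u (rat_vec a) + u (rat_vec b)"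
  by (simp add: dual_rat_rat_vec_add P_lattice)

lemma dual_coneI_gen:
  assumes "u \<in> dual_rat P" "\<And>g. g \<in> G \<Longrightarrow> 0 \<le> u (rat_vec g)"
  shows "u \<in> dual_cone P"
proof -
  have "P \<subseteq> {m \<in> P. 0 \<le> u (rat_vec m)}"
    using assms G_subset zero_in_P add_in_P dual_rat_0[OF assms(1)]
    by (intro P_least) (auto simp: add_P rat_vec_0)
  then show ?thesis using assms(1) by (intro dual_coneI) auto
qed

lemma zero_on_P:
  assumes "u \<in> dual_rat P" "\<And>g. g \<in> G \<Longrightarrow> u (rat_vec g) = 0"
  shows "u = 0"
proof -
  have "P \<subseteq> {m \<in> P. u (rat_vec m) = 0}"
    using assms G_subset zero_in_P add_in_P dual_rat_0[OF assms(1)]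
    by (intro P_least) (auto simp: add_P rat_vec_0)
  then show ?thesis using assms(1) 
    by (intro dual_rat_eqI[of _ P]) (auto simp: dual_rat_def)
qed

text \<open>Biduality, by Farkas for the generators: were v outside the cone, the separating form
  cut off outside the span would be an element of the dual cone that is negative at v.\<close>

lemma weight_coneI:
  assumes v: "v \<in> lattice_rat P" and pos: "\<And>u. u \<in> dual_cone P \<Longrightarrow> 0 \<le> u v"
  shows "v \<in> weight_cone P"
  using farkas[OF finite_G, of v rat_vec]
proof (elim disjE exE conjE)
  fix c assume "\<forall>i\<in>G. 0 \<le> c i" "v = (\<lambda>k. \<Sum>i\<in>G. c i * rat_vec i k)"
  then show ?thesis using finite_G G_subset unfolding weight_cone_def by blast
next
  fix f assume f: "linear_form f" "\<forall>i\<in>G. 0 \<le> f (rat_vec i)" "f v < 0"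
  define u where "u v = (if v \<in> lattice_rat P then f v else 0)" for v
  have "u \<in> dual_rat P" unfolding u_def by (rule linear_form_restrict[OF f(1)])
  then have "u \<in> dual_cone P" using f(2) by (intro dual_coneI_gen) (auto simp: u_def)
  then show ?thesis using pos[of u] f(3) v by (simp add: u_def)
qed

section \<open>Rays of the dual cone\<close>

definition tight :: "((nat \<Rightarrow> rat) \<Rightarrow> rat) \<Rightarrow> (nat \<Rightarrow> int) set" where
  "tight u = {g \<in> G. u (rat_vec g) = 0}"

text \<open>The sum \<open>s\<close> of the values on the generators turns the positive lattice
  multiples of u into positive integers \<open>c * s\<close>, so one of them is least. If it were k
  times a lattice form with k > 1, dividing by k would give a smaller one.\<close>

lemma exists_primitive_multiple:
  assumes u: "u \<in> dual_cone P" "u \<noteq> 0"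
  shows "\<exists>c>0. primitive P (\<lambda>v. c * u v)"
proof -
  define s where "s = (\<Sum>g\<in>G. u (rat_vec g))"
  have nonneg: "0 \<le> u (rat_vec g)" if "g \<in> G" for g
    using dual_coneD(3)[OF u(1)] G_subset that by blast
  have "s \<noteq> 0"
    using zero_on_P[OF dual_coneD(1)[OF u(1)]] u(2) nonneg finite_G
    by (auto simp: s_def sum_nonneg_eq_0_iff)
  moreover have "0 \<le> s" unfolding s_def using nonneg by (rule sum_nonneg)
  ultimately have s: "0 < s" by simp
  have lattice: "(\<lambda>v. c * u v) \<in> dual_lattice P \<longleftrightarrow> (\<forall>g\<in>G. c * u (rat_vec g) \<in> \<int>)" for c
  proof
    assume "(\<lambda>v. c * u v) \<in> dual_lattice P"
    then show "\<forall>g\<in>G. c * u (rat_vec g) \<in> \<int>"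
      using G_subset P_lattice by (auto simp: dual_lattice_def)
  next
    assume *: "\<forall>g\<in>G. c * u (rat_vec g) \<in> \<int>"
    let ?w = "\<lambda>v. c * u v"
    have w: "?w \<in> dual_rat P" by (rule dual_rat_multiple[OF dual_coneD(1)[OF u(1)]])
    have "P \<subseteq> {m \<in> P. ?w (rat_vec m) \<in> \<int>}"
      using * G_subset zero_in_P add_in_P dual_rat_0[OF w]
      by (intro P_least) (auto simp: add_P[OF w] rat_vec_0)
    then have "lattice_gen P \<subseteq> {m \<in> lattice_gen P. ?w (rat_vec m) \<in> \<int>}"
      using P_lattice lattice_gen_0 lattice_gen_diff dual_rat_0[OF w]
      by (intro lattice_gen_least) (auto simp: dual_rat_rat_vec_diff[OF w] rat_vec_0)
    then show "?w \<in> dual_lattice P" using w by (auto simp: dual_lattice_def)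
  qed
  define Q where "Q k \<longleftrightarrow> (\<exists>c>0. (\<lambda>v. c * u v) \<in> dual_lattice P \<and> c * s = of_nat k)" for k :: nat
  have Q_of: "\<exists>k. c * s = of_nat k \<and> Q k" if "c > 0" "(\<lambda>v. c * u v) \<in> dual_lattice P" for c
  proof -
    have "c * s \<in> \<int>" using that(2) unfolding lattice s_def sum_distrib_left by (intro Ints_sum) auto
    moreover have "0 \<le> c * s" using that(1) s by simp
    ultimately obtain l where "c * s = of_int l" "0 \<le> l" by (auto elim: Ints_cases)
    then have "c * s = of_nat (nat l)" by simp
    then obtain k where "c * s = of_nat k" by blast
    then show ?thesis using that by (auto simp: Q_def)
  qed
  obtain N :: nat where "0 < N" "\<forall>g\<in>G. of_nat N * u (rat_vec g) \<in> \<int>"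
    using common_denominator[OF finite_G, of "\<lambda>g. u (rat_vec g)"] by blast
  then have "\<exists>k. Q k" using Q_of[of "of_nat N"] by (auto simp: lattice)
  then have "Q (LEAST k. Q k)" by (rule LeastI_ex)
  then obtain c where c: "c > 0" "(\<lambda>v. c * u v) \<in> dual_lattice P" "c * s = of_nat (LEAST k. Q k)"
    by (auto simp: Q_def)
  have "k = 1" if q: "q \<in> dual_lattice P" and eq: "(\<lambda>v. c * u v) = (\<lambda>v. of_nat k * q v)" for q and k :: nat
  proof -
    have "k \<noteq> 0"
    proof
      assume "k = 0"
      then have "c * u v = 0" for v using fun_cong[OF eq, of v] by simp
      then show False using c(1) u(2) by (auto simp: fun_eq_iff)
    qed
    then have "q = (\<lambda>v. c / of_nat k * u v)"
      using fun_cong[OF eq] by (auto simp: field_simps)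
    then obtain l where l: "c / of_nat k * s = of_nat l" "Q l"
      using Q_of[of "c / of_nat k"] q c(1) \<open>k \<noteq> 0\<close> by auto
    have "(LEAST k. Q k) \<le> l" using l(2) by (rule Least_le)
    then have "c * s \<le> of_nat l" using c(3) by simp
    then have "c * s \<le> c * s / of_nat k" using l(1) by simp
    moreover have "0 < c * s" using c(1) s by simp
    moreover have "c * s / of_nat k < c * s" if "1 < k"
      using that mult_strict_left_mono[OF _ \<open>0 < c * s\<close>, of 1 "of_nat k"] by (simp add: divide_less_eq)
    ultimately have "k \<le> 1" by (meson linorder_not_less)
    then show ?thesis using \<open>k \<noteq> 0\<close> by simp
  qed
  moreover have "(\<lambda>v. c * u v) \<noteq> 0" using c(1) u(2) by (auto simp: fun_eq_iff)
  ultimately show ?thesis using c(1,2) unfolding primitive_def by blast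
qed

lemma ray_of_extremal:
  assumes u: "u \<in> dual_cone P" "u \<noteq> 0"
    and extremal: "\<And>w. w \<in> dual_rat P \<Longrightarrow> tight u \<subseteq> tight w \<Longrightarrow> \<exists>c. w = (\<lambda>v. c * u v)"
  shows "is_ray P {(\<lambda>v. c * u v) |c. 0 \<le> c}"
proof -
  \<comment> \<open>A form that is nonnegative on the generators vanishes at this one vector exactly
    when it vanishes on every tight generator. This makes \<open>v\<close> the exposing vector that
    \<open>is_ray\<close> asks for.\<close>
  define v where "v = (\<Sum>g\<in>tight u. rat_vec g)"
  have tG: "tight u \<subseteq> G" "finite (tight u)" using finite_G by (auto simp: tight_def)
  have v: "v \<in> weight_cone P"
    unfolding v_def using tG G_subset by (intro weight_cone_sum rat_vec_in_weight_cone) auto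
  have v_eq: "v = (\<lambda>i. \<Sum>m\<in>tight u. 1 * rat_vec m i)"
    unfolding v_def by (auto simp: sum_fun_apply)
  have tL: "tight u \<subseteq> lattice_gen P" using tG G_subset P_lattice by blast
  have val: "w v = (\<Sum>g\<in>tight u. w (rat_vec g))" if "w \<in> dual_rat P" for w
    using dual_rat_combination[OF that tG(2) tL, of "\<lambda>_. 1"] by (simp add: v_eq)
  have "{(\<lambda>v. c * u v) |c. 0 \<le> c} = {w \<in> dual_cone P. w v = 0}"
  proof (intro equalityI subsetI)
    fix w assume "w \<in> {(\<lambda>v. c * u v) |c. 0 \<le> c}"
    then obtain c where c: "0 \<le> c" "w = (\<lambda>v. c * u v)" by blast
    have "w \<in> dual_cone P" unfolding c(2) using c(1) dual_coneD[OF u(1)]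
      by (intro dual_coneI dual_rat_multiple) auto
    moreover have "u v = 0" using val[OF dual_coneD(1)[OF u(1)]] by (simp add: tight_def)
    ultimately show "w \<in> {w \<in> dual_cone P. w v = 0}" using c(2) by simp
  next
    fix w assume "w \<in> {w \<in> dual_cone P. w v = 0}"
    then have w: "w \<in> dual_cone P" "w v = 0" by auto
    have "\<forall>g\<in>tight u. w (rat_vec g) = 0"
      using w(2) tG G_subset dual_coneD(3)[OF w(1)] unfolding val[OF dual_coneD(1)[OF w(1)]]
      by (subst (asm) sum_nonneg_eq_0_iff) auto
    then have "tight u \<subseteq> tight w" by (auto simp: tight_def)
    then obtain c where c: "w = (\<lambda>v. c * u v)" using extremal[OF dual_coneD(1)[OF w(1)]] by blast
    \<comment> \<open>A generator on which \<open>u\<close> is positive decides the sign of the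
      scalar \<open>c\<close>.\<close>
    obtain g where g: "g \<in> G" "u (rat_vec g) \<noteq> 0"
      using zero_on_P[OF dual_coneD(1)[OF u(1)]] u(2) by blast
    then have "0 < u (rat_vec g)" "0 \<le> c * u (rat_vec g)"
      using dual_coneD(3)[OF u(1), of g] dual_coneD(3)[OF w(1), of g] G_subset by (auto simp: c)
    then have "0 \<le> c" by (simp add: zero_le_mult_iff)
    then show "w \<in> {(\<lambda>v. c * u v) |c. 0 \<le> c}" using c by blast
  qed
  then show ?thesis unfolding is_ray_def using v u(2) by blast
qed

text \<open>A form that is not extremal splits into two forms that vanish on more generators.\<close>

lemma dual_cone_least:
  assumes zero: "0 \<in> C"
    and add: "\<And>u w. u \<in> C \<Longrightarrow> w \<in> C \<Longrightarrow> (\<lambda>v. u v + w v) \<in> C"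
    and scale: "\<And>u c. u \<in> C \<Longrightarrow> 0 \<le> c \<Longrightarrow> (\<lambda>v. c * u v) \<in> C"
    and rays: "ray_vectors P \<subseteq> C"
  shows "dual_cone P \<subseteq> C"
proof
  fix u assume "u \<in> dual_cone P"
  then show "u \<in> C"
  \<comment> \<open>The measure counts the generators on which \<open>u\<close> is positive; the
    larger the tight set, the smaller the face of the dual cone that contains
    \<open>u\<close>.\<close>
  proof (induction "card (G - tight u)" arbitrary: u rule: less_induct)
    case less
    note u = less.prems
    have uG: "0 \<le> u (rat_vec g)" if "g \<in> G" for g
      using dual_coneD(3)[OF u] G_subset that by blast
    have smaller: "w \<in> C" if "w \<in> dual_cone P" "tight u \<subset> tight w" for w
    proof -
      have "G - tight w \<subset> G - tight u" using that(2) by (auto simp: tight_def)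
      then show ?thesis using that(1) finite_G by (intro less.hyps psubset_card_mono) auto
    qed
    show ?case
    proof (cases "u = 0")
      case True then show ?thesis using zero by simp
    next
      case nz: False
      show ?thesis
      proof (cases "\<forall>w\<in>dual_rat P. tight u \<subseteq> tight w \<longrightarrow> (\<exists>c. w = (\<lambda>v. c * u v))")
        case True
        obtain c where c: "c > 0" "primitive P (\<lambda>v. c * u v)"
          using exists_primitive_multiple[OF u nz] by blast
        have "is_ray P {(\<lambda>v. c * u v) |c. 0 \<le> c}" using True by (intro ray_of_extremal[OF u nz]) blast
        then have "(\<lambda>v. c * u v) \<in> ray_vectors P"
          unfolding ray_vectors_def using c by (intro CollectI conjI exI[of _ "{(\<lambda>v. c * u v) |c. 0 \<le> c}"]) auto
        then have "(\<lambda>v. (1 / c) * (c * u v)) \<in> C" using rays c(1) scale[of "\<lambda>v. c * u v" "1 / c"] by auto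
        moreover have "(\<lambda>v. (1 / c) * (c * u v)) = u" using c(1) by auto
        ultimately show ?thesis by simp
      next
        case False
        then obtain w where w: "w \<in> dual_rat P" "tight u \<subseteq> tight w" "\<And>c. w \<noteq> (\<lambda>v. c * u v)" by blast
        have uP: "u \<in> dual_rat P" using dual_coneD(1)[OF u] .
        define A where "A = G - tight u"
        have A: "finite A" "A \<noteq> {}" "\<And>g. g \<in> A \<Longrightarrow> 0 < u (rat_vec g)"
          using finite_G zero_on_P[OF uP] nz uG by (auto simp: A_def tight_def less_le)
        obtain g0 where "is_arg_min (\<lambda>g. w (rat_vec g) / u (rat_vec g)) (\<lambda>g. g \<in> A) g0"
          using ex_is_arg_min_if_finite[OF A(1,2)] by blast
        then have g0: "g0 \<in> A"
          and l_min: "\<And>g. g \<in> A \<Longrightarrow> w (rat_vec g0) / u (rat_vec g0) \<le> w (rat_vec g) / u (rat_vec g)"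
          unfolding is_arg_min_linorder by blast+
        \<comment> \<open>The least ratio is the largest multiple of \<open>u\<close> that can be
          subtracted from \<open>w\<close> without a negative value on a generator, and
          \<open>g0\<close> becomes tight. Outside \<open>A\<close> both forms vanish, so nothing is
          lost there.\<close>
        define l where "l = w (rat_vec g0) / u (rat_vec g0)"
        define w' where "w' = (\<lambda>v. 1 * w v + (- l) * u v)"
        have w'P: "w' \<in> dual_rat P" unfolding w'_def by (rule dual_rat_linear_combination[OF w(1) uP])
        have w'G: "0 \<le> w' (rat_vec g)" if "g \<in> G" for g
          using l_min[of g, folded l_def] A(3)[of g] w(2) that by (cases "g \<in> A") (auto simp: w'_def A_def tight_def field_simps)
        have w'C: "w' \<in> dual_cone P" by (rule dual_coneI_gen[OF w'P w'G])
        have "tight u \<subseteq> tight w'" using w(2) by (auto simp: w'_def tight_def)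
        moreover have "g0 \<in> tight w'" "g0 \<notin> tight u"
          using g0 A(3)[OF g0] by (auto simp: w'_def l_def A_def tight_def)
        ultimately have tw': "tight u \<subset> tight w'" by blast
        define A' where "A' = G - tight w'"
        have "A' \<noteq> {}"
        proof
          assume "A' = {}"
          then have "w' = 0" using zero_on_P[OF w'P] by (auto simp: A'_def tight_def)
          then have "w = (\<lambda>v. l * u v)" by (auto simp: w'_def fun_eq_iff)
          then show False using w(3) by blast
        qed
        then have A': "finite A'" "A' \<noteq> {}" "\<And>g. g \<in> A' \<Longrightarrow> 0 < w' (rat_vec g)"
          using finite_G w'G by (auto simp: A'_def tight_def less_le)
        obtain g1 where "is_arg_min (\<lambda>g. u (rat_vec g) / w' (rat_vec g)) (\<lambda>g. g \<in> A') g1"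
          using ex_is_arg_min_if_finite[OF A'(1,2)] by blast
        then have g1: "g1 \<in> A'"
          and k_min: "\<And>g. g \<in> A' \<Longrightarrow> u (rat_vec g1) / w' (rat_vec g1) \<le> u (rat_vec g) / w' (rat_vec g)"
          unfolding is_arg_min_linorder by blast+
        \<comment> \<open>The same with exchanged roles: as much of \<open>w'\<close> as possible is
          subtracted from \<open>u\<close>. The result is the splitting
          \<open>u = u' + k w'\<close>, in which both forms have strictly larger tight sets than
          \<open>u\<close>.\<close>
        define k where "k = u (rat_vec g1) / w' (rat_vec g1)"
        have "0 \<le> k" using g1 A'(3) uG by (auto simp: k_def A'_def intro: divide_nonneg_pos)
        define u' where "u' = (\<lambda>v. 1 * u v + (- k) * w' v)"
        have u'P: "u' \<in> dual_rat P" unfolding u'_def by (rule dual_rat_linear_combination[OF uP w'P])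
        have u'C: "u' \<in> dual_cone P"
        proof (rule dual_coneI_gen[OF u'P])
          fix g assume "g \<in> G"
          then show "0 \<le> u' (rat_vec g)"
            using k_min[of g, folded k_def] A'(3)[of g] uG by (cases "g \<in> A'") (auto simp: u'_def A'_def tight_def field_simps)
        qed
        have "tight u \<subseteq> tight u'" using tw' by (auto simp: u'_def tight_def)
        moreover have "g1 \<in> tight u'" "g1 \<notin> tight u"
          using g1 A'(3)[OF g1] tw' by (auto simp: u'_def k_def A'_def tight_def)
        ultimately have tu': "tight u \<subset> tight u'" by blast
        have "(\<lambda>v. u' v + k * w' v) \<in> C"
          using smaller[OF u'C tu'] smaller[OF w'C tw'] \<open>0 \<le> k\<close> by (intro add scale)
        then show ?thesis by (simp add: u'_def)
      qed
    qed
  qed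
qed

text \<open>The ray of p is exposed by a vector v of the cone, a nonnegative combination of weights.
  Those with nonzero coefficient are killed by p, hence also by r, since the zeros of p and r on P
  are determined by their tight sets. So r vanishes at v and lies on the same ray.\<close>

lemma same_tight_same_ray:
  assumes p: "p \<in> ray_vectors P" and r: "r \<in> ray_vectors P" and eq: "tight p = tight r"
  shows "\<exists>c\<ge>0. p = (\<lambda>v. c * r v)"
proof -
  have pC: "p \<in> dual_cone P" and rC: "r \<in> dual_cone P" using p r by (auto intro: ray_vectors_dual_cone)
  have "P \<subseteq> {m \<in> P. p (rat_vec m) = 0 \<longrightarrow> r (rat_vec m) = 0}"
    using eq G_subset zero_in_P add_in_P dual_rat_0[OF dual_coneD(1)[OF rC]]
      dual_coneD(3)[OF pC] dual_coneD(3)[OF rC]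
    by (intro P_least)
      (auto simp: add_P[OF dual_coneD(1)[OF pC]] add_P[OF dual_coneD(1)[OF rC]] rat_vec_0 tight_def
        add_nonneg_eq_0_iff)
  then have vanish: "r (rat_vec m) = 0" if "m \<in> P" "p (rat_vec m) = 0" for m using that by blast
  obtain \<rho> v u where \<rho>: "v \<in> weight_cone P" "\<rho> = {u \<in> dual_cone P. u v = 0}"
    "\<rho> = {(\<lambda>v. c * u v) |c. 0 \<le> c}" "p \<in> \<rho>"
    using p unfolding ray_vectors_def is_ray_def by blast
  obtain F c where v: "v = (\<lambda>i. \<Sum>m\<in>F. c m * rat_vec m i)" "finite F" "F \<subseteq> P" "\<forall>m\<in>F. 0 \<le> c m"
    using \<rho>(1) unfolding weight_cone_def by blast
  have FL: "F \<subseteq> lattice_gen P" using v(3) P_lattice by blast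
  have "(\<Sum>m\<in>F. c m * p (rat_vec m)) = 0"
    using \<rho>(2,4) dual_rat_combination[OF dual_coneD(1)[OF pC] v(2) FL, of c] by (simp add: v(1))
  then have "\<forall>m\<in>F. c m * p (rat_vec m) = 0"
    using v(2-4) dual_coneD(3)[OF pC] by (subst (asm) sum_nonneg_eq_0_iff) (auto intro!: mult_nonneg_nonneg)
  then have "\<forall>m\<in>F. c m * r (rat_vec m) = 0" using vanish v(3) by auto
  then have "(\<Sum>m\<in>F. c m * r (rat_vec m)) = 0" by (intro sum.neutral)
  then have "r v = 0"
    using dual_rat_combination[OF dual_coneD(1)[OF rC] v(2) FL, of c] by (simp add: v(1))
  then have "r \<in> \<rho>" using rC \<rho>(2) by blast
  then obtain a where a: "0 \<le> a" "r = (\<lambda>v. a * u v)" using \<rho>(3) by blast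
  obtain b where b: "0 \<le> b" "p = (\<lambda>v. b * u v)" using \<rho>(3,4) by blast
  have "r \<noteq> 0" using r by (auto simp: ray_vectors_def primitive_def)
  then have "a \<noteq> 0" using a(2) by (auto simp: fun_eq_iff)
  then show ?thesis using a b by (intro exI[of _ "b / a"]) auto
qed

lemma finite_rays:
  obtains R where "finite R" "R \<subseteq> ray_vectors P"
    "\<And>u. u \<in> dual_cone P \<Longrightarrow> \<exists>c. (\<forall>p\<in>R. 0 \<le> c p) \<and> u = (\<lambda>v. \<Sum>p\<in>R. c p * p v)"
proof
  \<comment> \<open>One representative per tight set is enough, as ray vectors with equal tight sets
    are proportional. There are finitely many tight sets because they are subsets of
    \<open>G\<close>.\<close>
  define r where "r I = (SOME p. p \<in> ray_vectors P \<and> tight p = I)" for I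
  define R where "R = r ` tight ` ray_vectors P"
  define C where "C = {u. \<exists>c. (\<forall>p\<in>R. 0 \<le> c p) \<and> u = (\<lambda>v. \<Sum>p\<in>R. c p * p v)}"
  have r: "r (tight p) \<in> ray_vectors P \<and> tight (r (tight p)) = tight p" if "p \<in> ray_vectors P" for p
    unfolding r_def by (rule someI[of _ p]) (use that in simp)
  have "tight ` ray_vectors P \<subseteq> Pow G" by (auto simp: tight_def)
  then show fin: "finite R" unfolding R_def using finite_G by (meson finite_Pow_iff finite_imageI finite_subset)
  show "R \<subseteq> ray_vectors P" using r by (auto simp: R_def)
  have "dual_cone P \<subseteq> C"
  proof (rule dual_cone_least)
    show "0 \<in> C" unfolding C_def by (intro CollectI exI[of _ "\<lambda>_. 0"]) (auto simp: zero_fun_def)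
    show "(\<lambda>v. u v + w v) \<in> C" if u: "u \<in> C" and w: "w \<in> C" for u w
    proof -
      obtain a b where "\<forall>p\<in>R. 0 \<le> a p" "u = (\<lambda>v. \<Sum>p\<in>R. a p * p v)"
        "\<forall>p\<in>R. 0 \<le> b p" "w = (\<lambda>v. \<Sum>p\<in>R. b p * p v)"
        using u w unfolding C_def by blast
      then show ?thesis unfolding C_def
        by (intro CollectI exI[of _ "\<lambda>p. a p + b p"]) (auto simp: distrib_right sum.distrib)
    qed
    show "(\<lambda>v. k * u v) \<in> C" if u: "u \<in> C" and k: "0 \<le> k" for u k
    proof -
      obtain a where "\<forall>p\<in>R. 0 \<le> a p" "u = (\<lambda>v. \<Sum>p\<in>R. a p * p v)"
        using u unfolding C_def by blast
      then show ?thesis unfolding C_def using k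
        by (intro CollectI exI[of _ "\<lambda>p. k * a p"]) (auto simp: sum_distrib_left mult.assoc)
    qed
    show "ray_vectors P \<subseteq> C"
    proof
      fix p assume p: "p \<in> ray_vectors P"
      then obtain c where c: "0 \<le> c" "p = (\<lambda>v. c * r (tight p) v)"
        using same_tight_same_ray[of p "r (tight p)"] r by auto
      have R: "r (tight p) \<in> R" using p by (auto simp: R_def)
      have "(\<Sum>q\<in>R. (if q = r (tight p) then c else 0) * q v) = c * r (tight p) v" for v
        using R fin by (subst sum.remove[of _ "r (tight p)"]) (auto intro: sum.neutral)
      then have "p = (\<lambda>v. \<Sum>q\<in>R. (if q = r (tight p) then c else 0) * q v)" using c(2) by simp
      then show "p \<in> C" unfolding C_def using c(1)
        by (intro CollectI exI[of _ "\<lambda>q. if q = r (tight p) then c else 0"]) auto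
    qed
  qed
  then show "\<exists>c. (\<forall>p\<in>R. 0 \<le> c p) \<and> u = (\<lambda>v. \<Sum>p\<in>R. c p * p v)" if "u \<in> dual_cone P" for u
    using that unfolding C_def by blast
qed

section \<open>Moving along admissible roots, and faces\<close>

lemma weight_coneI_rays:
  assumes v: "v \<in> lattice_rat P" and pos: "\<And>p. p \<in> ray_vectors P \<Longrightarrow> 0 \<le> p v"
  shows "v \<in> weight_cone P"
proof -
  obtain R where R: "finite R" "R \<subseteq> ray_vectors P"
    "\<And>u. u \<in> dual_cone P \<Longrightarrow> \<exists>c. (\<forall>p\<in>R. 0 \<le> c p) \<and> u = (\<lambda>v. \<Sum>p\<in>R. c p * p v)"
    using finite_rays by blast
  show ?thesis
  proof (rule weight_coneI[OF v])
    fix u assume "u \<in> dual_cone P"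
    then obtain c where c: "\<forall>p\<in>R. 0 \<le> c p" "u = (\<lambda>v. \<Sum>p\<in>R. c p * p v)" using R(3) by blast
    show "0 \<le> u v" unfolding c(2) using c(1) R(2) pos by (intro sum_nonneg mult_nonneg_nonneg) auto
  qed
qed

text \<open>By integrality p(m) > 0 means p(m) \<ge> 1, which absorbs the value -1 at e. Only the
  distinguished ray of a Demazure root is negative on it, so p is that ray and all other rays cause
  no harm. Thus e + m lies in the cone, and admissibility returns it to P.\<close>

lemma admissible_step:
  assumes e: "admissible P e" and p: "p \<in> ray_vectors P" "p (rat_vec e) = -1"
    and m: "m \<in> P" "0 < p (rat_vec m)"
  shows "e + m \<in> P"
proof -
  obtain p' where p': "e \<in> lattice_gen P" "p' \<in> ray_vectors P"
    "\<And>q. q \<in> ray_vectors P \<Longrightarrow> q \<noteq> p' \<Longrightarrow> 0 \<le> q (rat_vec e)"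
    using e unfolding admissible_def demazure_root_def by blast
  have "p' = p" using p'(3)[OF p(1)] p(2) by force
  have em: "e + m \<in> lattice_gen P" by (rule lattice_gen_add[OF p'(1) P_lattice[OF m(1)]])
  have "rat_vec (e + m) \<in> weight_cone P"
  proof (rule weight_coneI_rays[OF rat_vec_in_lattice_rat[OF em]])
    fix q assume q: "q \<in> ray_vectors P"
    have qd: "q \<in> dual_cone P" by (rule ray_vectors_dual_cone[OF q])
    have eq: "q (rat_vec (e + m)) = q (rat_vec e) + q (rat_vec m)"
      by (rule dual_rat_rat_vec_add[OF dual_coneD(1)[OF qd] p'(1) P_lattice[OF m(1)]])
    show "0 \<le> q (rat_vec (e + m))"
    proof (cases "q = p")
      case True
      have "p (rat_vec m) \<in> \<int>" using m(1) by (intro ray_vectors_integral[OF p(1)] P_lattice)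
      then have "1 \<le> p (rat_vec m)" using m(2) by (metis Ints_cases of_int_0_less_iff of_int_1_le_iff zless_imp_add1_zle add_0)
      then show ?thesis using True eq p(2) by simp
    next
      case False
      then show ?thesis using eq p'(3)[OF q] \<open>p' = p\<close> dual_coneD(3)[OF qd m(1)] by simp
    qed
  qed
  then show ?thesis using e m(1) by (auto simp: admissible_def)
qed

text \<open>Heights as natural numbers, which serve both as the measure of the descent and as upper
  entries of binomial coefficients.\<close>

lemma ray_multiplicity:
  assumes "p \<in> ray_vectors P"
  obtains h :: "(nat \<Rightarrow> int) \<Rightarrow> nat" where "\<And>m. m \<in> P \<Longrightarrow> p (rat_vec m) = of_nat (h m)"
proof
  fix m assume m: "m \<in> P"
  have "p (rat_vec m) \<in> \<int>" by (rule ray_vectors_integral[OF assms P_lattice[OF m]])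
  then obtain k where k: "p (rat_vec m) = of_int k" by (rule Ints_cases)
  moreover have "0 \<le> p (rat_vec m)" by (rule dual_coneD(3)[OF ray_vectors_dual_cone[OF assms] m])
  ultimately show "p (rat_vec m) = of_nat ((\<lambda>m. nat \<lfloor>p (rat_vec m)\<rfloor>) m)" by simp
qed

lemma tau_root_witness:
  assumes face: "is_face P \<tau>" and e: "admissible P e" "tau_root P \<tau> e"
  obtains p m where "p \<in> ray_vectors P" "p (rat_vec e) = -1" "m \<in> P" "p (rat_vec m) = 1"
    "rat_vec m \<notin> \<tau>" "e + m \<in> P" "rat_vec (e + m) \<in> \<tau>"
proof -
  obtain p where p: "p \<in> normal_vectors P \<tau>" "p (rat_vec e) = -1"
    and others: "\<And>q. q \<in> normal_vectors P \<tau> \<Longrightarrow> q \<noteq> p \<Longrightarrow> q (rat_vec e) = 0"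
    using e(2) unfolding tau_root_def by blast
  have pR: "p \<in> ray_vectors P" and p0: "\<And>v. v \<in> \<tau> \<Longrightarrow> p v = 0" using p(1) by (auto simp: normal_vectors_def)
  have pd: "p \<in> dual_cone P" by (rule ray_vectors_dual_cone[OF pR])
  have eL: "e \<in> lattice_gen P" using e(1) by (auto simp: admissible_def demazure_root_def)
  obtain u where u: "u \<in> dual_cone P" "\<tau> = {v \<in> weight_cone P. u v = 0}"
    using face unfolding is_face_def by blast
  obtain R where R: "finite R" "R \<subseteq> ray_vectors P"
    "\<And>u. u \<in> dual_cone P \<Longrightarrow> \<exists>c. (\<forall>p\<in>R. 0 \<le> c p) \<and> u = (\<lambda>v. \<Sum>p\<in>R. c p * p v)"
    using finite_rays by blast
  \<comment> \<open>The face is cut out by its normal ray vectors: in the expansion of the defining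
    form \<open>u\<close> along rays, every ray with nonzero coefficient must vanish on \<tau>,
    since all terms are nonnegative there.\<close>
  have in_face: "v \<in> \<tau>" if v: "v \<in> weight_cone P" "\<And>q. q \<in> normal_vectors P \<tau> \<Longrightarrow> q v = 0" for v
  proof -
    obtain c where c: "\<forall>p\<in>R. 0 \<le> c p" "u = (\<lambda>v. \<Sum>p\<in>R. c p * p v)" using R(3)[OF u(1)] by blast
    have "c q * q v = 0" if q: "q \<in> R" for q
    proof (cases "c q = 0")
      case False
      have "q w = 0" if w: "w \<in> \<tau>" for w
      proof -
        have "(\<Sum>p\<in>R. c p * p w) = 0" "w \<in> weight_cone P" using w u(2) c(2) by auto
        moreover have "0 \<le> c q * q w" if "q \<in> R" for q
          using c(1) R(2) that \<open>w \<in> weight_cone P\<close> dual_coneD(2)[OF ray_vectors_dual_cone] by auto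
        ultimately have "c q * q w = 0" using q R(1) by (subst (asm) sum_nonneg_eq_0_iff) auto
        then show ?thesis using False by simp
      qed
      then have "q \<in> normal_vectors P \<tau>" using q R(2) by (auto simp: normal_vectors_def)
      then show ?thesis using v(2) by simp
    qed simp
    then have "u v = 0" unfolding c(2) by (intro sum.neutral ballI)
    then show ?thesis using v(1) u(2) by simp
  qed
  have tau_add: "v + w \<in> \<tau>" if "v \<in> \<tau>" "w \<in> \<tau>" for v w
    using that dual_rat_add[OF dual_coneD(1)[OF u(1)], of v w] weight_cone_subset[of P] 
    by (auto simp: u(2) weight_cone_add)
  have tau_0: "0 \<in> \<tau>" using dual_rat_0[OF dual_coneD(1)[OF u(1)]] by (auto simp: u(2) weight_cone_0)
  have tau_L: "\<tau> \<subseteq> lattice_rat P" using u(2) weight_cone_subset[of P] by auto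
  \<comment> \<open>Subtracting \<open>e\<close> from a point deep inside \<open>\<tau>\<close> stays in the cone.\<close>
  have deep: "\<exists>w\<in>\<tau>. \<forall>q\<in>R'. q \<notin> normal_vectors P \<tau> \<longrightarrow> q (rat_vec e) \<le> q w" if "finite R'" "R' \<subseteq> R" for R'
    using that
  proof (induction R' rule: finite_induct)
    case empty then show ?case using tau_0 by auto
  next
    case (insert q R')
    then obtain w where w: "w \<in> \<tau>" "\<forall>q\<in>R'. q \<notin> normal_vectors P \<tau> \<longrightarrow> q (rat_vec e) \<le> q w" by auto
    show ?case
    proof (cases "q \<in> normal_vectors P \<tau>")
      case True then show ?thesis using w by blast
    next
      case False
      have qR: "q \<in> ray_vectors P" using insert.prems R(2) by blast
      note qd = ray_vectors_dual_cone[OF qR]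
      obtain x where x: "x \<in> \<tau>" "q x \<noteq> 0" using False qR by (auto simp: normal_vectors_def)
      have "0 < q x" using x u(2) dual_coneD(2)[OF qd] by (auto simp: less_le)
      \<comment> \<open>Chosen so that adding \<open>k\<close> times \<open>x\<close> raises
        \<open>q\<close> by the absolute value of its value at \<open>e\<close>; the other
        inequalities survive because dual forms are nonnegative on \<tau>.\<close>
      define k where "k = \<bar>q (rat_vec e)\<bar> / q x"
      have k: "0 \<le> k" using \<open>0 < q x\<close> by (simp add: k_def)
      let ?x = "\<lambda>i. k * x i"
      have xL: "x \<in> lattice_rat P" "w \<in> lattice_rat P" using x(1) w(1) tau_L by auto
      have "?x \<in> \<tau>"
      proof -
        obtain F c where v: "x = (\<lambda>i. \<Sum>m\<in>F. c m * rat_vec m i)" "finite F" "F \<subseteq> P" "\<forall>m\<in>F. 0 \<le> c m"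
          using x(1) u(2) unfolding weight_cone_def by blast
        have "?x = (\<lambda>i. \<Sum>m\<in>F. (k * c m) * rat_vec m i)" by (simp add: v(1) sum_distrib_left mult.assoc)
        then have "?x \<in> weight_cone P" unfolding weight_cone_def using v(2-4) k
          by (intro CollectI exI[of _ F] exI[of _ "\<lambda>m. k * c m"]) auto
        then show ?thesis using x(1) dual_rat_scale[OF dual_coneD(1)[OF u(1)] xL(1), of k] by (simp add: u(2))
      qed
      then have wx: "w + ?x \<in> \<tau>" using w(1) by (intro tau_add)
      have val: "q' (w + ?x) = q' w + k * q' x" if "q' \<in> dual_cone P" for q'
        using dual_rat_add[OF dual_coneD(1)[OF that] xL(2) lattice_rat_scale[OF xL(1)]]
          dual_rat_scale[OF dual_coneD(1)[OF that] xL(1)] by simp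
      have pos: "0 \<le> q' w" "0 \<le> k * q' x" if "q' \<in> dual_cone P" for q'
        using w(1) x(1) u(2) k dual_coneD(2)[OF that] by auto
      have "q (rat_vec e) \<le> q (w + ?x)"
        using val[OF qd] pos[OF qd] \<open>0 < q x\<close> by (simp add: k_def abs_le_iff)
      moreover have "q' (rat_vec e) \<le> q' (w + ?x)" if q': "q' \<in> R'" "q' \<notin> normal_vectors P \<tau>" for q'
      proof -
        have "q' \<in> dual_cone P" using q'(1) insert.prems R(2) ray_vectors_dual_cone by blast
        then show ?thesis using val[of q'] pos[of q'] w(2) q' by force
      qed
      ultimately show ?thesis using wx by blast
    qed
  qed
  from deep[OF R(1) subset_refl] obtain w where w: "w \<in> \<tau>"
    and wR: "\<forall>q\<in>R. q \<notin> normal_vectors P \<tau> \<longrightarrow> q (rat_vec e) \<le> q w"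
    by (rule bexE)
  \<comment> \<open>On the normals of \<tau> only \<open>e\<close> contributes, with value 1 for
    \<open>p\<close> and 0 for the others; on the remaining members of \<open>R\<close> the depth of
    \<open>w\<close> outweighs \<open>e\<close>.\<close>
  define v where "v = w + (\<lambda>i. (-1) * rat_vec e i)"
  have wL: "w \<in> lattice_rat P" using w tau_L by blast
  have eR: "rat_vec e \<in> lattice_rat P" by (rule rat_vec_in_lattice_rat[OF eL])
  have vL: "v \<in> lattice_rat P" unfolding v_def by (intro lattice_rat_add wL lattice_rat_scale eR)
  have val: "q v = q w - q (rat_vec e)" if "q \<in> dual_cone P" for q
    using dual_rat_add[OF dual_coneD(1)[OF that] wL lattice_rat_scale[OF eR, of "-1"]]
      dual_rat_scale[OF dual_coneD(1)[OF that] eR, of "-1"] by (simp add: v_def)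
  have "v \<in> weight_cone P"
  proof (rule weight_coneI[OF vL])
    fix u' assume "u' \<in> dual_cone P"
    from R(3)[OF this] obtain c where c: "\<forall>p\<in>R. 0 \<le> c p" "u' = (\<lambda>v. \<Sum>p\<in>R. c p * p v)" by blast
    have "0 \<le> q v" if q: "q \<in> R" for q
    proof -
      have qd: "q \<in> dual_cone P" using q R(2) ray_vectors_dual_cone by blast
      show ?thesis
      proof (cases "q \<in> normal_vectors P \<tau>")
        case True
        then have "q w = 0" using w by (auto simp: normal_vectors_def)
        then show ?thesis using val[OF qd] others[OF True] p(2) by (cases "q = p") auto
      next
        case False then show ?thesis using val[OF qd] bspec[OF wR q] False by simp
      qed
    qed
    then show "0 \<le> u' v" unfolding c(2) using c(1) by (intro sum_nonneg mult_nonneg_nonneg) auto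
  qed
  then obtain F c where v: "v = (\<lambda>i. \<Sum>m\<in>F. c m * rat_vec m i)" "finite F" "F \<subseteq> P" "\<forall>m\<in>F. 0 \<le> c m"
    unfolding weight_cone_def by blast
  have FL: "F \<subseteq> lattice_gen P" using v(3) P_lattice by blast
  have comb: "q v = (\<Sum>m\<in>F. c m * q (rat_vec m))" if "q \<in> dual_cone P" for q
    unfolding v(1) by (rule dual_rat_combination[OF dual_coneD(1)[OF that] v(2) FL])
  have "p v = 1" using val[OF pd] p(2) p0[OF w] by simp
  then have "(\<Sum>m\<in>F. c m * p (rat_vec m)) \<noteq> 0" using comb[OF pd] by simp
  then obtain m where m: "m \<in> F" "c m * p (rat_vec m) \<noteq> 0"
    by (rule sum.not_neutral_contains_not_neutral)
  have mP: "m \<in> P" using m(1) v(3) by blast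
  have m_pos: "0 < c m" using m v(4) by (force simp: less_le)
  have m0: "q (rat_vec m) = 0" if q: "q \<in> normal_vectors P \<tau>" "q \<noteq> p" for q
  proof -
    have qd: "q \<in> dual_cone P" using q(1) ray_vectors_dual_cone by (auto simp: normal_vectors_def)
    have "q v = 0" using val[OF qd] others[OF q] w q(1) by (auto simp: normal_vectors_def)
    then have "\<forall>m\<in>F. c m * q (rat_vec m) = 0"
      using v(2-4) dual_coneD(3)[OF qd] unfolding comb[OF qd]
      by (subst (asm) sum_nonneg_eq_0_iff) (auto intro!: mult_nonneg_nonneg)
    then show ?thesis using m(1) m_pos by auto
  qed
  obtain h where h: "\<And>m. m \<in> P \<Longrightarrow> p (rat_vec m) = of_nat (h m)" by (rule ray_multiplicity[OF pR]) blast
  have hpos: "0 < h m" using m(2) h[OF mP] by (cases "h m") auto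
  \<comment> \<open>Descend along \<open>e\<close> from height \<open>p m\<close> to height \<open>1\<close>.\<close>
  have "\<exists>m'\<in>P. p (rat_vec m') = of_nat (Suc k) \<and> (\<forall>q\<in>normal_vectors P \<tau>. q \<noteq> p \<longrightarrow> q (rat_vec m') = 0)"
    if "Suc k \<le> h m" for k
    using that
  \<comment> \<open>Downward induction. Writing heights as successors keeps them positive, as
    \<open>admissible_step\<close> demands, and makes the descent stop at height 1.\<close>
  proof (induction "h m - Suc k" arbitrary: k)
    case 0
    then have "h m = Suc k" by simp
    then show ?case using mP h[OF mP] m0 by auto
  next
    case (Suc l)
    then obtain m' where m': "m' \<in> P" "p (rat_vec m') = of_nat (Suc (Suc k))"
      "\<forall>q\<in>normal_vectors P \<tau>. q \<noteq> p \<longrightarrow> q (rat_vec m') = 0"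
      by (metis Suc_diff_Suc Suc_inject Suc_leI zero_less_Suc zero_less_diff)
    have em: "e + m' \<in> P" using m'(2) by (intro admissible_step[OF e(1) pR p(2) m'(1)]) (simp del: of_nat_Suc)
    have add: "q (rat_vec (e + m')) = q (rat_vec e) + q (rat_vec m')" if "q \<in> dual_cone P" for q
      by (rule dual_rat_rat_vec_add[OF dual_coneD(1)[OF that] eL P_lattice[OF m'(1)]])
    have "p (rat_vec (e + m')) = of_nat (Suc k)" using add[OF pd] m'(2) p(2) by simp
    moreover have "\<forall>q\<in>normal_vectors P \<tau>. q \<noteq> p \<longrightarrow> q (rat_vec (e + m')) = 0"
    proof (intro ballI impI)
      fix q assume q: "q \<in> normal_vectors P \<tau>" "q \<noteq> p"
      then have "q \<in> dual_cone P" using ray_vectors_dual_cone by (auto simp: normal_vectors_def)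
      then show "q (rat_vec (e + m')) = 0" using add[of q] others[OF q] m'(3) q by simp
    qed
    ultimately show ?case using em by blast
  qed
  from this[of 0] obtain m' where m': "m' \<in> P" "p (rat_vec m') = 1"
      "\<forall>q\<in>normal_vectors P \<tau>. q \<noteq> p \<longrightarrow> q (rat_vec m') = 0"
    using hpos by auto
  \<comment> \<open>One further step leads from height 1 to height 0 on \<open>p\<close>, that is,
    into the face.\<close>
  have em: "e + m' \<in> P" using m'(2) by (intro admissible_step[OF e(1) pR p(2) m'(1)]) simp
  have "rat_vec (e + m') \<in> \<tau>"
  proof (rule in_face[OF rat_vec_in_weight_cone[OF em]])
    fix q assume q: "q \<in> normal_vectors P \<tau>"
    then have qd: "q \<in> dual_cone P" using ray_vectors_dual_cone by (auto simp: normal_vectors_def)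
    show "q (rat_vec (e + m')) = 0"
      using dual_rat_rat_vec_add[OF dual_coneD(1)[OF qd] eL P_lattice[OF m'(1)]] m'(2,3) others[OF q] p(2) q
      by (cases "q = p") auto
  qed
  moreover have "rat_vec m' \<notin> \<tau>" using p0 m'(2) by force
  ultimately show ?thesis using that pR p(2) m'(1,2) em by blast
qed

text \<open>The hypotheses are what multiplicativity gives for the support of a point. For each
  generator g outside S, Farkas either yields a dual form that vanishes on the generators in S and
  is positive at g, or a relation that makes g a summand of an element of S, which is excluded. The
  sum of these forms exposes S.\<close>

lemma face_of_submonoid:
  assumes SP: "S \<subseteq> P" and zero: "0 \<in> S" and add: "\<And>a b. a \<in> P \<Longrightarrow> b \<in> P \<Longrightarrow> a + b \<in> S \<longleftrightarrow> a \<in> S \<and> b \<in> S"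
  shows "\<exists>\<tau>. is_face P \<tau> \<and> (\<forall>m\<in>P. rat_vec m \<in> \<tau> \<longleftrightarrow> m \<in> S)"
proof -
  have sumP: "(\<Sum>i\<in>I. f i) \<in> P" if "\<And>i. i \<in> I \<Longrightarrow> f i \<in> P" for I :: "'i set" and f
    using that by (induction I rule: infinite_finite_induct) (auto intro: zero_in_P add_in_P)
  have sumS: "(\<Sum>i\<in>I. f i) \<in> S" if "\<And>i. i \<in> I \<Longrightarrow> f i \<in> S" for I :: "'i set" and f
    using that
  proof (induction I rule: infinite_finite_induct)
    case (insert i I)
    have "f i \<in> S" "(\<Sum>i\<in>I. f i) \<in> S" using insert.prems by (auto intro!: insert.IH)
    then have "f i + (\<Sum>i\<in>I. f i) \<in> S" using add[of "f i" "\<Sum>i\<in>I. f i"] SP by blast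
    then show ?case by (simp only: sum.insert[OF insert.hyps])
  qed (auto intro: zero)
  have mult: "(\<Sum>_\<in>{..<n}. m) i = int n * m i" for n :: nat and m :: "nat \<Rightarrow> int" and i
    by (induction n) (auto simp: zero_fun_def plus_fun_def algebra_simps)
  have sum_at: "(\<Sum>j\<in>I. f j) i = (\<Sum>j\<in>I. f j i)" for I :: "'j set" and f :: "'j \<Rightarrow> nat \<Rightarrow> int" and i
    by (induction I rule: infinite_finite_induct) (auto simp: zero_fun_def plus_fun_def)
  have "\<exists>u\<in>dual_cone P. (\<forall>h\<in>G \<inter> S. u (rat_vec h) = 0) \<and> 0 < u (rat_vec g)" if g: "g \<in> G - S" for g
  proof -
    \<comment> \<open>The generators in \<open>S\<close> occur with both signs, which forces a form
      that is nonnegative on the whole family to vanish on them.\<close>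
    define a where "a = case_sum rat_vec (\<lambda>h i. - rat_vec h i)"
    have fin: "finite (G <+> (G \<inter> S))" using finite_G by simp
    from farkas[OF fin, of "\<lambda>i. - rat_vec g i" a] show ?thesis
    proof (elim disjE exE conjE)
      fix c assume c: "\<forall>i\<in>G <+> G \<inter> S. 0 \<le> c i"
        "(\<lambda>i. - rat_vec g i) = (\<lambda>k. \<Sum>i\<in>G <+> G \<inter> S. c i * a i k)"
      obtain N :: nat where N: "0 < N" "\<forall>i\<in>G <+> G \<inter> S. of_nat N * c i \<in> \<int>"
        using common_denominator[OF fin, of c] by blast
      define n where "n i = nat \<lfloor>of_nat N * c i\<rfloor>" for i
      have n: "of_nat N * c i = of_nat (n i)" if i: "i \<in> G <+> G \<inter> S" for i
      proof -
        obtain k where "of_nat N * c i = of_int k" using N(2) i by (auto elim: Ints_cases)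
        moreover have "0 \<le> of_nat N * c i" using c(1) i by simp
        ultimately show ?thesis by (simp add: n_def)
      qed
      have eq: "int N * g i + (\<Sum>h\<in>G. int (n (Inl h)) * h i) = (\<Sum>h\<in>G \<inter> S. int (n (Inr h)) * h i)" for i
      proof -
        have "- rat_vec g i = (\<Sum>h\<in>G. c (Inl h) * rat_vec h i) - (\<Sum>h\<in>G \<inter> S. c (Inr h) * rat_vec h i)"
          using fun_cong[OF c(2), of i] finite_G by (simp add: sum.Plus a_def sum_negf)
        then have "of_nat N * rat_vec g i + (\<Sum>h\<in>G. of_nat N * c (Inl h) * rat_vec h i)
            = (\<Sum>h\<in>G \<inter> S. of_nat N * c (Inr h) * rat_vec h i)"
          unfolding mult.assoc sum_distrib_left[symmetric] by (simp add: algebra_simps flip: distrib_left)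
        moreover have "(\<Sum>h\<in>G. of_nat N * c (Inl h) * rat_vec h i) = (\<Sum>h\<in>G. of_nat (n (Inl h)) * rat_vec h i)"
          using n by (intro sum.cong) auto
        moreover have "(\<Sum>h\<in>G \<inter> S. of_nat N * c (Inr h) * rat_vec h i) = (\<Sum>h\<in>G \<inter> S. of_nat (n (Inr h)) * rat_vec h i)"
          using n by (intro sum.cong) auto
        ultimately have "(of_int (int N * g i + (\<Sum>h\<in>G. int (n (Inl h)) * h i)) :: rat)
            = of_int (\<Sum>h\<in>G \<inter> S. int (n (Inr h)) * h i)"
          by (simp add: rat_vec_def)
        then show ?thesis by (simp only: of_int_eq_iff)
      qed
      \<comment> \<open>After clearing denominators by \<open>N\<close>, the relation contains
        \<open>N\<close> copies of \<open>g\<close>. One is split off, leaving \<open>N - 1\<close>,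
        so that the summand property of \<open>S\<close> applies to \<open>g\<close> itself.\<close>
      let ?l = "(\<Sum>_\<in>{..<N - 1}. g) + (\<Sum>h\<in>G. \<Sum>_\<in>{..<n (Inl h)}. h)"
      have "g + ?l = (\<Sum>h\<in>G \<inter> S. \<Sum>_\<in>{..<n (Inr h)}. h)"
      proof
        fix i
        have "(g + ?l) i = int N * g i + (\<Sum>h\<in>G. int (n (Inl h)) * h i)"
          using N(1) by (simp add: plus_fun_def sum_at[of _ G] mult of_nat_diff algebra_simps)
        then show "(g + ?l) i = (\<Sum>h\<in>G \<inter> S. \<Sum>_\<in>{..<n (Inr h)}. h) i"
          by (simp add: eq sum_at[of _ "G \<inter> S"] mult)
      qed
      moreover have "(\<Sum>h\<in>G \<inter> S. \<Sum>_\<in>{..<n (Inr h)}. h) \<in> S" by (intro sumS) auto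
      moreover have "g \<in> P" using g G_subset by blast
      moreover have "?l \<in> P" using g G_subset by (intro add_in_P sumP) blast+
      ultimately have "g \<in> S" using add[of g ?l] by simp
      then show ?thesis using g by blast
    next
      fix f assume f: "linear_form f" "\<forall>i\<in>G <+> G \<inter> S. 0 \<le> f (a i)" "f (\<lambda>i. - rat_vec g i) < 0"
      have neg: "f (\<lambda>i. - v i) = - f v" for v using linear_form_scale[OF f(1), of "-1" v] by simp
      define u where "u v = (if v \<in> lattice_rat P then f v else 0)" for v
      have uP: "u \<in> dual_rat P" unfolding u_def by (rule linear_form_restrict[OF f(1)])
      have u_eq: "u (rat_vec h) = f (rat_vec h)" if "h \<in> G" for h
        using that G_subset P_lattice rat_vec_in_lattice_rat by (auto simp: u_def)
      have G0: "0 \<le> f (rat_vec h)" if "h \<in> G" for h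
        using bspec[OF f(2) InlI[OF that]] by (simp add: a_def)
      have "f (rat_vec h) \<le> 0" if "h \<in> G \<inter> S" for h
        using bspec[OF f(2) InrI[OF that]] by (simp add: a_def neg)
      then have "\<forall>h\<in>G \<inter> S. u (rat_vec h) = 0" using G0 u_eq by (auto intro: antisym)
      moreover have "u \<in> dual_cone P" using G0 u_eq by (intro dual_coneI_gen[OF uP]) auto
      moreover have "0 < u (rat_vec g)" using f(3) g u_eq by (simp add: neg)
      ultimately show ?thesis by blast
    qed
  qed
  then obtain U where U: "\<And>g. g \<in> G - S \<Longrightarrow> U g \<in> dual_cone P"
    "\<And>g h. g \<in> G - S \<Longrightarrow> h \<in> G \<inter> S \<Longrightarrow> U g (rat_vec h) = 0" "\<And>g. g \<in> G - S \<Longrightarrow> 0 < U g (rat_vec g)"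
    by metis
  \<comment> \<open>All summands are nonnegative on P, so the sum is positive at a generator as soon
    as one of them is.\<close>
  define u where "u v = (\<Sum>g\<in>G - S. U g v)" for v
  have uP: "u \<in> dual_rat P" unfolding u_def using U(1) dual_coneD(1) by (intro dual_rat_sum) blast
  have uC: "u \<in> dual_cone P"
    using U(1) dual_coneD(3) by (intro dual_coneI[OF uP]) (auto simp: u_def intro!: sum_nonneg)
  have uS: "u (rat_vec h) = 0" if "h \<in> G \<inter> S" for h using U(2) that by (auto simp: u_def)
  have uG: "0 < u (rat_vec g)" if g: "g \<in> G - S" for g
  proof -
    have "g \<in> P" using g G_subset by blast
    then have "0 \<le> U i (rat_vec g)" if "i \<in> G - S" for i using dual_coneD(3)[OF U(1)[OF that]] by blast
    then show ?thesis unfolding u_def using g finite_G U(3)[OF g] by (intro sum_pos2[of _ g]) auto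
  qed
  have "P \<subseteq> {m \<in> P. u (rat_vec m) = 0 \<longleftrightarrow> m \<in> S}"
  proof (rule P_least)
    show "G \<subseteq> {m \<in> P. u (rat_vec m) = 0 \<longleftrightarrow> m \<in> S}" using G_subset uS uG by force
    show "0 \<in> {m \<in> P. u (rat_vec m) = 0 \<longleftrightarrow> m \<in> S}"
      using zero zero_in_P dual_rat_0[OF uP] by (simp add: rat_vec_0)
    show "a + b \<in> {m \<in> P. u (rat_vec m) = 0 \<longleftrightarrow> m \<in> S}"
      if "a \<in> {m \<in> P. u (rat_vec m) = 0 \<longleftrightarrow> m \<in> S}" "b \<in> {m \<in> P. u (rat_vec m) = 0 \<longleftrightarrow> m \<in> S}" for a b
      using that add[of a b] dual_coneD(3)[OF uC]
      by (auto simp: add_in_P add_P[OF uP] add_nonneg_eq_0_iff)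
  qed
  then show ?thesis using uC unfolding is_face_def
    by (intro exI[of _ "{v \<in> weight_cone P. u v = 0}"]) (auto intro: rat_vec_in_weight_cone)
qed

end


section \<open>Polynomial functions\<close>

text \<open>Equality is required on D only, because the components of morphisms agree with
  polynomials merely on the variety in question. The primed variant serves substitutions that are
  polynomial everywhere.\<close>

lemma gen_algebra_subst:
  assumes "p \<in> gen_algebra G"
    and "\<And>g. g \<in> G \<Longrightarrow> \<exists>h\<in>gen_algebra H. \<forall>y\<in>D. g (r y) = h y"
  shows "\<exists>h\<in>gen_algebra H. \<forall>y\<in>D. p (r y) = h y"
  using assms(1)
proof induction
  case (const c)
  show ?case by (rule bexI[OF _ gen_algebra.const[of c]]) simp
next
  case (gen g)
  then show ?case by (rule assms(2))
next
  case (add p q)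
  then obtain h k where "h \<in> gen_algebra H" "\<forall>y\<in>D. p (r y) = h y"
    "k \<in> gen_algebra H" "\<forall>y\<in>D. q (r y) = k y" by blast
  then show ?case by (intro bexI[OF _ gen_algebra.add[of h H k]]) auto
next
  case (mult p q)
  then obtain h k where "h \<in> gen_algebra H" "\<forall>y\<in>D. p (r y) = h y"
    "k \<in> gen_algebra H" "\<forall>y\<in>D. q (r y) = k y" by blast
  then show ?case by (intro bexI[OF _ gen_algebra.mult[of h H k]]) auto
qed

lemma gen_algebra_subst':
  assumes "p \<in> gen_algebra G" and "\<And>g. g \<in> G \<Longrightarrow> (\<lambda>y. g (r y)) \<in> gen_algebra H"
  shows "(\<lambda>y. p (r y)) \<in> gen_algebra H"
proof -
  have "\<exists>h\<in>gen_algebra H. \<forall>y\<in>UNIV. p (r y) = h y"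
    using assms(1)
  proof (rule gen_algebra_subst)
    fix g assume "g \<in> G"
    then show "\<exists>h\<in>gen_algebra H. \<forall>y\<in>UNIV. g (r y) = h y"
      by (intro bexI[OF _ assms(2)]) auto
  qed
  then obtain h where h: "h \<in> gen_algebra H" "\<forall>y. p (r y) = h y" by blast
  have "(\<lambda>y. p (r y)) = h" using h(2) by (intro ext) simp
  then show ?thesis using h(1) by simp
qed

lemma gen_algebra_add: "p \<in> gen_algebra G \<Longrightarrow> q \<in> gen_algebra G \<Longrightarrow> (\<lambda>x. p x + q x) \<in> gen_algebra G"
  using gen_algebra.add[of p G q] by (simp add: plus_fun_def)

lemma gen_algebra_mult: "p \<in> gen_algebra G \<Longrightarrow> q \<in> gen_algebra G \<Longrightarrow> (\<lambda>x. p x * q x) \<in> gen_algebra G"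
  using gen_algebra.mult[of p G q] by (simp add: times_fun_def)

lemma gen_algebra_diff: "p \<in> gen_algebra G \<Longrightarrow> q \<in> gen_algebra G \<Longrightarrow> (\<lambda>x. p x - q x) \<in> gen_algebra G"
  using gen_algebra_add[OF _ gen_algebra_mult[OF gen_algebra.const[of "-1"]], of p G q] by simp

lemma gen_algebra_power: "p \<in> gen_algebra G \<Longrightarrow> (\<lambda>x. p x ^ n) \<in> gen_algebra G"
  by (induction n) (auto intro: gen_algebra_mult gen_algebra.const)

lemma gen_algebra_sum:
  "(\<And>i. i \<in> I \<Longrightarrow> p i \<in> gen_algebra G) \<Longrightarrow> (\<lambda>x. \<Sum>i\<in>I. p i x) \<in> gen_algebra G"
  by (induction I rule: infinite_finite_induct) (auto intro: gen_algebra_add gen_algebra.const)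

lemma gen_algebra_prod:
  "(\<And>i. i \<in> I \<Longrightarrow> p i \<in> gen_algebra G) \<Longrightarrow> (\<lambda>x. \<Prod>i\<in>I. p i x) \<in> gen_algebra G"
  by (induction I rule: infinite_finite_induct) (auto intro: gen_algebra_mult gen_algebra.const)

lemma coord_gen: "(\<lambda>x. x i) \<in> gen_algebra coords"
  by (rule gen_algebra.gen) (auto simp: coords_def)

lemma coord2_gen: "(\<lambda>z. fst z i) \<in> gen_algebra coords2" "(\<lambda>z. snd z i) \<in> gen_algebra coords2"
  by (auto intro!: gen_algebra.gen simp: coords2_def case_prod_unfold)

lemma coords2_cases:
  assumes "g \<in> coords2"
  obtains i where "g = (\<lambda>z. fst z i)" | i where "g = (\<lambda>z. snd z i)"
  using assms unfolding coords2_def case_prod_unfold by blast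

lemma coords_subst:
  assumes "p \<in> gen_algebra coords" and "\<And>i. \<exists>h\<in>gen_algebra H. \<forall>y\<in>D. r y i = h y"
  shows "\<exists>h\<in>gen_algebra H. \<forall>y\<in>D. p (r y) = h y"
  using assms(1) by (rule gen_algebra_subst) (use assms(2) in \<open>auto simp: coords_def\<close>)

lemma coords_subst':
  assumes "p \<in> gen_algebra coords" and "\<And>i. (\<lambda>y. r y i) \<in> gen_algebra H"
  shows "(\<lambda>y. p (r y)) \<in> gen_algebra H"
  using assms(1) by (rule gen_algebra_subst') (use assms(2) in \<open>auto simp: coords_def\<close>)

lemma coords2_subst:
  assumes "p \<in> gen_algebra coords2"
    and "\<And>i. \<exists>h\<in>gen_algebra H. \<forall>y\<in>D. r y i = h y" "\<And>i. \<exists>h\<in>gen_algebra H. \<forall>y\<in>D. s y i = h y"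
  shows "\<exists>h\<in>gen_algebra H. \<forall>y\<in>D. p (r y, s y) = h y"
  using assms(1) by (rule gen_algebra_subst) (use assms(2,3) in \<open>auto elim!: coords2_cases\<close>)

lemma coords2_subst':
  assumes "p \<in> gen_algebra coords2"
    and "\<And>i. (\<lambda>y. r y i) \<in> gen_algebra H" "\<And>i. (\<lambda>y. s y i) \<in> gen_algebra H"
  shows "(\<lambda>y. p (r y, s y)) \<in> gen_algebra H"
  using assms(1) by (rule gen_algebra_subst') (use assms(2,3) in \<open>auto elim!: coords2_cases\<close>)

section \<open>The Zariski topology\<close>

lemma topspace_zariski [simp]: "topspace (zariski G) = UNIV"
proof -
  have "openin (zariski G) UNIV"
    unfolding openin_zariski
    by (rule exI[of _ "{\<lambda>_. 1}"]) (auto intro: gen_algebra.const)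
  then show ?thesis by (meson openin_subset top.extremum_uniqueI)
qed

lemma openin_zariski_nonzero: "p \<in> gen_algebra G \<Longrightarrow> openin (zariski G) {x. p x \<noteq> 0}"
  unfolding openin_zariski by (intro exI[of _ "{p}"]) auto

lemma closedin_zariski:
  "closedin (zariski G) C \<longleftrightarrow> (\<exists>S \<subseteq> gen_algebra G. C = {x. \<forall>p\<in>S. p x = 0})"
proof -
  have "closedin (zariski G) C \<longleftrightarrow> openin (zariski G) (- C)"
    by (simp add: closedin_def Compl_eq_Diff_UNIV)
  also have "\<dots> \<longleftrightarrow> (\<exists>S \<subseteq> gen_algebra G. C = {x. \<forall>p\<in>S. p x = 0})"
    unfolding openin_zariski
  proof (intro ex_cong1 conj_cong refl)
    fix S
    show "(- C = {x. \<exists>p\<in>S. p x \<noteq> 0}) = (C = {x. \<forall>p\<in>S. p x = 0})" by auto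
  qed
  finally show ?thesis .
qed

lemma closedin_zariski_zero: "p \<in> gen_algebra G \<Longrightarrow> closedin (zariski G) {x. p x = 0}"
  unfolding closedin_zariski by (intro exI[of _ "{p}"]) auto

lemma continuous_map_zariski:
  assumes "\<And>h. h \<in> H \<Longrightarrow> (\<lambda>y. h (r y)) \<in> gen_algebra G"
  shows "continuous_map (zariski G) (zariski H) r"
  unfolding continuous_map_def
proof (intro conjI allI impI)
  fix W assume "openin (zariski H) W"
  then obtain S where S: "S \<subseteq> gen_algebra H" "W = {x. \<exists>p\<in>S. p x \<noteq> 0}" unfolding openin_zariski by blast
  have "{x \<in> topspace (zariski G). r x \<in> W} = {x. \<exists>q\<in>(\<lambda>p y. p (r y)) ` S. q x \<noteq> 0}"
    using S(2) by auto
  moreover have "(\<lambda>p y. p (r y)) ` S \<subseteq> gen_algebra G"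
  proof (rule image_subsetI)
    fix p assume "p \<in> S"
    then have "p \<in> gen_algebra H" using S(1) by blast
    then show "(\<lambda>y. p (r y)) \<in> gen_algebra G" by (rule gen_algebra_subst') (rule assms)
  qed
  ultimately show "openin (zariski G) {x \<in> topspace (zariski G). r x \<in> W}"
    unfolding openin_zariski by blast
qed auto

lemma continuous_map_zariski_coords:
  assumes "\<And>i. (\<lambda>y. r y i) \<in> gen_algebra G"
  shows "continuous_map (zariski G) (zariski coords) r"
  using assms by (intro continuous_map_zariski) (auto simp: coords_def)

lemma continuous_map_zariski_coords2:
  assumes "\<And>i. (\<lambda>y. r y i) \<in> gen_algebra G" "\<And>i. (\<lambda>y. s y i) \<in> gen_algebra G"
  shows "continuous_map (zariski G) (zariski coords2) (\<lambda>y. (r y, s y))"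
  using assms by (intro continuous_map_zariski) (auto elim!: coords2_cases)

lemma openin_zariski_vimage:
  assumes "continuous_map (zariski G) (zariski H) r" "openin (zariski H) W"
  shows "openin (zariski G) {x. r x \<in> W}"
  using openin_continuous_map_preimage[OF assms] by simp

lemma closedin_zariski_vimage:
  assumes "continuous_map (zariski G) (zariski H) r" "closedin (zariski H) C"
  shows "closedin (zariski G) {x. r x \<in> C}"
  using closedin_continuous_map_preimage[OF assms] by simp

lemma closedin_zariski_Int:
  "closedin (zariski G) {x. A x} \<Longrightarrow> closedin (zariski G) {x. B x} \<Longrightarrow> closedin (zariski G) {x. A x \<and> B x}"
  using closedin_Int[of "zariski G" "{x. A x}" "{x. B x}"] by (simp add: Collect_conj_eq)

text \<open>Closed sets are zero sets, so a closure is governed by the polynomials that vanish on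
  the set. Equality of two closures is thereby reduced to equality of vanishing conditions.\<close>

lemma closure_of_zariski_on:
  fixes X :: "(nat \<Rightarrow> 'k::field) set"
  assumes "A \<subseteq> X"
  shows "zariski_on X closure_of A
    = {x \<in> X. \<forall>p\<in>gen_algebra coords. (\<forall>a\<in>A. p a = 0) \<longrightarrow> p x = 0}" (is "_ = ?C")
proof
  have closed: "closedin (zariski coords) {x. \<forall>p\<in>{p \<in> gen_algebra coords. \<forall>a\<in>A. p a = 0}. p x = 0}"
    unfolding closedin_zariski by blast
  have eq: "?C = X \<inter> {x. \<forall>p\<in>{p \<in> gen_algebra coords. \<forall>a\<in>A. p a = 0}. p x = 0}" by blast
  have "closedin (zariski_on X) ?C" unfolding eq using closed by (rule closedin_subtopology_Int_closed)
  then show "zariski_on X closure_of A \<subseteq> ?C"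
    by (rule closure_of_minimal[rotated]) (use assms in blast)
  show "?C \<subseteq> zariski_on X closure_of A"
  proof
    fix x assume x: "x \<in> ?C"
    have "closedin (zariski_on X) (zariski_on X closure_of A)" by simp
    then obtain T where T: "closedin (zariski coords) T" "zariski_on X closure_of A = T \<inter> X"
      unfolding closedin_subtopology by blast
    obtain S where S: "S \<subseteq> gen_algebra coords" "T = {x. \<forall>p\<in>S. p x = 0}"
      using T(1) unfolding closedin_zariski by blast
    have "A \<subseteq> zariski_on X closure_of A" using assms by (intro closure_of_subset) auto
    then have "\<forall>p\<in>S. \<forall>a\<in>A. p a = 0" using T(2) S(2) by blast
    then have "x \<in> T" using x S by blast
    then show "x \<in> zariski_on X closure_of A" using x T(2) by blast
  qed
qed

section \<open>Irreducible spaces\<close>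

lemma irreducible_spaceI:
  assumes "topspace T \<noteq> {}"
    and "\<And>V W. openin T V \<Longrightarrow> openin T W \<Longrightarrow> V \<noteq> {} \<Longrightarrow> W \<noteq> {} \<Longrightarrow> V \<inter> W \<noteq> {}"
  shows "irreducible_space T"
  unfolding irreducible_space_def
proof (intro conjI allI impI assms(1))
  fix C D assume *: "closedin T C \<and> closedin T D \<and> topspace T = C \<union> D"
  then have "openin T (topspace T - C)" "openin T (topspace T - D)"
    by (blast intro: openin_diff[OF openin_topspace])+
  moreover have "(topspace T - C) \<inter> (topspace T - D) = {}" using * by blast
  ultimately have "topspace T - C = {} \<or> topspace T - D = {}" using assms(2) by blast
  then show "topspace T = C \<or> topspace T = D" using * by (auto dest: closedin_subset)
qed

lemma irreducible_spaceD:
  assumes "irreducible_space T" "openin T V" "openin T W" "V \<noteq> {}" "W \<noteq> {}"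
  shows "V \<inter> W \<noteq> {}"
proof
  assume "V \<inter> W = {}"
  then have "topspace T = (topspace T - V) \<union> (topspace T - W)" by blast
  moreover have "closedin T (topspace T - V)" "closedin T (topspace T - W)"
    using assms(2,3) by auto
  ultimately have "topspace T = topspace T - V \<or> topspace T = topspace T - W"
    using assms(1) unfolding irreducible_space_def by metis
  then show False using assms(2-5) openin_subset by blast
qed

text \<open>Separate continuity of the pairing suffices for products of irreducible spaces to be
  irreducible.\<close>

lemma irreducible_space_pairing:
  assumes S: "irreducible_space S" and T: "irreducible_space T"
    and R: "topspace R = (\<Union>b\<in>topspace S. f b ` topspace T)"
    and cont1: "\<And>c. c \<in> topspace T \<Longrightarrow> continuous_map S R (\<lambda>b. f b c)"
    and cont2: "\<And>b. b \<in> topspace S \<Longrightarrow> continuous_map T R (f b)"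
  shows "irreducible_space R"
proof (rule irreducible_spaceI)
  show "topspace R \<noteq> {}" using S T R by (auto simp: irreducible_space_def)
  fix V W assume V: "openin R V" "V \<noteq> {}" and W: "openin R W" "W \<noteq> {}"
  \<comment> \<open>The projection of \<open>V\<close> is a union of preimages under the slices with
    fixed second argument, each of which is open; no product topology enters.\<close>
  define pr where "pr V = (\<Union>c\<in>topspace T. {b \<in> topspace S. f b c \<in> V})" for V
  have op: "openin S (pr V)" if "openin R V" for V
    unfolding pr_def using openin_continuous_map_preimage[OF cont1 that] by blast
  have ne: "pr V \<noteq> {}" if V: "openin R V" "V \<noteq> {}" for V
  proof -
    obtain z where "z \<in> V" "z \<in> topspace R" using V openin_subset by blast
    then show ?thesis unfolding R pr_def by blast
  qed
  obtain b where b: "b \<in> pr V" "b \<in> pr W"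
    using irreducible_spaceD[OF S op[OF V(1)] op[OF W(1)] ne[OF V] ne[OF W]] by blast
  then have bS: "b \<in> topspace S" by (auto simp: pr_def)
  have "{c \<in> topspace T. f b c \<in> V} \<inter> {c \<in> topspace T. f b c \<in> W} \<noteq> {}"
    using b openin_continuous_map_preimage[OF cont2[OF bS]] V(1) W(1)
    by (intro irreducible_spaceD[OF T]) (auto simp: pr_def)
  then show "V \<inter> W \<noteq> {}" by blast
qed

text \<open>One argument for the line and for the hyperbola. Along the curve every polynomial
  function becomes a polynomial in the parameter after multiplication by a power of w, which has no
  zeros on D. So a nonempty open set contains all but finitely many parameters, and two such sets
  meet since D is infinite.\<close>

lemma irreducible_curve:
  fixes \<gamma> :: "'k::field \<Rightarrow> nat \<Rightarrow> 'k"
  assumes D: "infinite D" "\<And>a. a \<in> D \<Longrightarrow> poly w a \<noteq> 0"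
    and coord: "\<And>i. \<exists>q N. \<forall>a\<in>D. \<gamma> a i * poly w a ^ N = poly q a"
  shows "irreducible_space (zariski_on (\<gamma> ` D))"
proof (rule irreducible_spaceI)
  show "topspace (zariski_on (\<gamma> ` D)) \<noteq> {}" using D(1) by auto
  have rational: "\<exists>q N. \<forall>a\<in>D. p (\<gamma> a) * poly w a ^ N = poly q a" if "p \<in> gen_algebra coords" for p
    using that
  proof induction
    case (const c)
    show ?case by (rule exI[of _ "[:c:]"], rule exI[of _ 0]) simp
  next
    case (gen g)
    then show ?case using coord by (auto simp: coords_def)
  next
    case (add p q)
    then obtain r M s N where r: "\<forall>a\<in>D. p (\<gamma> a) * poly w a ^ M = poly r a"
      and s: "\<forall>a\<in>D. q (\<gamma> a) * poly w a ^ N = poly s a" by blast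
    have "(p + q) (\<gamma> a) * poly w a ^ (M + N) = poly (r * w ^ N + s * w ^ M) a" if a: "a \<in> D" for a
    proof -
      have "(p + q) (\<gamma> a) * poly w a ^ (M + N)
          = (p (\<gamma> a) * poly w a ^ M) * poly w a ^ N + (q (\<gamma> a) * poly w a ^ N) * poly w a ^ M"
        by (simp add: power_add algebra_simps)
      then show ?thesis using r s a by simp
    qed
    then show ?case by blast
  next
    case (mult p q)
    then obtain r M s N where r: "\<forall>a\<in>D. p (\<gamma> a) * poly w a ^ M = poly r a"
      and s: "\<forall>a\<in>D. q (\<gamma> a) * poly w a ^ N = poly s a" by blast
    have "(p * q) (\<gamma> a) * poly w a ^ (M + N) = poly (r * s) a" if a: "a \<in> D" for a
    proof -
      have "(p * q) (\<gamma> a) * poly w a ^ (M + N) = (p (\<gamma> a) * poly w a ^ M) * (q (\<gamma> a) * poly w a ^ N)"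
        by (simp add: power_add algebra_simps)
      then show ?thesis using r s a by simp
    qed
    then show ?case by blast
  qed
  have *: "\<exists>q. q \<noteq> 0 \<and> (\<forall>a\<in>D. poly q a \<noteq> 0 \<longrightarrow> \<gamma> a \<in> V)"
    if V: "openin (zariski_on (\<gamma> ` D)) V" "V \<noteq> {}" for V
  proof -
    obtain S where S: "S \<subseteq> gen_algebra coords" "V = {x. \<exists>p\<in>S. p x \<noteq> 0} \<inter> \<gamma> ` D"
      using V(1) unfolding openin_subtopology openin_zariski by blast
    obtain x where x: "x \<in> V" using V(2) by blast
    then obtain p a where p: "p \<in> S" "a \<in> D" "p (\<gamma> a) \<noteq> 0" using S(2) by auto
    have "p \<in> gen_algebra coords" using S(1) p(1) by blast
    from rational[OF this] obtain q N where "\<forall>a\<in>D. p (\<gamma> a) * poly w a ^ N = poly q a" by (elim exE)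
    then have q: "poly q a = 0 \<longleftrightarrow> p (\<gamma> a) = 0" if "a \<in> D" for a
      using that D(2)[OF that] by (metis mult_eq_0_iff power_not_zero)
    have "q \<noteq> 0" using q[OF p(2)] p(3) by auto
    moreover have "\<forall>a\<in>D. poly q a \<noteq> 0 \<longrightarrow> \<gamma> a \<in> V" using S(2) q p(1) by auto
    ultimately show ?thesis by blast
  qed
  fix V W assume V: "openin (zariski_on (\<gamma> ` D)) V" "V \<noteq> {}"
    and W: "openin (zariski_on (\<gamma> ` D)) W" "W \<noteq> {}"
  obtain q r where q: "q \<noteq> 0" "\<forall>a\<in>D. poly q a \<noteq> 0 \<longrightarrow> \<gamma> a \<in> V"
    and r: "r \<noteq> 0" "\<forall>a\<in>D. poly r a \<noteq> 0 \<longrightarrow> \<gamma> a \<in> W"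
    using *[OF V] *[OF W] by blast
  have "finite {a. poly (q * r) a = 0}" using q(1) r(1) by (intro poly_roots_finite) simp
  then obtain a where "a \<in> D" "poly (q * r) a \<noteq> 0"
    using D(1) by (metis (mono_tags, lifting) finite_subset mem_Collect_eq subsetI)
  then show "V \<inter> W \<noteq> {}" using q(2) r(2) by auto
qed


section \<open>Products of varieties\<close>

text \<open>Pairs of sequences are encoded by interleaving, so that products stay in the type that
  \<open>Aut0\<close> prescribes for bases of families.\<close>

definition join :: "(nat \<Rightarrow> 'a) \<Rightarrow> (nat \<Rightarrow> 'a) \<Rightarrow> nat \<Rightarrow> 'a" where
  "join b c i = (if even i then b (i div 2) else c (i div 2))"

definition left :: "(nat \<Rightarrow> 'a) \<Rightarrow> nat \<Rightarrow> 'a" where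
  "left w i = w (2 * i)"

definition right :: "(nat \<Rightarrow> 'a) \<Rightarrow> nat \<Rightarrow> 'a" where
  "right w i = w (2 * i + 1)"

definition join_set :: "(nat \<Rightarrow> 'a) set \<Rightarrow> (nat \<Rightarrow> 'a) set \<Rightarrow> (nat \<Rightarrow> 'a) set" where
  "join_set U V = {w. left w \<in> U \<and> right w \<in> V}"

definition join_map :: "((nat \<Rightarrow> 'a) \<Rightarrow> nat \<Rightarrow> 'b) \<Rightarrow> ((nat \<Rightarrow> 'a) \<Rightarrow> nat \<Rightarrow> 'b) \<Rightarrow> (nat \<Rightarrow> 'a) \<Rightarrow> nat \<Rightarrow> 'b" where
  "join_map f g w = join (f (left w)) (g (right w))"

definition join_atlas ::
  "((nat \<Rightarrow> 'a) set \<times> ((nat \<Rightarrow> 'a) \<Rightarrow> nat \<Rightarrow> 'b)) set \<Rightarrow>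
   ((nat \<Rightarrow> 'a) set \<times> ((nat \<Rightarrow> 'a) \<Rightarrow> nat \<Rightarrow> 'b)) set \<Rightarrow>
   ((nat \<Rightarrow> 'a) set \<times> ((nat \<Rightarrow> 'a) \<Rightarrow> nat \<Rightarrow> 'b)) set" where
  "join_atlas \<A> \<B> = (\<lambda>((U, \<phi>), (V, \<psi>)). (join_set U V, join_map \<phi> \<psi>)) ` (\<A> \<times> \<B>)"

section \<open>Interleaved pairs\<close>

lemma left_join [simp]: "left (join b c) = b"
  and right_join [simp]: "right (join b c) = c"
  and join_left_right [simp]: "join (left w) (right w) = w"
  by (auto simp: left_def right_def join_def fun_eq_iff)

lemma join_set_iff [simp]: "join b c \<in> join_set U V \<longleftrightarrow> b \<in> U \<and> c \<in> V"
  by (simp add: join_set_def)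

lemma left_right_join_map [simp]:
  "left (join_map f g w) = f (left w)" "right (join_map f g w) = g (right w)"
  by (simp_all add: join_map_def)

lemma join_map_image: "join_map f g ` join_set U V = join_set (f ` U) (g ` V)"
proof (intro equalityI subsetI)
  fix w assume "w \<in> join_set (f ` U) (g ` V)"
  then obtain b c where "b \<in> U" "left w = f b" "c \<in> V" "right w = g c" by (auto simp: join_set_def)
  then have "w = join_map f g (join b c)" "join b c \<in> join_set U V"
    by (auto simp: join_map_def) (metis join_left_right)
  then show "w \<in> join_map f g ` join_set U V" by blast
qed (auto simp: join_set_def)

lemma join_set_Int: "join_set U V \<inter> join_set U' V' = join_set (U \<inter> U') (V \<inter> V')"
  by (auto simp: join_set_def)

lemma inj_on_join_map:
  assumes "inj_on f U" "inj_on g V"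
  shows "inj_on (join_map f g) (join_set U V)"
  using assms by (intro inj_onI)
    (metis (no_types, lifting) inj_onD join_left_right join_set_iff left_right_join_map)

lemma inv_into_join_map:
  assumes "inj_on f U" "inj_on g V" "v \<in> join_set (f ` U) (g ` V)"
  shows "inv_into (join_set U V) (join_map f g) v = join (inv_into U f (left v)) (inv_into V g (right v))"
proof (rule inv_into_f_eq[OF inj_on_join_map[OF assms(1,2)]])
  have "left v \<in> f ` U" "right v \<in> g ` V" using assms(3) by (auto simp: join_set_def)
  then show "join (inv_into U f (left v)) (inv_into V g (right v)) \<in> join_set U V"
    "join_map f g (join (inv_into U f (left v)) (inv_into V g (right v))) = v"
    by (auto simp: inv_into_into f_inv_into_f join_map_def)
qed

lemma left_gen: "(\<lambda>w. left w i) \<in> gen_algebra coords" "(\<lambda>w. right w i) \<in> gen_algebra coords"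
  unfolding left_def right_def by (rule coord_gen)+

lemma continuous_left: "continuous_map (zariski coords) (zariski coords) left"
  and continuous_right: "continuous_map (zariski coords) (zariski coords) right"
  by (intro continuous_map_zariski_coords left_gen)+

lemma continuous_join:
  "continuous_map (zariski coords) (zariski coords) (join b)"
  "continuous_map (zariski coords) (zariski coords) (\<lambda>b. join b c)"
proof -
  show "continuous_map (zariski coords) (zariski coords) (join b)"
  proof (rule continuous_map_zariski_coords)
    show "(\<lambda>y. join b y i) \<in> gen_algebra coords" for i
      unfolding join_def by (cases "even i") (auto intro: coord_gen gen_algebra.const)
  qed
  show "continuous_map (zariski coords) (zariski coords) (\<lambda>b. join b c)"
  proof (rule continuous_map_zariski_coords)
    show "(\<lambda>y. join y c i) \<in> gen_algebra coords" for i
      unfolding join_def by (cases "even i") (auto intro: coord_gen gen_algebra.const)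
  qed
qed

section \<open>The product atlas\<close>

lemma varietyD:
  assumes "variety B \<A>"
  shows "finite \<A>" "B = (\<Union>(U, \<phi>)\<in>\<A>. U)"
    "\<And>U \<phi>. (U, \<phi>) \<in> \<A> \<Longrightarrow> inj_on \<phi> U"
    "\<And>U \<phi>. (U, \<phi>) \<in> \<A> \<Longrightarrow> affine_variety (\<phi> ` U)"
    "\<And>U \<phi> U' \<phi>'. (U, \<phi>) \<in> \<A> \<Longrightarrow> (U', \<phi>') \<in> \<A> \<Longrightarrow> openin (zariski_on (\<phi> ` U)) (\<phi> ` (U \<inter> U'))"
    "\<And>U \<phi> U' \<phi>'. (U, \<phi>) \<in> \<A> \<Longrightarrow> (U', \<phi>') \<in> \<A> \<Longrightarrow>
       regular_map_on (\<phi> ` (U \<inter> U')) (\<lambda>v. \<phi>' (inv_into U \<phi> v))"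
    "\<And>U \<phi> U' \<phi>'. (U, \<phi>) \<in> \<A> \<Longrightarrow> (U', \<phi>') \<in> \<A> \<Longrightarrow>
       closedin (zariski coords2) ((\<lambda>b. (\<phi> b, \<phi>' b)) ` (U \<inter> U'))"
  using assms unfolding variety_def by fast+

lemma join_atlas_iff:
  "(W, \<chi>) \<in> join_atlas \<A> \<B> \<longleftrightarrow>
     (\<exists>U \<phi> V \<psi>. (U, \<phi>) \<in> \<A> \<and> (V, \<psi>) \<in> \<B> \<and> W = join_set U V \<and> \<chi> = join_map \<phi> \<psi>)"
  unfolding join_atlas_def by force

lemma affine_variety_join_set:
  assumes "affine_variety U" "affine_variety V"
  shows "affine_variety (join_set U V)"
proof -
  obtain n m where n: "U \<subseteq> affine_space n" "V \<subseteq> affine_space m"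
    using assms by (auto simp: affine_variety_def)
  have "join_set U V \<subseteq> affine_space (2 * (n + m))"
  proof
    fix w assume "w \<in> join_set U V"
    then have z: "\<forall>i\<ge>n. left w i = 0" "\<forall>i\<ge>m. right w i = 0"
      using n by (auto simp: join_set_def affine_space_def)
    have "w i = 0" if "2 * (n + m) \<le> i" for i
    proof -
      have "n \<le> i div 2" "m \<le> i div 2" using that by auto
      then have "join (left w) (right w) i = 0" using z unfolding join_def by simp
      then show ?thesis by simp
    qed
    then show "w \<in> affine_space (2 * (n + m))" by (simp add: affine_space_def)
  qed
  moreover have "closedin (zariski coords) (join_set U V)"
    unfolding join_set_def using assms
    by (intro closedin_zariski_Int closedin_zariski_vimage[OF continuous_left]
        closedin_zariski_vimage[OF continuous_right]) (auto simp: affine_variety_def)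
  ultimately show ?thesis by (auto simp: affine_variety_def)
qed

lemma openin_zariski_on_join_set:
  assumes "openin (zariski_on U) Q" "openin (zariski_on V) R"
  shows "openin (zariski_on (join_set U V)) (join_set Q R)"
proof -
  obtain S T where S: "openin (zariski coords) S" "Q = S \<inter> U" and T: "openin (zariski coords) T" "R = T \<inter> V"
    using assms unfolding openin_subtopology by blast
  have "openin (zariski coords) ({w. left w \<in> S} \<inter> {w. right w \<in> T})"
    by (intro openin_Int openin_zariski_vimage[OF continuous_left S(1)]
        openin_zariski_vimage[OF continuous_right T(1)])
  moreover have "join_set Q R = ({w. left w \<in> S} \<inter> {w. right w \<in> T}) \<inter> join_set U V"
    unfolding S(2) T(2) join_set_def by blast
  ultimately show ?thesis unfolding openin_subtopology by blast
qed

text \<open>Each component of a product map depends on one factor only. The lemma transports the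
  local fractions of that factor along the projection \<pi>, which will be \<open>left\<close> or
  \<open>right\<close>.\<close>

lemma regular_map_on_pullback:
  assumes f: "regular_map_on U f" and \<pi>: "\<And>i. (\<lambda>v. \<pi> v i) \<in> gen_algebra coords"
    and W: "\<And>v. v \<in> W \<Longrightarrow> \<pi> v \<in> U" "\<And>v. v \<in> W \<Longrightarrow> h v = f (\<pi> v) i" "w \<in> W"
  shows "\<exists>Q p q. openin (zariski_on W) Q \<and> w \<in> Q \<and> p \<in> gen_algebra coords \<and>
    q \<in> gen_algebra coords \<and> (\<forall>v\<in>Q. q v \<noteq> 0 \<and> h v = p v / q v)"
proof -
  obtain Q p q where Q: "openin (zariski_on U) Q" "\<pi> w \<in> Q" "p \<in> gen_algebra coords"
    "q \<in> gen_algebra coords" "\<forall>v\<in>Q. q v \<noteq> 0 \<and> f v i = p v / q v"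
    using f W(1)[OF W(3)] unfolding regular_map_on_def by meson
  obtain T where T: "openin (zariski coords) T" "Q = T \<inter> U" using Q(1) unfolding openin_subtopology by blast
  show ?thesis
  proof (intro exI conjI ballI)
    show "openin (zariski_on W) ({v. \<pi> v \<in> T} \<inter> W)"
      unfolding openin_subtopology
      by (intro exI[of _ "{v. \<pi> v \<in> T}"] conjI refl
          openin_zariski_vimage[OF continuous_map_zariski_coords[OF \<pi>] T(1)])
    show "w \<in> {v. \<pi> v \<in> T} \<inter> W" using Q(2) T(2) W(3) by simp
    show "(\<lambda>v. p (\<pi> v)) \<in> gen_algebra coords" "(\<lambda>v. q (\<pi> v)) \<in> gen_algebra coords"
      using Q(3,4) by (auto intro: coords_subst' \<pi>)
    show "q (\<pi> v) \<noteq> 0" "h v = p (\<pi> v) / q (\<pi> v)" if "v \<in> {v. \<pi> v \<in> T} \<inter> W" for v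
      using that Q(5) T(2) W(1,2) by auto
  qed
qed

lemma regular_map_on_join_map:
  assumes f: "regular_map_on U f" and g: "regular_map_on V g"
    and h: "\<And>w. w \<in> join_set U V \<Longrightarrow> h w = join_map f g w"
  shows "regular_map_on (join_set U V) h"
  unfolding regular_map_on_def
proof (intro allI ballI)
  fix j w assume w: "w \<in> join_set U V"
  show "\<exists>Q p q. openin (zariski_on (join_set U V)) Q \<and> w \<in> Q \<and> p \<in> gen_algebra coords \<and>
      q \<in> gen_algebra coords \<and> (\<forall>v\<in>Q. q v \<noteq> 0 \<and> h v j = p v / q v)"
  proof (cases "even j")
    case True
    have *: "left v \<in> U" "h v j = f (left v) (j div 2)" if "v \<in> join_set U V" for v
      using that True by (auto simp: join_set_def h[OF that] join_map_def join_def)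
    show ?thesis by (rule regular_map_on_pullback[OF f left_gen(1) * w])
  next
    case False
    have *: "right v \<in> V" "h v j = g (right v) (j div 2)" if "v \<in> join_set U V" for v
      using that False by (auto simp: join_set_def h[OF that] join_map_def join_def)
    show ?thesis by (rule regular_map_on_pullback[OF g left_gen(2) * w])
  qed
qed

lemma variety_join:
  assumes A: "variety B \<A>" and C: "variety C \<B>"
  shows "variety (join_set B C) (join_atlas \<A> \<B>)"
proof -
  have chart: "inj_on \<chi> W" "affine_variety (\<chi> ` W)" if mem: "(W, \<chi>) \<in> join_atlas \<A> \<B>" for W \<chi>
  proof -
    obtain U \<phi> V \<psi> where *: "(U, \<phi>) \<in> \<A>" "(V, \<psi>) \<in> \<B>" and W: "W = join_set U V" "\<chi> = join_map \<phi> \<psi>"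
      using mem unfolding join_atlas_iff by blast
    show "inj_on \<chi> W" unfolding W using * varietyD(3)[OF A] varietyD(3)[OF C] by (intro inj_on_join_map)
    show "affine_variety (\<chi> ` W)" unfolding W join_map_image
      using * varietyD(4)[OF A] varietyD(4)[OF C] by (intro affine_variety_join_set)
  qed
  have overlap: "openin (zariski_on (\<chi> ` W)) (\<chi> ` (W \<inter> W'))"
    "regular_map_on (\<chi> ` (W \<inter> W')) (\<lambda>v. \<chi>' (inv_into W \<chi> v))"
    "closedin (zariski coords2) ((\<lambda>b. (\<chi> b, \<chi>' b)) ` (W \<inter> W'))"
    if mem: "(W, \<chi>) \<in> join_atlas \<A> \<B>" "(W', \<chi>') \<in> join_atlas \<A> \<B>" for W \<chi> W' \<chi>'
  proof -
    obtain U \<phi> V \<psi> where *: "(U, \<phi>) \<in> \<A>" "(V, \<psi>) \<in> \<B>" and W: "W = join_set U V" "\<chi> = join_map \<phi> \<psi>"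
      using mem(1) unfolding join_atlas_iff by blast
    obtain U' \<phi>' V' \<psi>' where k': "(U', \<phi>') \<in> \<A>" "(V', \<psi>') \<in> \<B>"
      and W': "W' = join_set U' V'" "\<chi>' = join_map \<phi>' \<psi>'"
      using mem(2) unfolding join_atlas_iff by blast
    show "openin (zariski_on (\<chi> ` W)) (\<chi> ` (W \<inter> W'))"
      unfolding W W' join_set_Int join_map_image
      using * k' varietyD(5)[OF A] varietyD(5)[OF C] by (intro openin_zariski_on_join_set)
    show "regular_map_on (\<chi> ` (W \<inter> W')) (\<lambda>v. \<chi>' (inv_into W \<chi> v))"
      unfolding W W' join_set_Int join_map_image
    proof (rule regular_map_on_join_map[OF varietyD(6)[OF A *(1) k'(1)] varietyD(6)[OF C *(2) k'(2)]])
      fix w assume "w \<in> join_set (\<phi> ` (U \<inter> U')) (\<psi> ` (V \<inter> V'))"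
      then have "w \<in> join_set (\<phi> ` U) (\<psi> ` V)" by (auto simp: join_set_def)
      then show "join_map \<phi>' \<psi>' (inv_into (join_set U V) (join_map \<phi> \<psi>) w)
          = join_map (\<lambda>v. \<phi>' (inv_into U \<phi> v)) (\<lambda>v. \<psi>' (inv_into V \<psi> v)) w"
        using inv_into_join_map[OF varietyD(3)[OF A *(1)] varietyD(3)[OF C *(2)]]
        by (simp add: join_map_def)
    qed
    let ?D = "(\<lambda>b. (\<phi> b, \<phi>' b)) ` (U \<inter> U')" and ?E = "(\<lambda>b. (\<psi> b, \<psi>' b)) ` (V \<inter> V')"
    \<comment> \<open>Up to reordering of coordinates, the graph for a product of charts is the
      product of the two graphs, hence an intersection of two preimages of closed sets.\<close>
    have "(\<lambda>b. (\<chi> b, \<chi>' b)) ` (W \<inter> W')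
        = {z. (left (fst z), left (snd z)) \<in> ?D \<and> (right (fst z), right (snd z)) \<in> ?E}"
    proof (intro equalityI subsetI)
      fix z assume "z \<in> (\<lambda>b. (\<chi> b, \<chi>' b)) ` (W \<inter> W')"
      then show "z \<in> {z. (left (fst z), left (snd z)) \<in> ?D \<and> (right (fst z), right (snd z)) \<in> ?E}"
        unfolding W W' by (auto simp: join_set_def)
    next
      fix z assume "z \<in> {z. (left (fst z), left (snd z)) \<in> ?D \<and> (right (fst z), right (snd z)) \<in> ?E}"
      then obtain b c where b: "b \<in> U \<inter> U'" "left (fst z) = \<phi> b" "left (snd z) = \<phi>' b"
        and c: "c \<in> V \<inter> V'" "right (fst z) = \<psi> c" "right (snd z) = \<psi>' c" by auto
      have "fst z = \<chi> (join b c)" "snd z = \<chi>' (join b c)"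
        using b(2,3) c(2,3) unfolding W W' join_map_def left_join right_join by (metis join_left_right)+
      then have "z = (\<chi> (join b c), \<chi>' (join b c))" by (simp add: prod_eq_iff)
      moreover have "join b c \<in> W \<inter> W'" using b(1) c(1) W W' by simp
      ultimately show "z \<in> (\<lambda>b. (\<chi> b, \<chi>' b)) ` (W \<inter> W')" by blast
    qed
    also have "closedin (zariski coords2) \<dots>"
    proof (rule closedin_zariski_Int)
      have "continuous_map (zariski coords2) (zariski coords2) (\<lambda>z. (left (fst z), left (snd z)))"
        by (intro continuous_map_zariski_coords2) (auto simp: left_def intro: coord2_gen)
      then show "closedin (zariski coords2) {z. (left (fst z), left (snd z)) \<in> ?D}"
        using varietyD(7)[OF A *(1) k'(1)] by (rule closedin_zariski_vimage)
      have "continuous_map (zariski coords2) (zariski coords2) (\<lambda>z. (right (fst z), right (snd z)))"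
        by (intro continuous_map_zariski_coords2) (auto simp: right_def intro: coord2_gen)
      then show "closedin (zariski coords2) {z. (right (fst z), right (snd z)) \<in> ?E}"
        using varietyD(7)[OF C *(2) k'(2)] by (rule closedin_zariski_vimage)
    qed
    finally show "closedin (zariski coords2) ((\<lambda>b. (\<chi> b, \<chi>' b)) ` (W \<inter> W'))" .
  qed
  have "join_set B C = (\<Union>(W, \<chi>)\<in>join_atlas \<A> \<B>. W)"
  proof (intro equalityI subsetI)
    fix w assume "w \<in> join_set B C"
    then obtain U \<phi> V \<psi> where "(U, \<phi>) \<in> \<A>" "left w \<in> U" "(V, \<psi>) \<in> \<B>" "right w \<in> V"
      using varietyD(2)[OF A] varietyD(2)[OF C] by (auto simp: join_set_def)
    then show "w \<in> (\<Union>(W, \<chi>)\<in>join_atlas \<A> \<B>. W)"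
      by (intro UN_I[of "(join_set U V, join_map \<phi> \<psi>)"]) (auto simp: join_atlas_iff join_set_def)
  next
    fix w assume "w \<in> (\<Union>(W, \<chi>)\<in>join_atlas \<A> \<B>. W)"
    then obtain W \<chi> where "(W, \<chi>) \<in> join_atlas \<A> \<B>" "w \<in> W" by blast
    then obtain U \<phi> V \<psi> where "(U, \<phi>) \<in> \<A>" "(V, \<psi>) \<in> \<B>" "w \<in> join_set U V"
      unfolding join_atlas_iff by blast
    then show "w \<in> join_set B C" using varietyD(2)[OF A] varietyD(2)[OF C] by (auto simp: join_set_def)
  qed
  moreover have "finite (join_atlas \<A> \<B>)"
    unfolding join_atlas_def using varietyD(1)[OF A] varietyD(1)[OF C] by simp
  ultimately show ?thesis unfolding variety_def using chart overlap by auto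
qed

section \<open>Topology of a product variety\<close>

lemma topspace_variety_topology:
  assumes "variety B \<A>"
  shows "topspace (variety_topology B \<A>) = B"
proof -
  have "openin (variety_topology B \<A>) B"
    unfolding openin_variety_topology
  proof (intro conjI ballI subset_refl, clarify)
    fix U \<phi> assume "(U, \<phi>) \<in> \<A>"
    then have "B \<inter> U = \<phi> -` UNIV \<inter> U" using varietyD(2)[OF assms] by auto
    then show "openin (pullback_topology U \<phi> (zariski coords)) (B \<inter> U)"
      unfolding openin_pullback_topology by (intro exI[of _ UNIV]) (metis openin_topspace topspace_zariski)
  qed
  moreover have "W \<subseteq> B" if "openin (variety_topology B \<A>) W" for W
    using that unfolding openin_variety_topology by blast
  ultimately show ?thesis by (meson openin_subset openin_topspace subset_antisym)
qed

lemma openin_variety_topology_vimage: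
  assumes C: "variety C \<B>"
    and T: "\<And>V \<psi>. (V, \<psi>) \<in> \<B> \<Longrightarrow> \<exists>T. openin (zariski coords) T \<and> (\<forall>c\<in>V. r c \<in> W \<longleftrightarrow> \<psi> c \<in> T)"
  shows "openin (variety_topology C \<B>) {c \<in> C. r c \<in> W}"
  unfolding openin_variety_topology
proof (intro conjI ballI, blast, clarify)
  fix V \<psi> assume V: "(V, \<psi>) \<in> \<B>"
  from T[OF this] obtain T where "openin (zariski coords) T" "\<forall>c\<in>V. r c \<in> W \<longleftrightarrow> \<psi> c \<in> T" by blast
  moreover from this have "{c \<in> C. r c \<in> W} \<inter> V = \<psi> -` T \<inter> V" using V varietyD(2)[OF C] by blast
  ultimately show "openin (pullback_topology V \<psi> (zariski coords)) ({c \<in> C. r c \<in> W} \<inter> V)"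
    unfolding openin_pullback_topology by blast
qed

text \<open>The two slice inclusions supply the separate continuity that
  \<open>irreducible_space_pairing\<close> asks for.\<close>

lemma continuous_join_variety:
  assumes A: "variety B \<A>" and C: "variety C \<B>"
  shows "b \<in> B \<Longrightarrow> continuous_map (variety_topology C \<B>)
      (variety_topology (join_set B C) (join_atlas \<A> \<B>)) (join b)"
    and "c \<in> C \<Longrightarrow> continuous_map (variety_topology B \<A>)
      (variety_topology (join_set B C) (join_atlas \<A> \<B>)) (\<lambda>b. join b c)"
proof -
  note top = topspace_variety_topology[OF A] topspace_variety_topology[OF C]
    topspace_variety_topology[OF variety_join[OF A C]]
  have chart: "\<exists>T. openin (zariski coords) T \<and>
      (\<forall>b\<in>U. \<forall>c\<in>V. join b c \<in> W \<longleftrightarrow> join (\<phi> b) (\<psi> c) \<in> T)"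
    if "openin (variety_topology (join_set B C) (join_atlas \<A> \<B>)) W" "(U, \<phi>) \<in> \<A>" "(V, \<psi>) \<in> \<B>"
    for W U \<phi> V \<psi>
  proof -
    have "(join_set U V, join_map \<phi> \<psi>) \<in> join_atlas \<A> \<B>" using that(2,3) unfolding join_atlas_iff by blast
    then have "\<exists>T. openin (zariski coords) T \<and> W \<inter> join_set U V = join_map \<phi> \<psi> -` T \<inter> join_set U V"
      using that(1) unfolding openin_variety_topology openin_pullback_topology by fast
    then obtain T where T: "openin (zariski coords) T" "W \<inter> join_set U V = join_map \<phi> \<psi> -` T \<inter> join_set U V"
      by blast
    have "join b c \<in> W \<longleftrightarrow> join (\<phi> b) (\<psi> c) \<in> T" if bc: "b \<in> U" "c \<in> V" for b c
    proof -
      have "join b c \<in> W \<longleftrightarrow> join b c \<in> W \<inter> join_set U V" using bc by simp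
      also have "\<dots> \<longleftrightarrow> join (\<phi> b) (\<psi> c) \<in> T" unfolding T(2) using bc by (simp add: join_map_def)
      finally show ?thesis .
    qed
    then show ?thesis using T(1) by blast
  qed
  show "continuous_map (variety_topology C \<B>)
      (variety_topology (join_set B C) (join_atlas \<A> \<B>)) (join b)" if b: "b \<in> B"
    unfolding continuous_map_def top
  proof (intro conjI allI impI openin_variety_topology_vimage[OF C])
    show "join b \<in> C \<rightarrow> join_set B C" using b by simp
    fix W V \<psi> assume W: "openin (variety_topology (join_set B C) (join_atlas \<A> \<B>)) W" "(V, \<psi>) \<in> \<B>"
    obtain U \<phi> where U: "(U, \<phi>) \<in> \<A>" "b \<in> U" using b varietyD(2)[OF A] by blast
    obtain T where "openin (zariski coords) T" "\<forall>c\<in>V. join b c \<in> W \<longleftrightarrow> join (\<phi> b) (\<psi> c) \<in> T"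
      using chart[OF W(1) U(1) W(2)] U(2) by blast
    then show "\<exists>T. openin (zariski coords) T \<and> (\<forall>c\<in>V. join b c \<in> W \<longleftrightarrow> \<psi> c \<in> T)"
      using openin_zariski_vimage[OF continuous_join(1)]
      by (intro exI[of _ "{y. join (\<phi> b) y \<in> T}"]) auto
  qed
  show "continuous_map (variety_topology B \<A>)
      (variety_topology (join_set B C) (join_atlas \<A> \<B>)) (\<lambda>b. join b c)" if c: "c \<in> C"
    unfolding continuous_map_def top
  proof (intro conjI allI impI openin_variety_topology_vimage[OF A])
    show "(\<lambda>b. join b c) \<in> B \<rightarrow> join_set B C" using c by simp
    fix W U \<phi> assume W: "openin (variety_topology (join_set B C) (join_atlas \<A> \<B>)) W" "(U, \<phi>) \<in> \<A>"
    obtain V \<psi> where V: "(V, \<psi>) \<in> \<B>" "c \<in> V" using c varietyD(2)[OF C] by blast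
    obtain T where "openin (zariski coords) T" "\<forall>b\<in>U. join b c \<in> W \<longleftrightarrow> join (\<phi> b) (\<psi> c) \<in> T"
      using chart[OF W V(1)] V(2) by blast
    then show "\<exists>T. openin (zariski coords) T \<and> (\<forall>b\<in>U. join b c \<in> W \<longleftrightarrow> \<phi> b \<in> T)"
      using openin_zariski_vimage[OF continuous_join(2)]
      by (intro exI[of _ "{y. join y (\<psi> c) \<in> T}"]) auto
  qed
qed

lemma irreducible_variety_join:
  assumes A: "variety B \<A>" "irreducible_space (variety_topology B \<A>)"
    and C: "variety C \<B>" "irreducible_space (variety_topology C \<B>)"
  shows "irreducible_space (variety_topology (join_set B C) (join_atlas \<A> \<B>))"
proof (rule irreducible_space_pairing[OF A(2) C(2)])
  note top = topspace_variety_topology[OF A(1)] topspace_variety_topology[OF C(1)]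
    topspace_variety_topology[OF variety_join[OF A(1) C(1)]]
  have "join_set B C = (\<Union>b\<in>B. join b ` C)"
  proof (intro equalityI subsetI)
    fix w assume "w \<in> join_set B C"
    then have "left w \<in> B" "right w \<in> C" "w = join (left w) (right w)" by (auto simp: join_set_def)
    then show "w \<in> (\<Union>b\<in>B. join b ` C)" by blast
  qed auto
  then show "topspace (variety_topology (join_set B C) (join_atlas \<A> \<B>)) =
    (\<Union>b\<in>topspace (variety_topology B \<A>). join b ` topspace (variety_topology C \<B>))"
    unfolding top .
qed (use continuous_join_variety[OF A(1) C(1)] topspace_variety_topology[OF A(1)]
    topspace_variety_topology[OF C(1)] in auto)


section \<open>The neutral component\<close>

lemma automorphism_bij: "automorphism X \<phi> \<Longrightarrow> bij_betw \<phi> X X"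
  by (simp add: automorphism_def)

lemma automorphism_in: "automorphism X \<phi> \<Longrightarrow> x \<in> X \<Longrightarrow> \<phi> x \<in> X"
  by (auto dest: automorphism_bij bij_betwE)

lemma poly_map_comp:
  assumes f: "poly_map coords X f" and g: "poly_map G D g" and gX: "\<And>x. x \<in> D \<Longrightarrow> g x \<in> X"
    and h: "\<And>x. x \<in> D \<Longrightarrow> h x = f (g x)"
  shows "poly_map G D h"
  unfolding poly_map_def
proof
  fix j
  obtain p where p: "p \<in> gen_algebra coords" "\<forall>x\<in>X. f x j = p x" using f unfolding poly_map_def by blast
  have "\<exists>q\<in>gen_algebra G. \<forall>x\<in>D. p (g x) = q x"
    by (rule coords_subst[OF p(1)]) (use g in \<open>auto simp: poly_map_def\<close>)
  then show "\<exists>q\<in>gen_algebra G. \<forall>x\<in>D. h x j = q x" using p(2) gX h by force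
qed

lemma automorphismI:
  assumes "\<And>x. x \<in> X \<Longrightarrow> f x \<in> X" "\<And>x. x \<in> X \<Longrightarrow> g x \<in> X"
    and "\<And>x. x \<in> X \<Longrightarrow> g (f x) = x" "\<And>x. x \<in> X \<Longrightarrow> f (g x) = x"
    and "poly_map coords X f" "poly_map coords X g"
  shows "automorphism X f"
proof -
  have bij: "bij_betw f X X" by (rule bij_betw_byWitness[where f' = g]) (use assms(1-4) in auto)
  have "inv_into X f x = g x" if "x \<in> X" for x
    using that assms(2,4) bij by (intro inv_into_f_eq) (auto simp: bij_betw_def)
  then have "poly_map coords X (inv_into X f)" using assms(6) by (simp add: poly_map_def)
  then show ?thesis using bij assms(5) by (simp add: automorphism_def)
qed

lemma automorphism_comp:
  assumes f: "automorphism X f" and g: "automorphism X g"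
  shows "automorphism X (\<lambda>x. f (g x))"
proof (rule automorphismI)
  note bf = automorphism_bij[OF f] and bg = automorphism_bij[OF g]
  have inv: "inv_into X f x \<in> X" "inv_into X g x \<in> X" if "x \<in> X" for x
    using that bf bg by (auto simp: bij_betw_def inv_into_into)
  show "inv_into X g (inv_into X f x) \<in> X" if "x \<in> X" for x by (rule inv(2)[OF inv(1)[OF that]])
  show "f (g x) \<in> X" if "x \<in> X" for x by (rule automorphism_in[OF f automorphism_in[OF g that]])
  show "inv_into X g (inv_into X f (f (g x))) = x" if "x \<in> X" for x
    using that bf bg automorphism_in[OF g that] by (simp add: bij_betw_inv_into_left)
  show "f (g (inv_into X g (inv_into X f x))) = x" if "x \<in> X" for x
    using that bf bg inv by (simp add: bij_betw_inv_into_right)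
  have pf: "poly_map coords X f" "poly_map coords X (inv_into X f)"
    and pg: "poly_map coords X g" "poly_map coords X (inv_into X g)"
    using f g by (auto simp: automorphism_def)
  show "poly_map coords X (\<lambda>x. f (g x))"
    by (rule poly_map_comp[OF pf(1) pg(1) automorphism_in[OF g] refl])
  show "poly_map coords X (\<lambda>x. inv_into X g (inv_into X f x))"
    by (rule poly_map_comp[OF pg(2) pf(2) inv(1) refl])
qed

lemma algebraic_family_comp:
  assumes A: "variety B \<A>" and C: "variety C \<B>"
    and f: "algebraic_family B \<A> X f" and g: "algebraic_family C \<B> X g"
  shows "algebraic_family (join_set B C) (join_atlas \<A> \<B>) X (\<lambda>w x. f (left w) (g (right w) x))"
  unfolding algebraic_family_def
proof (intro conjI ballI, goal_cases)
  case (1 w)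
  then have "automorphism X (f (left w))" "automorphism X (g (right w))"
    using f g by (auto simp: algebraic_family_def join_set_def)
  then show ?case by (rule automorphism_comp)
next
  case (2 z)
  then obtain U \<phi> V \<psi> where *: "(U, \<phi>) \<in> \<A>" "(V, \<psi>) \<in> \<B>" and z: "z = (join_set U V, join_map \<phi> \<psi>)"
    by (metis join_atlas_iff surj_pair)
  have UB: "U \<subseteq> B" "V \<subseteq> C" using * varietyD(2)[OF A] varietyD(2)[OF C] by blast+
  have pf: "poly_map coords2 (\<phi> ` U \<times> X) (\<lambda>(v, x). f (inv_into U \<phi> v) x)"
    and pg: "poly_map coords2 (\<psi> ` V \<times> X) (\<lambda>(v, x). g (inv_into V \<psi> v) x)"
    using f g * unfolding algebraic_family_def by fast+
  let ?D = "join_set (\<phi> ` U) (\<psi> ` V) \<times> X"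
  \<comment> \<open>The polynomials for \<open>f\<close> represent it only at points of
    \<open>X\<close>, so the inner values must be known to lie there before they are
    substituted.\<close>
  have gX: "g (inv_into V \<psi> (right w)) x \<in> X" if "(w, x) \<in> ?D" for w x
  proof -
    have "inv_into V \<psi> (right w) \<in> C" using that UB(2) inv_into_into[of "right w" \<psi> V] by (auto simp: join_set_def)
    then show ?thesis using that g by (auto simp: algebraic_family_def intro: automorphism_in)
  qed
  have "\<exists>p\<in>gen_algebra coords2. \<forall>y\<in>?D.
      f (inv_into U \<phi> (left (fst y))) (g (inv_into V \<psi> (right (fst y))) (snd y)) j = p y" for j
  proof -
    obtain p where p: "p \<in> gen_algebra coords2" "\<forall>y\<in>\<phi> ` U \<times> X. f (inv_into U \<phi> (fst y)) (snd y) j = p y"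
      using pf unfolding poly_map_def case_prod_unfold by blast
    have "\<exists>h\<in>gen_algebra coords2. \<forall>y\<in>?D. p (left (fst y), g (inv_into V \<psi> (right (fst y))) (snd y)) = h y"
    proof (rule coords2_subst[OF p(1)])
      show "\<exists>h\<in>gen_algebra coords2. \<forall>y\<in>?D. left (fst y) i = h y" for i
        by (rule bexI[OF _ coord2_gen(1)[of "2 * i"]]) (simp add: left_def)
      fix i
      obtain q where q: "q \<in> gen_algebra coords2" "\<forall>y\<in>\<psi> ` V \<times> X. g (inv_into V \<psi> (fst y)) (snd y) i = q y"
        using pg unfolding poly_map_def case_prod_unfold by blast
      have "(\<lambda>y. q (right (fst y), snd y)) \<in> gen_algebra coords2"
        by (rule coords2_subst'[OF q(1)]) (auto simp: right_def intro: coord2_gen)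
      moreover have "\<forall>y\<in>?D. g (inv_into V \<psi> (right (fst y))) (snd y) i = q (right (fst y), snd y)"
        using q(2) by (force simp: join_set_def)
      ultimately show "\<exists>h\<in>gen_algebra coords2. \<forall>y\<in>?D. g (inv_into V \<psi> (right (fst y))) (snd y) i = h y"
        by (intro bexI[where x = "\<lambda>y. q (right (fst y), snd y)"])
    qed
    moreover have "\<forall>y\<in>?D. f (inv_into U \<phi> (left (fst y))) (g (inv_into V \<psi> (right (fst y))) (snd y)) j
        = p (left (fst y), g (inv_into V \<psi> (right (fst y))) (snd y))"
      using p(2) gX by (force simp: join_set_def)
    ultimately show ?thesis by auto
  qed
  moreover have "inv_into (join_set U V) (join_map \<phi> \<psi>) v = join (inv_into U \<phi> (left v)) (inv_into V \<psi> (right v))"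
    if "v \<in> join_set (\<phi> ` U) (\<psi> ` V)" for v
    using inv_into_join_map[OF varietyD(3)[OF A *(1)] varietyD(3)[OF C *(2)] that] .
  ultimately show ?case
    unfolding z prod.case join_map_image poly_map_def by (auto simp: case_prod_unfold)
qed

section \<open>Members of irreducible families\<close>

definition in_irreducible_family ::
  "(nat \<Rightarrow> 'k::field) set \<Rightarrow> (nat \<Rightarrow> 'k) set \<Rightarrow> ((nat \<Rightarrow> 'k) set \<times> ((nat \<Rightarrow> 'k) \<Rightarrow> nat \<Rightarrow> 'k)) set \<Rightarrow>
    ((nat \<Rightarrow> 'k) \<Rightarrow> (nat \<Rightarrow> 'k) \<Rightarrow> nat \<Rightarrow> 'k) \<Rightarrow> bool" where
  "in_irreducible_family X B \<A> f \<longleftrightarrow> variety B \<A> \<and> irreducible_space (variety_topology B \<A>) \<and>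
     algebraic_family B \<A> X f \<and> (\<exists>b\<in>B. \<forall>x\<in>X. f b x = x)"

lemma Aut0_iff:
  "\<phi> \<in> Aut0 X \<longleftrightarrow> automorphism X \<phi> \<and>
     (\<exists>B \<A> f. in_irreducible_family X B \<A> f \<and> (\<exists>b\<in>B. \<forall>x\<in>X. f b x = \<phi> x))"
  unfolding Aut0_def in_irreducible_family_def by blast

lemma Aut0E:
  assumes "\<phi> \<in> Aut0 X"
  obtains B \<A> f where "in_irreducible_family X B \<A> f" "\<exists>b\<in>B. \<forall>x\<in>X. f b x = \<phi> x"
proof -
  from assms have "\<exists>B \<A> f. in_irreducible_family X B \<A> f \<and> (\<exists>b\<in>B. \<forall>x\<in>X. f b x = \<phi> x)"
    by (simp add: Aut0_iff)
  then show ?thesis by (elim exE conjE) (rule that)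
qed

lemma Aut0_memberI:
  assumes "in_irreducible_family X B \<A> f" "b \<in> B"
  shows "f b \<in> Aut0 X"
  using assms unfolding Aut0_iff by (auto simp: in_irreducible_family_def algebraic_family_def)

lemma Aut0_automorphism: "\<phi> \<in> Aut0 X \<Longrightarrow> automorphism X \<phi>"
  by (simp add: Aut0_iff)

text \<open>Over the product of the two bases the composites form one irreducible family. Setting
  one parameter to its identity point recovers the other family. The composite is used for closure
  under composition, the two separate members for directedness of supports.\<close>

lemma Aut0_common_family:
  fixes X :: "(nat \<Rightarrow> 'k::field) set"
  assumes "\<phi> \<in> Aut0 X" "\<psi> \<in> Aut0 X"
  obtains B \<A> f where "in_irreducible_family X B \<A> f"
    "\<exists>b\<in>B. \<forall>x\<in>X. f b x = \<phi> x" "\<exists>b\<in>B. \<forall>x\<in>X. f b x = \<psi> x" "\<exists>b\<in>B. \<forall>x\<in>X. f b x = \<phi> (\<psi> x)"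
proof -
  obtain B \<A> f where "in_irreducible_family X B \<A> f" and f1: "\<exists>b\<in>B. \<forall>x\<in>X. f b x = \<phi> x"
    using assms(1) by (rule Aut0E)
  then have B: "variety B \<A>" "irreducible_space (variety_topology B \<A>)" "algebraic_family B \<A> X f"
    and f0: "\<exists>b\<in>B. \<forall>x\<in>X. f b x = x" by (simp_all add: in_irreducible_family_def)
  from f0 obtain b0 where b0: "b0 \<in> B" "\<forall>x\<in>X. f b0 x = x" by (rule bexE)
  from f1 obtain b1 where b1: "b1 \<in> B" "\<forall>x\<in>X. f b1 x = \<phi> x" by (rule bexE)
  obtain C \<B> g where "in_irreducible_family X C \<B> g" and g1: "\<exists>b\<in>C. \<forall>x\<in>X. g b x = \<psi> x"
    using assms(2) by (rule Aut0E)
  then have C: "variety C \<B>" "irreducible_space (variety_topology C \<B>)" "algebraic_family C \<B> X g"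
    and g0: "\<exists>b\<in>C. \<forall>x\<in>X. g b x = x" by (simp_all add: in_irreducible_family_def)
  from g0 obtain c0 where c0: "c0 \<in> C" "\<forall>x\<in>X. g c0 x = x" by (rule bexE)
  from g1 obtain c1 where c1: "c1 \<in> C" "\<forall>x\<in>X. g c1 x = \<psi> x" by (rule bexE)
  let ?h = "\<lambda>w x. f (left w) (g (right w) x)"
  have \<psi>X: "\<psi> x \<in> X" if "x \<in> X" for x
    using automorphism_in[OF Aut0_automorphism[OF assms(2)] that] .
  let ?D = "join_set B C"
  have "\<exists>b\<in>?D. \<forall>x\<in>X. ?h b x = x"
    using b0 c0 by (intro bexI[of _ "join b0 c0"]) auto
  then have "in_irreducible_family X ?D (join_atlas \<A> \<B>) ?h"
    unfolding in_irreducible_family_def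
    using variety_join[OF B(1) C(1)] irreducible_variety_join[OF B(1,2) C(1,2)]
      algebraic_family_comp[OF B(1) C(1) B(3) C(3)] by (intro conjI)
  moreover have "\<exists>b\<in>?D. \<forall>x\<in>X. ?h b x = \<phi> x"
    using b1 c0 by (intro bexI[of _ "join b1 c0"]) auto
  moreover have "\<exists>b\<in>?D. \<forall>x\<in>X. ?h b x = \<psi> x"
    using b0 c1 \<psi>X by (intro bexI[of _ "join b0 c1"]) auto
  moreover have "\<exists>b\<in>?D. \<forall>x\<in>X. ?h b x = \<phi> (\<psi> x)"
    using b1 c1 \<psi>X by (intro bexI[of _ "join b1 c1"]) auto
  ultimately show ?thesis by (rule that)
qed

lemma Aut0_comp:
  assumes "\<phi> \<in> Aut0 X" "\<psi> \<in> Aut0 X"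
  shows "(\<lambda>x. \<phi> (\<psi> x)) \<in> Aut0 X"
proof -
  have "automorphism X (\<lambda>x. \<phi> (\<psi> x))"
    by (rule automorphism_comp[OF assms[THEN Aut0_automorphism]])
  then show ?thesis using Aut0_common_family[OF assms] unfolding Aut0_iff by metis
qed

text \<open>With z frozen, the value of p at the moved point is a polynomial in the coordinates of
  each chart of the base.\<close>

lemma openin_family_nonzero:
  assumes B: "variety B \<A>" "algebraic_family B \<A> X f" and p: "p \<in> gen_algebra coords" and z: "z \<in> X"
  shows "openin (variety_topology B \<A>) {b \<in> B. p (f b z) \<noteq> 0}"
  unfolding openin_variety_topology
proof (intro conjI ballI, blast, clarify)
  fix U \<phi> assume U: "(U, \<phi>) \<in> \<A>"
  then have UB: "U \<subseteq> B" and inj: "inj_on \<phi> U" using varietyD(2,3)[OF B(1)] by blast+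
  have pf: "poly_map coords2 (\<phi> ` U \<times> X) (\<lambda>(v, x). f (inv_into U \<phi> v) x)"
    using B(2) U unfolding algebraic_family_def by fast
  have "\<exists>q\<in>gen_algebra coords. \<forall>v\<in>\<phi> ` U. p (f (inv_into U \<phi> v) z) = q v"
  proof (rule coords_subst[OF p])
    fix i
    obtain q where q: "q \<in> gen_algebra coords2" "\<forall>y\<in>\<phi> ` U \<times> X. f (inv_into U \<phi> (fst y)) (snd y) i = q y"
      using pf unfolding poly_map_def case_prod_unfold by blast
    have "(\<lambda>v. q (v, z)) \<in> gen_algebra coords"
      by (rule coords2_subst'[OF q(1)]) (auto intro: coord_gen gen_algebra.const)
    then show "\<exists>h\<in>gen_algebra coords. \<forall>v\<in>\<phi> ` U. f (inv_into U \<phi> v) z i = h v"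
      using q(2) z by (intro bexI[of _ "\<lambda>v. q (v, z)"]) auto
  qed
  then obtain q where q: "q \<in> gen_algebra coords" "\<forall>v\<in>\<phi> ` U. p (f (inv_into U \<phi> v) z) = q v" by (rule bexE)
  have "{b \<in> B. p (f b z) \<noteq> 0} \<inter> U = \<phi> -` {v. q v \<noteq> 0} \<inter> U"
    using q(2) UB inj by auto
  then show "openin (pullback_topology U \<phi> (zariski coords)) ({b \<in> B. p (f b z) \<noteq> 0} \<inter> U)"
    unfolding openin_pullback_topology using openin_zariski_nonzero[OF q(1)] by blast
qed

text \<open>An affine base is a variety with the identity as its only chart, and its variety
  topology is the Zariski topology. This is the entrance for the concrete families over the line and
  the hyperbola.\<close>

lemma Aut0_affine_family:
  fixes X V :: "(nat \<Rightarrow> 'k::field) set"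
  assumes V: "affine_variety V" "irreducible_space (zariski_on V)"
    and F: "\<And>v. v \<in> V \<Longrightarrow> automorphism X (F v)" "poly_map coords2 (V \<times> X) (\<lambda>(v, x). F v x)"
    and v0: "v\<^sub>0 \<in> V" "\<And>x. x \<in> X \<Longrightarrow> F v\<^sub>0 x = x" and v: "v \<in> V"
  shows "F v \<in> Aut0 X"
proof (rule Aut0_memberI[OF _ v])
  let ?A = "{(V, id)}"
  have inv: "inv_into V id v = v" if "v \<in> V" for v
    using that by (intro inv_into_f_eq) auto
  have closedV: "closedin (zariski coords) V" using V(1) by (simp add: affine_variety_def)
  have "variety V ?A"
  proof -
    have "openin (zariski_on V) V"
      by (metis openin_topspace topspace_subtopology topspace_zariski Int_UNIV_left)
    moreover have "regular_map_on V (\<lambda>v. inv_into V id v)"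
      unfolding regular_map_on_def
    proof (intro allI ballI)
      fix j w assume "w \<in> V"
      then show "\<exists>Q p q. openin (zariski_on V) Q \<and> w \<in> Q \<and> p \<in> gen_algebra coords \<and>
          q \<in> gen_algebra coords \<and> (\<forall>v\<in>Q. q v \<noteq> 0 \<and> inv_into V id v j = p v / q v)"
        using \<open>openin (zariski_on V) V\<close> inv
        by (intro exI[of _ V] exI[of _ "\<lambda>v. v j"] exI[of _ "\<lambda>_. 1"])
          (auto intro: coord_gen gen_algebra.const)
    qed
    moreover have "closedin (zariski coords2) ((\<lambda>b. (b, b)) ` V)"
    proof -
      have eq: "(\<lambda>b. (b, b)) ` V = {z. fst z \<in> V} \<inter> (\<Inter>i. {z. fst z i - snd z i = 0})"
        by (auto simp: fun_eq_iff prod_eq_iff image_iff intro: bexI)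
      have "continuous_map (zariski coords2) (zariski coords) fst"
        by (rule continuous_map_zariski_coords) (rule coord2_gen)
      then have "closedin (zariski coords2) {z. fst z \<in> V}"
        using closedV by (rule closedin_zariski_vimage)
      moreover have "closedin (zariski coords2) (\<Inter>i. {z :: (nat \<Rightarrow> 'k) \<times> (nat \<Rightarrow> 'k). fst z i - snd z i = 0})"
      proof (rule closedin_Inter)
        fix S :: "((nat \<Rightarrow> 'k) \<times> (nat \<Rightarrow> 'k)) set" assume "S \<in> range (\<lambda>i. {z. fst z i - snd z i = 0})"
        then obtain i where "S = {z. fst z i - snd z i = 0}" by blast
        then show "closedin (zariski coords2) S"
          using closedin_zariski_zero[OF gen_algebra_diff[OF coord2_gen(1)[of i] coord2_gen(2)[of i]]] by simp
      qed simp
      ultimately show ?thesis unfolding eq by (rule closedin_Int)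
    qed
    ultimately show ?thesis using V(1) by (simp add: variety_def id_def)
  qed
  moreover have "variety_topology V ?A = zariski_on V"
    unfolding topology_eq
  proof
    fix W
    have "openin (variety_topology V ?A) W \<longleftrightarrow> W \<subseteq> V \<and> (\<exists>T. openin (zariski coords) T \<and> W \<inter> V = T \<inter> V)"
      by (simp add: openin_variety_topology openin_pullback_topology)
    also have "\<dots> \<longleftrightarrow> openin (zariski_on V) W" unfolding openin_subtopology by blast
    finally show "openin (variety_topology V ?A) W = openin (zariski_on V) W" .
  qed
  moreover have "algebraic_family V ?A X F"
    unfolding algebraic_family_def
  proof (intro conjI ballI F(1))
    have "poly_map coords2 (V \<times> X) (\<lambda>(v, x). F (inv_into V id v) x)"
      using F(2) inv unfolding poly_map_def by (auto simp: case_prod_unfold)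
    then show "case y of (U, \<phi>) \<Rightarrow> poly_map coords2 (\<phi> ` U \<times> X) (\<lambda>(v, x). F (inv_into U \<phi> v) x)"
      if "y \<in> ?A" for y using that by simp
  qed
  ultimately show "in_irreducible_family X V ?A F"
    using V(2) v0 by (auto simp: in_irreducible_family_def)
qed


section \<open>Weight decomposition of the coordinate ring\<close>

text \<open>Linear span of W among functions restricted to D: membership depends only on the values
  on D, because polynomials stand for regular functions. Adding one term at a time makes the span
  accessible to induction.\<close>

inductive_set lin_span :: "('a \<Rightarrow> 'k::field) set \<Rightarrow> 'a set \<Rightarrow> ('a \<Rightarrow> 'k) set" for W D where
  zero: "(\<And>x. x \<in> D \<Longrightarrow> f x = 0) \<Longrightarrow> f \<in> lin_span W D"
| step: "h \<in> lin_span W D \<Longrightarrow> w \<in> W \<Longrightarrow> (\<And>x. x \<in> D \<Longrightarrow> f x = c * w x + h x) \<Longrightarrow> f \<in> lin_span W D"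

lemma lin_span_cong:
  assumes "f \<in> lin_span W D" "\<And>x. x \<in> D \<Longrightarrow> g x = f x"
  shows "g \<in> lin_span W D"
  using assms(1)
proof cases
  case zero
  show ?thesis by (rule lin_span.zero) (simp add: assms(2) zero)
next
  case (step h w c)
  show ?thesis by (rule lin_span.step[OF step(1,2), where c = c]) (simp add: assms(2) step(3))
qed

lemma lin_span_scale: "w \<in> W \<Longrightarrow> (\<lambda>x. c * w x) \<in> lin_span W D"
  by (rule lin_span.step[OF lin_span.zero[of D "\<lambda>_. 0"], of w _ _ c]) auto

lemma lin_span_gen: "w \<in> W \<Longrightarrow> w \<in> lin_span W D"
  using lin_span_scale[of w W 1] by simp

lemma lin_span_add:
  assumes "f \<in> lin_span W D" "g \<in> lin_span W D"
  shows "(\<lambda>x. f x + g x) \<in> lin_span W D"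
  using assms(1)
proof induction
  case (zero f)
  show ?case using assms(2) by (rule lin_span_cong) (simp add: zero)
next
  case (step h w f c)
  show ?case by (rule lin_span.step[OF step.IH step.hyps(2), where c = c]) (simp add: step.hyps(3) add.assoc)
qed

lemma lin_span_sum:
  assumes "\<And>i. i \<in> I \<Longrightarrow> f i \<in> lin_span W D"
  shows "(\<lambda>x. \<Sum>i\<in>I. f i x) \<in> lin_span W D"
  using assms by (induction I rule: infinite_finite_induct) (simp_all add: lin_span.zero lin_span_add)

lemma lin_span_mult_const:
  assumes "f \<in> lin_span W D"
  shows "(\<lambda>x. a * f x) \<in> lin_span W D"
  using assms
proof induction
  case (zero f)
  show ?case by (rule lin_span.zero) (simp add: zero)
next
  case (step h w f c)
  show ?case by (rule lin_span.step[OF step.IH step.hyps(2), where c = "a * c"])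
    (simp add: step.hyps(3) algebra_simps)
qed

lemma lin_span_mult:
  assumes W: "\<And>v w. v \<in> W \<Longrightarrow> w \<in> W \<Longrightarrow> (\<lambda>x. v x * w x) \<in> lin_span W D"
    and f: "f \<in> lin_span W D" and g: "g \<in> lin_span W D"
  shows "(\<lambda>x. f x * g x) \<in> lin_span W D"
proof -
  have *: "(\<lambda>x. v x * g x) \<in> lin_span W D" if v: "v \<in> W" for v
    using g
  proof induction
    case (zero f)
    show ?case by (rule lin_span.zero) (simp add: zero)
  next
    case (step h w f c)
    have "(\<lambda>x. c * (v x * w x)) \<in> lin_span W D" by (rule lin_span_mult_const[OF W[OF v step.hyps(2)]])
    from lin_span_add[OF this step.IH] show ?case
      by (rule lin_span_cong) (simp add: step.hyps algebra_simps)
  qed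
  from f show ?thesis
  proof induction
    case (zero f)
    show ?case by (rule lin_span.zero) (simp add: zero)
  next
    case (step h w f c)
    from lin_span_add[OF lin_span_mult_const[OF *[OF step.hyps(2)], of c] step.IH] show ?case
      by (rule lin_span_cong) (simp add: step.hyps algebra_simps)
  qed
qed

text \<open>If products of members of W lie in the span, the span is closed under multiplication, so
  it contains the whole algebra once it contains 1 and the generators. This is applied to functions
  on the torus times X, to characters on X, and to evaluations at monoid homomorphisms.\<close>

lemma gen_algebra_lin_span:
  assumes W: "\<And>v w. v \<in> W \<Longrightarrow> w \<in> W \<Longrightarrow> (\<lambda>x. v x * w x) \<in> lin_span W D"
    and one: "(\<lambda>_. 1) \<in> lin_span W D" and G: "\<And>g. g \<in> G \<Longrightarrow> g \<in> lin_span W D"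
    and f: "f \<in> gen_algebra G"
  shows "f \<in> lin_span W D"
  using f
proof induction
  case (const c)
  show ?case using lin_span_mult_const[OF one, of c] by simp
next
  case (gen g)
  then show ?case by (rule G)
next
  case (add p q)
  then show ?case using lin_span_add[of p W D q] by (simp add: plus_fun_def)
next
  case (mult p q)
  have "(\<lambda>x. p x * q x) \<in> lin_span W D" by (rule lin_span_mult[OF W mult.IH])
  then show ?case by (simp add: times_fun_def)
qed

lemma lin_span_image:
  assumes "f \<in> lin_span (w ` I) D"
  shows "\<exists>F c. finite F \<and> F \<subseteq> I \<and> (\<forall>x\<in>D. f x = (\<Sum>i\<in>F. c i * w i x))"
  using assms
proof induction
  case (zero f)
  then show ?case by (intro exI[of _ "{}"]) auto
next
  case (step h v f a)
  then obtain F c i where F: "finite F" "F \<subseteq> I" "\<forall>x\<in>D. h x = (\<Sum>i\<in>F. c i * w i x)" and i: "i \<in> I" "v = w i"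
    by blast
  \<comment> \<open>The index \<open>i\<close> may already occur in \<open>F\<close>; then the new
    coefficient is added to the old one.\<close>
  define c' where "c' = c(i := a + (if i \<in> F then c i else 0))"
  have "f x = (\<Sum>j\<in>insert i F. c' j * w j x)" if x: "x \<in> D" for x
  proof -
    have "(\<Sum>j\<in>insert i F. c' j * w j x) = c' i * w i x + (\<Sum>j\<in>F - {i}. c' j * w j x)"
      by (rule sum.insert_remove[OF F(1)])
    also have "(\<Sum>j\<in>F - {i}. c' j * w j x) = (\<Sum>j\<in>F - {i}. c j * w j x)"
      by (intro sum.cong) (auto simp: c'_def)
    also have "(\<Sum>j\<in>F. c j * w j x) = (if i \<in> F then c i * w i x else 0) + (\<Sum>j\<in>F - {i}. c j * w j x)"
      using F(1) by (auto simp: sum.remove)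
    then have "c' i * w i x + (\<Sum>j\<in>F - {i}. c j * w j x) = a * w i x + (\<Sum>j\<in>F. c j * w j x)"
      by (auto simp: c'_def algebra_simps)
    finally show ?thesis using step.hyps(3)[OF x] F(3) x i(2) by simp
  qed
  then show ?case using F(1,2) i(1)
    by (intro exI[of _ "insert i F"] exI[of _ c']) auto
qed

section \<open>The torus and its characters\<close>

lemma torus_1: "1 \<in> torus d"
  by (simp add: torus_def)

lemma torus_mult: "s \<in> torus d \<Longrightarrow> t \<in> torus d \<Longrightarrow> s * t \<in> torus d"
  by (simp add: torus_def)

lemma torus_inverse: "t \<in> torus d \<Longrightarrow> (\<lambda>i. inverse (t i)) \<in> torus d"
  by (simp add: torus_def)

lemma torus_nonzero: "t \<in> torus d \<Longrightarrow> t i \<noteq> 0"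
  by (cases "i < d") (auto simp: torus_def)

lemma torus_mult_inverse: "t \<in> torus d \<Longrightarrow> t * (\<lambda>i. inverse (t i)) = 1"
  using torus_nonzero by (fastforce simp: fun_eq_iff)

lemma character_1 [simp]: "character d m 1 = 1"
  by (simp add: character_def)

lemma character_0 [simp]: "character d 0 t = 1"
  by (simp add: character_def)

lemma character_mult: "character d m (s * t) = character d m s * character d m t"
  by (simp add: character_def power_int_mult_distrib prod.distrib)

lemma character_add: "t \<in> torus d \<Longrightarrow> character d (m + m') t = character d m t * character d m' t"
  unfolding character_def prod.distrib[symmetric]
  by (intro prod.cong refl) (simp add: power_int_add torus_nonzero)

lemma char_lattice_add: "m \<in> char_lattice d \<Longrightarrow> m' \<in> char_lattice d \<Longrightarrow> m + m' \<in> char_lattice d"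
  and char_lattice_0: "0 \<in> char_lattice d"
  by (simp_all add: char_lattice_def)

text \<open>In characteristic zero the element 2 has infinite multiplicative order. This provides
  torus points that separate characters.\<close>

lemma two_powi_inj:
  assumes "(2 :: 'k::field_char_0) powi a = 2 powi b"
  shows "a = b"
proof -
  have *: "b \<le> a" if "(2 :: 'k) powi a = 2 powi b" for a b
  proof (rule ccontr)
    assume "\<not> b \<le> a"
    then have "(2 :: 'k) powi (b - a) = 1"
      using that by (simp add: power_int_diff)
    moreover obtain n where n: "b - a = int (Suc n)"
      using \<open>\<not> b \<le> a\<close> by (metis not_le zero_less_diff zero_less_imp_eq_int gr0_implies_Suc diff_gt_0_iff_gt)
    ultimately have "(2 :: 'k) ^ Suc n = 1" by (metis power_int_of_nat)
    then have "of_nat (2 ^ Suc n) = (of_nat 1 :: 'k)" by simp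
    then have "(2::nat) ^ Suc n = 1" by (simp only: of_nat_eq_iff)
    then show False by simp
  qed
  show ?thesis using *[OF assms] *[OF assms[symmetric]] by simp
qed

lemma character_separate:
  assumes "m \<in> char_lattice d" "m' \<in> char_lattice d" "m \<noteq> m'"
  obtains t :: "nat \<Rightarrow> 'k::field_char_0" where "t \<in> torus d" "character d m t \<noteq> character d m' t"
proof -
  obtain i where i: "m i \<noteq> m' i" using assms(3) by auto
  then have "i < d" using assms(1,2) by (cases "i < d") (auto simp: char_lattice_def)
  define t where "t = (\<lambda>j. if j = i then 2 else 1 :: 'k)"
  have val: "character d n t = 2 powi n i" for n
  proof -
    have "character d n t = (\<Prod>j<d. if j = i then 2 powi n i else 1)"
      unfolding character_def t_def by (intro prod.cong) auto
    then show ?thesis using \<open>i < d\<close> by simp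
  qed
  have "t \<in> torus d" using \<open>i < d\<close> by (auto simp: torus_def t_def)
  moreover have "character d m t \<noteq> character d m' t" using two_powi_inj i unfolding val by blast
  ultimately show ?thesis by (rule that)
qed

text \<open>Dedekind's argument: translating the relation by a point s and subtracting
  \<open>character d a s\<close> times the relation removes the term of a. The factor left at
  another m is nonzero once s separates m from a.\<close>

lemma characters_independent:
  fixes c :: "(nat \<Rightarrow> int) \<Rightarrow> 'k::field_char_0"
  assumes "finite F" "F \<subseteq> char_lattice d"
    and "\<And>t. t \<in> torus d \<Longrightarrow> (\<Sum>m\<in>F. c m * character d m t) = 0"
  shows "\<forall>m\<in>F. c m = 0"
  using assms
proof (induction F arbitrary: c rule: finite_induct)
  case empty then show ?case by simp
next
  case (insert a F)
  have sum0: "c a * character d a t + (\<Sum>m\<in>F. c m * character d m t) = 0" if "t \<in> torus d" for t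
    using insert.prems(2)[OF that] insert.hyps by simp
  have F0: "c m = 0" if m: "m \<in> F" for m
  proof -
    have "m \<noteq> a" using m insert.hyps by blast
    then obtain s :: "nat \<Rightarrow> 'k" where s: "s \<in> torus d" "character d m s \<noteq> character d a s"
      using character_separate[of m d a] insert.prems(1) m by blast
    have "(\<Sum>m\<in>F. (c m * (character d m s - character d a s)) * character d m t) = 0" if t: "t \<in> torus d" for t
    proof -
      have "(\<Sum>m\<in>F. (c m * (character d m s - character d a s)) * character d m t)
          = (\<Sum>m\<in>F. c m * character d m (s * t)) - character d a s * (\<Sum>m\<in>F. c m * character d m t)"
        by (simp add: character_mult sum_subtractf sum_distrib_left algebra_simps)
      also have "(\<Sum>m\<in>F. c m * character d m (s * t)) = - (c a * character d a (s * t))"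
        using sum0[OF torus_mult[OF s(1) t]] by (simp add: eq_neg_iff_add_eq_0 add.commute)
      also have "(\<Sum>m\<in>F. c m * character d m t) = - (c a * character d a t)"
        using sum0[OF t] by (simp add: eq_neg_iff_add_eq_0 add.commute)
      finally show ?thesis unfolding character_mult by (simp add: algebra_simps)
    qed
    then have "\<forall>m\<in>F. c m * (character d m s - character d a s) = 0"
      using insert.prems(1) by (intro insert.IH) auto
    then show ?thesis using s(2) m by auto
  qed
  moreover have "c a = 0" using sum0[OF torus_1] F0 by simp
  ultimately show ?case by blast
qed

text \<open>The coordinates of the torus and their inverses are characters on it (those from index d
  on are constantly 1), and a product of characters is a character. So every function is a sum of
  characters times polynomials in x.\<close>

lemma torus_coords_lin_span:
  assumes "f \<in> gen_algebra torus_coords"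
  shows "f \<in> lin_span ((\<lambda>(m, q) (t, x). character d m t * q x) ` (char_lattice d \<times> gen_algebra coords))
     (torus d \<times> UNIV)" (is "f \<in> lin_span (?w ` ?I) ?D")
proof (rule gen_algebra_lin_span[OF _ _ _ assms])
  have mem: "(\<lambda>(t, x). character d m t * q x) \<in> lin_span (?w ` ?I) ?D"
    if "m \<in> char_lattice d" "q \<in> gen_algebra coords" for m q
    by (rule lin_span_gen) (use that in \<open>auto intro!: image_eqI[of _ _ "(m, q)"]\<close>)
  show "(\<lambda>x. v x * w x) \<in> lin_span (?w ` ?I) ?D" if "v \<in> ?w ` ?I" "w \<in> ?w ` ?I" for v w
  proof -
    from that(1) obtain a where a: "v = ?w a" "a \<in> ?I" by (rule imageE)
    from that(2) obtain b where b: "w = ?w b" "b \<in> ?I" by (rule imageE)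
    have "fst a + fst b \<in> char_lattice d" "(\<lambda>x. snd a x * snd b x) \<in> gen_algebra coords"
      using a(2) b(2) by (auto intro: char_lattice_add gen_algebra_mult)
    from mem[OF this] show ?thesis
      by (rule lin_span_cong) (auto simp: a(1) b(1) case_prod_unfold character_add algebra_simps)
  qed
  show one: "(\<lambda>_. 1) \<in> lin_span (?w ` ?I) ?D"
    using mem[OF char_lattice_0 gen_algebra.const[of 1]] by (rule lin_span_cong) auto
  have unit: "character d (\<lambda>j. if j = i then k else 0) t = t i powi k" if "i < d" for i k and t :: "nat \<Rightarrow> 'a"
  proof -
    have "character d (\<lambda>j. if j = i then k else 0) t = (\<Prod>j<d. if j = i then t i powi k else 1)"
      unfolding character_def by (intro prod.cong) auto
    then show ?thesis using that by simp
  qed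
  have coord: "(\<lambda>(t, x). t i powi k) \<in> lin_span (?w ` ?I) ?D" for i k
  proof (cases "i < d")
    case True
    then have "(\<lambda>j. if j = i then k else 0) \<in> char_lattice d" by (auto simp: char_lattice_def)
    from mem[OF this gen_algebra.const[of 1]] show ?thesis
      by (rule lin_span_cong) (auto simp: unit[OF True])
  next
    case False
    show ?thesis using one by (rule lin_span_cong) (use False in \<open>auto simp: torus_def\<close>)
  qed
  fix g assume "g \<in> (torus_coords :: ((nat \<Rightarrow> 'a) \<times> (nat \<Rightarrow> 'a) \<Rightarrow> 'a) set)"
  then consider i where "g = (\<lambda>(t, x). t i)" | i where "g = (\<lambda>(t, x). inverse (t i))" | i where "g = (\<lambda>(t, x). x i)"
    unfolding torus_coords_def by blast
  then show "g \<in> lin_span (?w ` ?I) ?D"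
  proof cases
    case (1 i) then show ?thesis using coord[of i 1] by simp
  next
    case (2 i) then show ?thesis using coord[of i "-1"] by (simp add: power_int_minus)
  next
    case (3 i)
    show ?thesis using mem[OF char_lattice_0 coord_gen[of i]] unfolding 3 by (rule lin_span_cong) auto
  qed
qed

section \<open>Weight spaces of an affine toric variety\<close>

locale toric =
  fixes d :: nat and X :: "(nat \<Rightarrow> 'k::field_char_0) set"
    and act :: "(nat \<Rightarrow> 'k) \<Rightarrow> (nat \<Rightarrow> 'k) \<Rightarrow> nat \<Rightarrow> 'k" and x\<^sub>0 :: "nat \<Rightarrow> 'k"
  assumes affine_variety: "affine_variety X" and irreducible: "irreducible_space (zariski_on X)"
    and action: "torus_action d X act"
    and x0: "x\<^sub>0 \<in> X" and open_orbit: "openin (zariski_on X) (torus_orbit d act x\<^sub>0)"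
begin

definition P :: "(nat \<Rightarrow> int) set" where
  "P = weight_monoid d X act"

lemma act_in: "t \<in> torus d \<Longrightarrow> x \<in> X \<Longrightarrow> act t x \<in> X"
  and act_1: "x \<in> X \<Longrightarrow> act 1 x = x"
  and act_mult: "s \<in> torus d \<Longrightarrow> t \<in> torus d \<Longrightarrow> x \<in> X \<Longrightarrow> act (s * t) x = act s (act t x)"
  and act_poly: "poly_map torus_coords (torus d \<times> X) (\<lambda>(t, x). act t x)"
  using action by (auto simp: torus_action_def)

lemma weight_spaceD:
  "f \<in> weight_space d X act m \<Longrightarrow> f \<in> gen_algebra coords"
  "f \<in> weight_space d X act m \<Longrightarrow> t \<in> torus d \<Longrightarrow> x \<in> X \<Longrightarrow> f (act t x) = character d m t * f x"
  by (auto simp: weight_space_def)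

lemma orbit_dense:
  assumes f: "f \<in> gen_algebra coords" and zero: "\<And>t. t \<in> torus d \<Longrightarrow> f (act t x\<^sub>0) = 0" and x: "x \<in> X"
  shows "f x = 0"
proof (rule ccontr)
  assume "f x \<noteq> 0"
  have "openin (zariski_on X) ({x. f x \<noteq> 0} \<inter> X)"
    unfolding openin_subtopology using openin_zariski_nonzero[OF f] by blast
  moreover have "act 1 x\<^sub>0 \<in> torus_orbit d act x\<^sub>0" unfolding torus_orbit_def using torus_1 by blast
  ultimately have "({x. f x \<noteq> 0} \<inter> X) \<inter> torus_orbit d act x\<^sub>0 \<noteq> {}"
    using \<open>f x \<noteq> 0\<close> x by (intro irreducible_spaceD[OF irreducible _ open_orbit]) auto
  then show False using zero by (auto simp: torus_orbit_def)
qed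

text \<open>Along the open orbit a weight vector is a character times its value at the base point,
  and the open orbit is dense. Consequently a weight space is at most one-dimensional as a space of
  functions on X.\<close>

lemma weight_space_zero:
  assumes "f \<in> weight_space d X act m" "f x\<^sub>0 = 0" "x \<in> X"
  shows "f x = 0"
  using weight_spaceD(1)[OF assms(1)] _ assms(3)
  by (rule orbit_dense) (simp add: weight_spaceD(2)[OF assms(1) _ x0] assms(2))

lemma weight_space_scale:
  "f \<in> weight_space d X act m \<Longrightarrow> (\<lambda>x. c * f x) \<in> weight_space d X act m"
  by (auto simp: weight_space_def intro: gen_algebra_mult gen_algebra.const)

text \<open>The character \<open>\<chi>\<^sup>m\<close> as a regular function on \<open>X\<close>, normalised at the base point.\<close>

definition chi :: "(nat \<Rightarrow> int) \<Rightarrow> (nat \<Rightarrow> 'k) \<Rightarrow> 'k" where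
  "chi m = (SOME f. f \<in> weight_space d X act m \<and> f x\<^sub>0 = 1)"

lemma P_I:
  assumes "m \<in> char_lattice d" "f \<in> weight_space d X act m" "f x\<^sub>0 \<noteq> 0"
  shows "m \<in> P"
  using assms x0 unfolding P_def weight_monoid_def by blast

lemma P_char_lattice: "m \<in> P \<Longrightarrow> m \<in> char_lattice d"
  by (simp add: P_def weight_monoid_def)

lemma chi:
  assumes "m \<in> P"
  shows chi_weight: "chi m \<in> weight_space d X act m" and chi_x0: "chi m x\<^sub>0 = 1"
proof -
  obtain f x where f: "f \<in> weight_space d X act m" "x \<in> X" "f x \<noteq> 0"
    using assms unfolding P_def weight_monoid_def by blast
  then have "f x\<^sub>0 \<noteq> 0" using weight_space_zero by blast
  then have "(\<lambda>x. inverse (f x\<^sub>0) * f x) \<in> weight_space d X act m \<and> inverse (f x\<^sub>0) * f x\<^sub>0 = 1"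
    using weight_space_scale[OF f(1)] by simp
  then have "chi m \<in> weight_space d X act m \<and> chi m x\<^sub>0 = 1"
    unfolding chi_def by (rule someI[of "\<lambda>f. f \<in> weight_space d X act m \<and> f x\<^sub>0 = 1"])
  then show "chi m \<in> weight_space d X act m" "chi m x\<^sub>0 = 1" by auto
qed

lemma chi_gen: "m \<in> P \<Longrightarrow> chi m \<in> gen_algebra coords"
  by (rule weight_spaceD(1)[OF chi_weight])

lemma chi_act: "m \<in> P \<Longrightarrow> t \<in> torus d \<Longrightarrow> x \<in> X \<Longrightarrow> chi m (act t x) = character d m t * chi m x"
  by (rule weight_spaceD(2)[OF chi_weight])

lemma weight_space_eq:
  assumes f: "f \<in> weight_space d X act m" and m: "m \<in> P" and x: "x \<in> X"
  shows "f x = f x\<^sub>0 * chi m x"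
proof -
  have "(\<lambda>x. f x - f x\<^sub>0 * chi m x) \<in> weight_space d X act m"
    unfolding weight_space_def
  proof (intro CollectI conjI ballI)
    show "(\<lambda>x. f x - f x\<^sub>0 * chi m x) \<in> gen_algebra coords"
      by (intro gen_algebra_diff gen_algebra_mult gen_algebra.const weight_spaceD(1)[OF f] chi_gen m)
  qed (simp add: weight_spaceD(2)[OF f] chi_act m algebra_simps)
  from weight_space_zero[OF this _ x] show ?thesis by (simp add: chi_x0[OF m])
qed

lemma zero_in_P: "0 \<in> P"
  by (rule P_I[OF char_lattice_0, of "\<lambda>_. 1"]) (auto simp: weight_space_def intro: gen_algebra.const)

lemma chi_0: "x \<in> X \<Longrightarrow> chi 0 x = 1"
  using weight_space_eq[of "\<lambda>_. 1" 0 x] zero_in_P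
  by (auto simp: weight_space_def intro: gen_algebra.const)

lemma chi_mult_weight:
  assumes "m \<in> P" "m' \<in> P"
  shows "(\<lambda>x. chi m x * chi m' x) \<in> weight_space d X act (m + m')"
  using assms chi_act chi_gen
  by (auto simp: weight_space_def character_add algebra_simps intro: gen_algebra_mult)

lemma add_in_P:
  assumes "m \<in> P" "m' \<in> P"
  shows "m + m' \<in> P"
  by (rule P_I[OF _ chi_mult_weight[OF assms]])
    (use assms P_char_lattice in \<open>auto simp: chi_x0 intro: char_lattice_add\<close>)

lemma chi_add:
  assumes "m \<in> P" "m' \<in> P" "x \<in> X"
  shows "chi (m + m') x = chi m x * chi m' x"
  using weight_space_eq[OF chi_mult_weight[OF assms(1,2)] add_in_P[OF assms(1,2)] assms(3)]
  by (simp add: chi_x0 assms(1,2))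

lemma chi_independent:
  assumes F: "finite F" "F \<subseteq> P" and z: "z \<in> X"
    and zero: "\<And>t. t \<in> torus d \<Longrightarrow> (\<Sum>m\<in>F. c m * chi m (act t z)) = 0"
  shows "\<forall>m\<in>F. c m * chi m z = 0"
proof (rule characters_independent[OF F(1)])
  show "F \<subseteq> char_lattice d" using F(2) P_char_lattice by blast
  fix t :: "nat \<Rightarrow> 'k" assume t: "t \<in> torus d"
  have "(\<Sum>m\<in>F. c m * chi m z * character d m t) = (\<Sum>m\<in>F. c m * chi m (act t z))"
    using F(2) by (intro sum.cong) (auto simp: chi_act[OF _ t z])
  then show "(\<Sum>m\<in>F. c m * chi m z * character d m t) = 0" using zero[OF t] by simp
qed

lemma chi_independent_X:
  assumes "finite F" "F \<subseteq> P" "\<And>x. x \<in> X \<Longrightarrow> (\<Sum>m\<in>F. c m * chi m x) = 0" "m \<in> F"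
  shows "c m = 0"
proof -
  have "\<forall>m\<in>F. c m * chi m x\<^sub>0 = 0"
    using assms(3)[OF act_in[OF _ x0]] by (rule chi_independent[OF assms(1,2) x0])
  then show ?thesis using assms(2,4) by (auto simp: chi_x0 subset_iff)
qed

text \<open>Expand f(t x) into characters of t with polynomial coefficients in x. Computing f(s t x)
  in two ways and comparing coefficients of the characters of s shows that each coefficient is a
  weight vector; t = 1 gives the decomposition of f.\<close>

lemma weight_decomposition:
  assumes f: "f \<in> gen_algebra coords"
  shows "\<exists>F q. finite F \<and> F \<subseteq> char_lattice d \<and> (\<forall>m\<in>F. q m \<in> weight_space d X act m) \<and>
    (\<forall>x\<in>X. f x = (\<Sum>m\<in>F. q m x))"
proof -
  have "\<exists>h\<in>gen_algebra torus_coords. \<forall>y\<in>torus d \<times> X. f (act (fst y) (snd y)) = h y"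
    by (rule coords_subst[OF f]) (use act_poly in \<open>auto simp: poly_map_def case_prod_unfold\<close>)
  then obtain h where h: "h \<in> gen_algebra torus_coords" "\<forall>y\<in>torus d \<times> X. f (act (fst y) (snd y)) = h y"
    by (rule bexE)
  obtain I c where I: "finite I" "I \<subseteq> char_lattice d \<times> gen_algebra coords"
    "\<forall>y\<in>torus d \<times> UNIV. h y = (\<Sum>i\<in>I. c i * (case i of (m, q) \<Rightarrow> \<lambda>(t, x). character d m t * q x) y)"
    using lin_span_image[OF torus_coords_lin_span[OF h(1), of d]] by blast
  define F where "F = fst ` I"
  \<comment> \<open>Terms with the same character are collected first, as independence speaks about
    distinct characters.\<close>
  define q where "q m x = (\<Sum>i\<in>{i \<in> I. fst i = m}. c i * snd i x)" for m x
  have F: "finite F" "F \<subseteq> char_lattice d" using I(1,2) by (auto simp: F_def)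
  have q: "q m \<in> gen_algebra coords" for m
    unfolding q_def using I(2) by (intro gen_algebra_sum gen_algebra_mult gen_algebra.const) auto
  have expand: "f (act t x) = (\<Sum>m\<in>F. q m x * character d m t)" if t: "t \<in> torus d" and x: "x \<in> X" for t x
  proof -
    have "f (act t x) = (\<Sum>i\<in>I. c i * (character d (fst i) t * snd i x))"
      using h(2) I(3) t x by (auto simp: case_prod_unfold)
    also have "\<dots> = (\<Sum>m\<in>F. \<Sum>i\<in>{i \<in> I. fst i = m}. c i * (character d (fst i) t * snd i x))"
      using I(1) by (intro sum.group[symmetric]) (auto simp: F_def)
    also have "\<dots> = (\<Sum>m\<in>F. q m x * character d m t)"
      unfolding q_def sum_distrib_right by (intro sum.cong) auto
    finally show ?thesis .
  qed
  have "q m (act t x) = character d m t * q m x" if m: "m \<in> F" and t: "t \<in> torus d" and x: "x \<in> X" for m t x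
  proof -
    have "\<forall>m\<in>F. q m (act t x) - character d m t * q m x = 0"
    proof (rule characters_independent[OF F])
      fix s :: "nat \<Rightarrow> 'k" assume s: "s \<in> torus d"
      have "(\<Sum>m\<in>F. (q m (act t x) - character d m t * q m x) * character d m s)
          = (\<Sum>m\<in>F. q m (act t x) * character d m s) - (\<Sum>m\<in>F. q m x * character d m (s * t))"
        by (simp add: character_mult sum_subtractf algebra_simps)
      also have "\<dots> = 0"
        using expand[OF s act_in[OF t x]] expand[OF torus_mult[OF s t] x] act_mult[OF s t x] by simp
      finally show "(\<Sum>m\<in>F. (q m (act t x) - character d m t * q m x) * character d m s) = 0" .
    qed
    then show ?thesis using m by simp
  qed
  then have "\<forall>m\<in>F. q m \<in> weight_space d X act m" using q by (auto simp: weight_space_def)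
  moreover have "\<forall>x\<in>X. f x = (\<Sum>m\<in>F. q m x)" using expand[OF torus_1] act_1 by simp
  ultimately show ?thesis using F by blast
qed

lemma chi_expansion:
  assumes f: "f \<in> gen_algebra coords"
  shows "\<exists>F c. finite F \<and> F \<subseteq> P \<and> (\<forall>x\<in>X. f x = (\<Sum>m\<in>F. c m * chi m x))"
proof -
  obtain F q where F: "finite F" "F \<subseteq> char_lattice d" and q: "\<forall>m\<in>F. q m \<in> weight_space d X act m"
    and eq: "\<forall>x\<in>X. f x = (\<Sum>m\<in>F. q m x)"
    using weight_decomposition[OF f] by blast
  \<comment> \<open>Components that vanish at the base point vanish on \<open>X\<close>; discarding
    them leaves only weights in \<open>P\<close>.\<close>
  define F' where "F' = {m \<in> F. q m x\<^sub>0 \<noteq> 0}"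
  have F'P: "F' \<subseteq> P" using F(2) q P_I by (auto simp: F'_def)
  have "f x = (\<Sum>m\<in>F'. q m x\<^sub>0 * chi m x)" if x: "x \<in> X" for x
  proof -
    have "f x = (\<Sum>m\<in>F'. q m x)"
      unfolding bspec[OF eq x] using F(1) q weight_space_zero[OF _ _ x]
      by (intro sum.mono_neutral_right) (auto simp: F'_def)
    also have "\<dots> = (\<Sum>m\<in>F'. q m x\<^sub>0 * chi m x)"
      using F'P q weight_space_eq[OF _ _ x] by (intro sum.cong) (auto simp: F'_def)
    finally show ?thesis .
  qed
  then show ?thesis using F(1) F'P by (intro exI[of _ F'] exI[of _ "\<lambda>m. q m x\<^sub>0"]) (auto simp: F'_def)
qed

text \<open>The weights in the expansions of the finitely many coordinates that are not identically
  zero generate P. If a submonoid H contains them, all functions are combinations of characters with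
  weights in H, and a character with weight outside H would contradict independence.\<close>

lemma finitely_generated: "\<exists>G. fg_monoid P G"
proof -
  obtain n where n: "X \<subseteq> affine_space n" using affine_variety by (auto simp: affine_variety_def)
  obtain F c where F: "\<And>i. finite (F i)" "\<And>i. F i \<subseteq> P"
    "\<And>i x. x \<in> X \<Longrightarrow> x i = (\<Sum>m\<in>F i. c i m * chi m x)"
    using chi_expansion[OF coord_gen] by metis
  define G where "G = (\<Union>i<n. F i)"
  have "fg_monoid P G"
  proof
    show "finite G" "G \<subseteq> P" using F(1,2) by (auto simp: G_def)
    show "0 \<in> P" by (rule zero_in_P)
    show "a + b \<in> P" if "a \<in> P" "b \<in> P" for a b using that by (rule add_in_P)
    fix H assume H: "G \<subseteq> H" "0 \<in> H" "\<And>a b. a \<in> H \<Longrightarrow> b \<in> H \<Longrightarrow> a + b \<in> H"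
    let ?W = "chi ` (H \<inter> P)"
    have span: "f \<in> lin_span ?W X" if "f \<in> gen_algebra coords" for f
    proof (rule gen_algebra_lin_span[OF _ _ _ that])
      show "(\<lambda>x. v x * w x) \<in> lin_span ?W X" if vw: "v \<in> ?W" "w \<in> ?W" for v w
      proof -
        obtain a b where ab: "a \<in> H \<inter> P" "b \<in> H \<inter> P" "v = chi a" "w = chi b" using vw by blast
        then have "chi (a + b) \<in> lin_span ?W X" using H(3) add_in_P by (intro lin_span_gen) blast
        then show ?thesis using ab by (elim lin_span_cong) (auto simp: chi_add)
      qed
      have "chi 0 \<in> lin_span ?W X" using H(2) zero_in_P by (intro lin_span_gen) blast
      then show "(\<lambda>_. 1) \<in> lin_span ?W X" by (elim lin_span_cong) (simp add: chi_0)
      fix g assume "g \<in> (coords :: ((nat \<Rightarrow> 'k) \<Rightarrow> 'k) set)"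
      then obtain i where g: "g = (\<lambda>x. x i)" by (auto simp: coords_def)
      show "g \<in> lin_span ?W X"
      proof (cases "i < n")
        case True
        have "(\<lambda>x. \<Sum>m\<in>F i. c i m * chi m x) \<in> lin_span ?W X"
        proof (intro lin_span_sum lin_span_scale imageI IntI)
          show "m \<in> H" "m \<in> P" if "m \<in> F i" for m
            using that H(1) F(2) True by (auto simp: G_def)
        qed
        then show ?thesis by (rule lin_span_cong) (simp add: g F(3))
      next
        case False
        then show ?thesis using n by (intro lin_span.zero) (auto simp: g affine_space_def)
      qed
    qed
    show "P \<subseteq> H"
    proof
      fix m assume m: "m \<in> P"
      obtain E b where E: "finite E" "E \<subseteq> H \<inter> P" "\<forall>x\<in>X. chi m x = (\<Sum>n\<in>E. b n * chi n x)"
        using lin_span_image[OF span[OF chi_gen[OF m]]] by blast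
      show "m \<in> H"
      proof (rule ccontr)
        assume "m \<notin> H"
        then have "m \<notin> E" using E(2) by blast
        \<comment> \<open>The coefficient -1 at \<open>m\<close> turns the expansion of
          \<open>chi m\<close> over \<open>E\<close> into a vanishing combination of distinct
          characters.\<close>
        have "(b(m := - 1)) m = 0"
        proof (rule chi_independent_X[where F = "insert m E" and c = "b(m := - 1)"])
          fix x assume x: "x \<in> X"
          have "(\<Sum>n\<in>E. (b(m := -1)) n * chi n x) = (\<Sum>n\<in>E. b n * chi n x)"
            using \<open>m \<notin> E\<close> by (intro sum.cong) auto
          then show "(\<Sum>n\<in>insert m E. (b(m := -1)) n * chi n x) = 0"
            using E(1,3) x \<open>m \<notin> E\<close> by simp
        qed (use E m in auto)
        then show False by simp
      qed
    qed
  qed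
  then show ?thesis by blast
qed


subsection \<open>Points as monoid homomorphisms\<close>

definition monoid_hom :: "((nat \<Rightarrow> int) \<Rightarrow> 'k) \<Rightarrow> bool" where
  "monoid_hom \<gamma> \<longleftrightarrow> \<gamma> 0 = 1 \<and> (\<forall>m\<in>P. \<forall>m'\<in>P. \<gamma> (m + m') = \<gamma> m * \<gamma> m')"

definition coord_expansion :: "nat \<Rightarrow> (nat \<Rightarrow> int) set \<times> ((nat \<Rightarrow> int) \<Rightarrow> 'k)" where
  "coord_expansion i = (SOME Fc. finite (fst Fc) \<and> fst Fc \<subseteq> P \<and>
     (\<forall>x\<in>X. x i = (\<Sum>m\<in>fst Fc. snd Fc m * chi m x)))"

text \<open>The inverse of evaluation: each coordinate function is expanded into characters once and
  for all, and the values of \<gamma> are put in their place.\<close>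

definition point :: "((nat \<Rightarrow> int) \<Rightarrow> 'k) \<Rightarrow> nat \<Rightarrow> 'k" where
  "point \<gamma> i = (\<Sum>m\<in>fst (coord_expansion i). snd (coord_expansion i) m * \<gamma> m)"

lemma coord_expansion:
  shows finite_coord_expansion: "finite (fst (coord_expansion i))"
    and coord_expansion_P: "fst (coord_expansion i) \<subseteq> P"
    and coord_expansion_eq:
      "x \<in> X \<Longrightarrow> x i = (\<Sum>m\<in>fst (coord_expansion i). snd (coord_expansion i) m * chi m x)"
proof -
  obtain F c where "finite F \<and> F \<subseteq> P \<and> (\<forall>x\<in>X. x i = (\<Sum>m\<in>F. c m * chi m x))"
    using chi_expansion[OF coord_gen[of i]] by blast
  then have "finite (fst (F, c)) \<and> fst (F, c) \<subseteq> P \<and> (\<forall>x\<in>X. x i = (\<Sum>m\<in>fst (F, c). snd (F, c) m * chi m x))"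
    by simp
  then have *: "finite (fst (coord_expansion i)) \<and> fst (coord_expansion i) \<subseteq> P \<and>
     (\<forall>x\<in>X. x i = (\<Sum>m\<in>fst (coord_expansion i). snd (coord_expansion i) m * chi m x))"
    unfolding coord_expansion_def by (rule someI)
  then show "finite (fst (coord_expansion i))" "fst (coord_expansion i) \<subseteq> P"
    "x \<in> X \<Longrightarrow> x i = (\<Sum>m\<in>fst (coord_expansion i). snd (coord_expansion i) m * chi m x)"
    by blast+
qed

lemma monoid_hom_chi: "x \<in> X \<Longrightarrow> monoid_hom (\<lambda>m. chi m x)"
  by (simp add: monoid_hom_def chi_0 chi_add)

lemma point_chi: "x \<in> X \<Longrightarrow> point (\<lambda>m. chi m x) = x"
  by (rule ext) (simp add: point_def coord_expansion_eq[symmetric])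

lemma point_cong: "(\<And>m. m \<in> P \<Longrightarrow> \<gamma> m = \<gamma>' m) \<Longrightarrow> point \<gamma> = point \<gamma>'"
  unfolding point_def fun_eq_iff using coord_expansion_P
  by (intro allI sum.cong refl arg_cong2[where f = "(*)"]) blast

lemma gen_algebra_point:
  assumes f: "f \<in> gen_algebra coords"
  shows "\<exists>F c. finite F \<and> F \<subseteq> P \<and> (\<forall>\<gamma>. monoid_hom \<gamma> \<longrightarrow> f (point \<gamma>) = (\<Sum>m\<in>F. c m * \<gamma> m))"
proof -
  let ?w = "\<lambda>m \<gamma>. \<gamma> m" and ?D = "{\<gamma>. monoid_hom \<gamma>}"
  have "(\<lambda>\<gamma>. f (point \<gamma>)) \<in> lin_span (?w ` P) ?D"
  proof (rule gen_algebra_lin_span)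
    show "(\<lambda>\<gamma>. f (point \<gamma>)) \<in> gen_algebra (range (\<lambda>i \<gamma>. point \<gamma> i))"
      by (rule coords_subst'[OF f]) (auto intro: gen_algebra.gen)
    show "(\<lambda>\<gamma>. v \<gamma> * w \<gamma>) \<in> lin_span (?w ` P) ?D" if "v \<in> ?w ` P" "w \<in> ?w ` P" for v w
    proof -
      from that(1) obtain a where a: "v = ?w a" "a \<in> P" by (rule imageE)
      from that(2) obtain b where b: "w = ?w b" "b \<in> P" by (rule imageE)
      have "?w (a + b) \<in> lin_span (?w ` P) ?D"
        by (intro lin_span_gen imageI add_in_P a b)
      then show ?thesis by (rule lin_span_cong) (use a b in \<open>auto simp: monoid_hom_def\<close>)
    qed
    have "?w 0 \<in> lin_span (?w ` P) ?D" using zero_in_P by (intro lin_span_gen) blast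
    then show "(\<lambda>_. 1) \<in> lin_span (?w ` P) ?D" by (elim lin_span_cong) (simp add: monoid_hom_def)
    fix g assume "g \<in> range (\<lambda>i \<gamma>. point \<gamma> i)"
    then obtain i where g: "g = (\<lambda>\<gamma>. point \<gamma> i)" by blast
    show "g \<in> lin_span (?w ` P) ?D"
      unfolding g point_def
    proof (rule lin_span_sum)
      fix m assume "m \<in> fst (coord_expansion i)"
      then have "m \<in> P" using coord_expansion_P by blast
      then show "(\<lambda>\<gamma>. snd (coord_expansion i) m * \<gamma> m) \<in> lin_span (?w ` P) ?D"
        by (intro lin_span_scale imageI)
    qed
  qed
  from lin_span_image[OF this] show ?thesis by auto
qed

text \<open>Evaluation at \<gamma> does not depend on the expansion chosen. Two expansions that
  agree on X have the same coefficients by independence of characters, so they also agree at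
  \<gamma>, which is not yet known to come from a point of X.\<close>

lemma gen_algebra_point_eq:
  assumes f: "f \<in> gen_algebra coords" and F: "finite F" "F \<subseteq> P"
    and eq: "\<And>x. x \<in> X \<Longrightarrow> f x = (\<Sum>m\<in>F. c m * chi m x)" and \<gamma>: "monoid_hom \<gamma>"
  shows "f (point \<gamma>) = (\<Sum>m\<in>F. c m * \<gamma> m)"
proof -
  obtain E b where E: "finite E" "E \<subseteq> P" "\<And>\<gamma>. monoid_hom \<gamma> \<Longrightarrow> f (point \<gamma>) = (\<Sum>m\<in>E. b m * \<gamma> m)"
    using gen_algebra_point[OF f] by blast
  define c' where "c' m = (if m \<in> F then c m else 0)" for m
  define b' where "b' m = (if m \<in> E then b m else 0)" for m
  have F_sum: "(\<Sum>m\<in>F. c m * g m) = (\<Sum>m\<in>F \<union> E. c' m * g m)" for g :: "(nat \<Rightarrow> int) \<Rightarrow> 'k"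
    using F(1) E(1) by (intro sum.mono_neutral_cong_left) (auto simp: c'_def)
  have E_sum: "(\<Sum>m\<in>E. b m * g m) = (\<Sum>m\<in>F \<union> E. b' m * g m)" for g :: "(nat \<Rightarrow> int) \<Rightarrow> 'k"
    using F(1) E(1) by (intro sum.mono_neutral_cong_left) (auto simp: b'_def)
  have "c' m - b' m = 0" if "m \<in> F \<union> E" for m
  proof (rule chi_independent_X[OF _ _ _ that])
    fix x assume x: "x \<in> X"
    have "f x = (\<Sum>m\<in>E. b m * chi m x)" using E(3)[OF monoid_hom_chi[OF x]] by (simp add: point_chi[OF x])
    then have "(\<Sum>m\<in>F \<union> E. c' m * chi m x) = (\<Sum>m\<in>F \<union> E. b' m * chi m x)"
      using eq[OF x] by (simp add: F_sum[symmetric] E_sum[symmetric])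
    then show "(\<Sum>m\<in>F \<union> E. (c' m - b' m) * chi m x) = 0"
      by (simp add: left_diff_distrib sum_subtractf)
  qed (use F E in auto)
  then have "(\<Sum>m\<in>F \<union> E. c' m * \<gamma> m) = (\<Sum>m\<in>F \<union> E. b' m * \<gamma> m)" by (intro sum.cong) auto
  then show ?thesis using E(3)[OF \<gamma>] by (simp add: F_sum E_sum)
qed

lemma point_in_X:
  assumes "monoid_hom \<gamma>"
  shows "point \<gamma> \<in> X"
proof -
  have "closedin (zariski coords) X" using affine_variety by (simp add: affine_variety_def)
  then obtain S where S: "S \<subseteq> gen_algebra coords" "X = {x. \<forall>p\<in>S. p x = 0}" unfolding closedin_zariski by blast
  have "p (point \<gamma>) = 0" if p: "p \<in> S" for p
    \<comment> \<open>An equation of \<open>X\<close> has the empty expansion on \<open>X\<close>,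
      so it evaluates to 0 at every monoid homomorphism.\<close>
    using gen_algebra_point_eq[of p "{}" undefined \<gamma>] p S assms by auto
  then show ?thesis using S(2) by blast
qed

lemma chi_point:
  assumes "monoid_hom \<gamma>" "m \<in> P"
  shows "chi m (point \<gamma>) = \<gamma> m"
  using gen_algebra_point_eq[OF chi_gen[OF assms(2)], of "{m}" "\<lambda>_. 1" \<gamma>] assms by auto

lemma point_eqI:
  assumes "x \<in> X" "y \<in> X" "\<And>m. m \<in> P \<Longrightarrow> chi m x = chi m y"
  shows "x = y"
  using point_cong[of "\<lambda>m. chi m x" "\<lambda>m. chi m y"] assms by (simp add: point_chi)

end


section \<open>Tori and root subgroups in the neutral component\<close>

lemma affine_variety_line: "affine_variety (affine_space 1 :: (nat \<Rightarrow> 'k::field) set)"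
proof -
  have "affine_space 1 = {x. \<forall>p\<in>(\<lambda>i x. x i) ` {1..}. p x = (0 :: 'k)}"
    by (auto simp: affine_space_def)
  moreover have "(\<lambda>i (x :: nat \<Rightarrow> 'k). x i) ` {1..} \<subseteq> gen_algebra coords"
    using coord_gen by blast
  ultimately have "closedin (zariski coords) (affine_space 1 :: (nat \<Rightarrow> 'k) set)"
    unfolding closedin_zariski by blast
  then show ?thesis by (auto simp: affine_variety_def)
qed

lemma irreducible_line:
  "irreducible_space (zariski_on (affine_space 1 :: (nat \<Rightarrow> 'k::field_char_0) set))"
proof -
  define \<gamma> where "\<gamma> a = (\<lambda>i::nat. if i = 0 then a else 0 :: 'k)" for a
  have "irreducible_space (zariski_on (\<gamma> ` UNIV))"
  proof (rule irreducible_curve[where w = 1])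
    show "infinite (UNIV :: 'k set)" by (rule infinite_UNIV_char_0)
    show "\<exists>q N. \<forall>a\<in>UNIV. \<gamma> a i * poly 1 a ^ N = poly q a" for i
      by (intro exI[of _ "if i = 0 then [:0, 1:] else 0"] exI[of _ 0]) (simp add: \<gamma>_def)
  qed simp
  moreover have "\<gamma> ` UNIV = affine_space 1"
  proof (intro equalityI subsetI)
    fix x :: "nat \<Rightarrow> 'k" assume "x \<in> affine_space 1"
    then have "x = \<gamma> (x 0)" by (auto simp: affine_space_def \<gamma>_def)
    then show "x \<in> \<gamma> ` UNIV" by blast
  qed (auto simp: \<gamma>_def affine_space_def)
  ultimately show ?thesis by simp
qed

text \<open>The multiplicative group, as a closed subvariety of the plane.\<close>

definition hyperbola :: "(nat \<Rightarrow> 'k::field) set" where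
  "hyperbola = {v \<in> affine_space 2. v 0 * v 1 = 1}"

lemma affine_variety_hyperbola: "affine_variety (hyperbola :: (nat \<Rightarrow> 'k::field) set)"
proof -
  let ?S = "insert (\<lambda>v. v 0 * v 1 - 1) ((\<lambda>i x. x i) ` {2..}) :: ((nat \<Rightarrow> 'k) \<Rightarrow> 'k) set"
  have "hyperbola = {x. \<forall>p\<in>?S. p x = 0}"
    by (auto simp: affine_space_def hyperbola_def)
  moreover have "?S \<subseteq> gen_algebra coords"
    by (intro insert_subsetI image_subsetI gen_algebra_diff gen_algebra_mult gen_algebra.const coord_gen)
  ultimately have "closedin (zariski coords) (hyperbola :: (nat \<Rightarrow> 'k) set)"
    unfolding closedin_zariski by blast
  then show ?thesis by (auto simp: affine_variety_def hyperbola_def)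
qed

lemma irreducible_hyperbola:
  "irreducible_space (zariski_on (hyperbola :: (nat \<Rightarrow> 'k::field_char_0) set))"
proof -
  define \<gamma> where "\<gamma> a = (\<lambda>i::nat. if i = 0 then a else if i = 1 then inverse a else 0 :: 'k)" for a
  have "irreducible_space (zariski_on (\<gamma> ` (- {0})))"
  proof (rule irreducible_curve[where w = "[:0, 1:]"])
    have "infinite (UNIV - {0 :: 'k})" using infinite_UNIV_char_0 by (rule infinite_remove)
    then show "infinite (- {0 :: 'k})" by (simp add: Compl_eq_Diff_UNIV)
    fix i :: nat
    consider "i = 0" | "i = 1" | "i > 1" by linarith
    then show "\<exists>q N. \<forall>a\<in>- {0}. \<gamma> a i * poly [:0, 1:] a ^ N = poly q a"
    proof cases
      case 1
      then show ?thesis by (intro exI[of _ "[:0, 1:]"] exI[of _ 0]) (simp add: \<gamma>_def)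
    next
      case 2
      then show ?thesis by (intro exI[of _ 1] exI[of _ 1]) (simp add: \<gamma>_def)
    next
      case 3
      then show ?thesis by (intro exI[of _ 0] exI[of _ 0]) (simp add: \<gamma>_def)
    qed
  qed simp
  moreover have "\<gamma> ` (- {0}) = hyperbola"
  proof (intro equalityI subsetI)
    fix x :: "nat \<Rightarrow> 'k" assume "x \<in> hyperbola"
    then have x: "\<forall>i\<ge>2. x i = 0" "x 0 * x 1 = 1" by (auto simp: hyperbola_def affine_space_def)
    have "x = \<gamma> (x 0)"
    proof
      fix i :: nat
      consider "i = 0" | "i = 1" | "i \<ge> 2" by linarith
      then show "x i = \<gamma> (x 0) i" using x by cases (auto simp: \<gamma>_def inverse_unique)
    qed
    moreover have "x 0 \<in> - {0}" using x(2) by auto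
    ultimately show "x \<in> \<gamma> ` (- {0})" by (rule image_eqI)
  qed (auto simp: \<gamma>_def hyperbola_def affine_space_def)
  ultimately show ?thesis by simp
qed

section \<open>The torus inside the neutral component\<close>

context toric
begin

lemma automorphism_act:
  assumes t: "t \<in> torus d"
  shows "automorphism X (act t)"
proof (rule automorphismI)
  let ?s = "\<lambda>i. inverse (t i)"
  have s: "?s \<in> torus d" by (rule torus_inverse[OF t])
  have ts: "t * ?s = 1" "?s * t = 1" using torus_mult_inverse[OF t] by (simp_all add: mult.commute)
  show "act t x \<in> X" "act ?s x \<in> X" if "x \<in> X" for x using act_in t s that by blast+
  show "act ?s (act t x) = x" "act t (act ?s x) = x" if "x \<in> X" for x
    using act_mult[OF s t that] act_mult[OF t s that] ts act_1[OF that] by simp_all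
  have "poly_map coords X (act t)" if t: "t \<in> torus d" for t
    unfolding poly_map_def
  proof
    fix j
    obtain p where p: "p \<in> gen_algebra torus_coords" "\<forall>y\<in>torus d \<times> X. act (fst y) (snd y) j = p y"
      using act_poly unfolding poly_map_def case_prod_unfold by blast
    have "(\<lambda>x. p (t, x)) \<in> gen_algebra coords"
      by (rule gen_algebra_subst'[OF p(1)]) (auto simp: torus_coords_def intro: coord_gen gen_algebra.const)
    then show "\<exists>p\<in>gen_algebra coords. \<forall>x\<in>X. act t x j = p x"
      using p(2) t by (intro bexI[of _ "\<lambda>x. p (t, x)"]) auto
  qed
  then show "poly_map coords X (act t)" "poly_map coords X (act ?s)" using t s by blast+
qed

definition coordinate_subgroup :: "nat \<Rightarrow> 'k \<Rightarrow> nat \<Rightarrow> 'k" where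
  "coordinate_subgroup i a = (\<lambda>j. if j = i then a else 1)"

lemma coordinate_subgroup_torus: "i < d \<Longrightarrow> a \<noteq> 0 \<Longrightarrow> coordinate_subgroup i a \<in> torus d"
  by (auto simp: torus_def coordinate_subgroup_def)

text \<open>The parameter runs over the hyperbola because charts must be closed in affine space; its
  second coordinate makes \<open>inverse (t i)\<close> polynomial in the base.\<close>

lemma coordinate_subgroup_Aut0:
  assumes i: "i < d" and a: "a \<noteq> 0"
  shows "act (coordinate_subgroup i a) \<in> Aut0 X"
proof -
  define F where "F v = act (coordinate_subgroup i (v 0))" for v :: "nat \<Rightarrow> 'k"
  define v where "v b = (\<lambda>i::nat. if i = 0 then b else if i = 1 then inverse b else 0 :: 'k)" for b
  have v: "v b \<in> hyperbola" if "b \<noteq> 0" for b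
    using that by (auto simp: v_def hyperbola_def affine_space_def)
  have nz: "w 0 \<noteq> 0" "inverse (w 0) = w 1" if "w \<in> hyperbola" for w :: "nat \<Rightarrow> 'k"
    using that by (auto simp: hyperbola_def inverse_unique)
  have "F (v a) \<in> Aut0 X"
  proof (rule Aut0_affine_family[OF affine_variety_hyperbola irreducible_hyperbola _ _ v[of 1] _ v[OF a]])
    show "automorphism X (F w)" if "w \<in> hyperbola" for w
      unfolding F_def using nz[OF that] i by (intro automorphism_act coordinate_subgroup_torus)
    show "poly_map coords2 (hyperbola \<times> X) (\<lambda>(w, x). F w x)"
      unfolding poly_map_def
    proof
      fix j
      obtain p where p: "p \<in> gen_algebra torus_coords" "\<forall>y\<in>torus d \<times> X. act (fst y) (snd y) j = p y"
        using act_poly unfolding poly_map_def case_prod_unfold by blast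
      have "\<exists>h\<in>gen_algebra coords2. \<forall>y\<in>hyperbola \<times> X. p (coordinate_subgroup i (fst y 0), snd y) = h y"
      proof (rule gen_algebra_subst[OF p(1)])
        fix g :: "(nat \<Rightarrow> 'k) \<times> (nat \<Rightarrow> 'k) \<Rightarrow> 'k" assume "g \<in> torus_coords"
        then consider k where "g = (\<lambda>(t, x). t k)" | k where "g = (\<lambda>(t, x). inverse (t k))"
          | k where "g = (\<lambda>(t, x). x k)"
          unfolding torus_coords_def by blast
        then show "\<exists>h\<in>gen_algebra coords2. \<forall>y\<in>hyperbola \<times> X. g (coordinate_subgroup i (fst y 0), snd y) = h y"
        proof cases
          case (1 k)
          show ?thesis unfolding 1
            by (rule bexI[of _ "if k = i then (\<lambda>y. fst y 0) else (\<lambda>_. 1)"])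
              (auto simp: coordinate_subgroup_def intro: coord2_gen gen_algebra.const)
        next
          case (2 k)
          show ?thesis unfolding 2
            by (rule bexI[of _ "if k = i then (\<lambda>y. fst y 1) else (\<lambda>_. 1)"])
              (auto simp: coordinate_subgroup_def nz(2)[unfolded One_nat_def] intro: coord2_gen gen_algebra.const)
        next
          case (3 k)
          show ?thesis unfolding 3 by (rule bexI[of _ "\<lambda>y. snd y k"]) (auto intro: coord2_gen)
        qed
      qed
      then obtain h where h: "h \<in> gen_algebra coords2"
        "\<forall>y\<in>hyperbola \<times> X. p (coordinate_subgroup i (fst y 0), snd y) = h y" by (rule bexE)
      have "\<forall>y\<in>hyperbola \<times> X. (case y of (w, x) \<Rightarrow> F w x) j = h y"
        using h(2) p(2) nz(1) coordinate_subgroup_torus[OF i] by (fastforce simp: F_def)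
      then show "\<exists>p\<in>gen_algebra coords2. \<forall>y\<in>hyperbola \<times> X. (case y of (w, x) \<Rightarrow> F w x) j = p y"
        by (intro bexI[OF _ h(1)])
    qed
    have "coordinate_subgroup i (v 1 0) = 1" by (auto simp: coordinate_subgroup_def v_def fun_eq_iff)
    then show "F (v 1) x = x" if "x \<in> X" for x using act_1[OF that] by (simp add: F_def)
  qed simp
  then show ?thesis by (simp add: F_def v_def)
qed

text \<open>A torus element is a product of elements of coordinate subgroups, so families with
  one-dimensional base and closure under composition suffice. The composite is known to agree with
  \<open>act t\<close> only on X, whence the existential form.\<close>

lemma act_Aut0:
  assumes t: "t \<in> torus d"
  shows "\<exists>\<phi>\<in>Aut0 X. \<forall>x\<in>X. \<phi> x = act t x"
proof -
  define r where "r k = (\<lambda>i. if i < k then t i else 1)" for k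
  have r: "r k \<in> torus d" for k using t by (auto simp: torus_def r_def)
  have r0: "r 0 = 1" by (auto simp: r_def fun_eq_iff)
  have rd: "r d = t" using t by (auto simp: torus_def r_def fun_eq_iff)
  have "\<exists>\<phi>\<in>Aut0 X. \<forall>x\<in>X. \<phi> x = act (r k) x" if "k \<le> d" for k
    using that
  proof (induction k)
    case 0
    have "act 1 \<in> Aut0 X"
    \<comment> \<open>The empty product acts as the identity on \<open>X\<close>, a member of a
      constant family over the line.\<close>
    proof (rule Aut0_affine_family[OF affine_variety_line irreducible_line,
          where F = "\<lambda>_. act 1" and v = "\<lambda>_. 0" and v\<^sub>0 = "\<lambda>_. 0"])
      show "automorphism X (act 1)" by (rule automorphism_act[OF torus_1])
      have "\<forall>y\<in>affine_space 1 \<times> X. (case y of (v, x) \<Rightarrow> act 1 x) j = snd y j" for j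
        by (auto simp: act_1)
      then show "poly_map coords2 (affine_space 1 \<times> X) (\<lambda>(v, x). act 1 x)"
        unfolding poly_map_def by (intro allI bexI[OF _ coord2_gen(2)])
    qed (auto simp: affine_space_def act_1)
    then show ?case unfolding r0 by blast
  next
    case (Suc k)
    then obtain \<phi> where \<phi>: "\<phi> \<in> Aut0 X" "\<forall>x\<in>X. \<phi> x = act (r k) x" by auto
    let ?s = "coordinate_subgroup k (t k)"
    have s: "?s \<in> torus d" "act ?s \<in> Aut0 X"
      using Suc.prems torus_nonzero[OF t] by (auto intro: coordinate_subgroup_torus coordinate_subgroup_Aut0)
    have "r (Suc k) = ?s * r k" by (auto simp: r_def coordinate_subgroup_def fun_eq_iff less_Suc_eq)
    then have "\<forall>x\<in>X. act ?s (\<phi> x) = act (r (Suc k)) x" using act_mult[OF s(1) r] \<phi>(2) by simp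
    then show ?case using Aut0_comp[OF s(2) \<phi>(1)] by (intro bexI[of _ "\<lambda>x. act ?s (\<phi> x)"])
  qed
  from this[of d] show ?thesis by (simp add: rd)
qed

end

text \<open>Regroups a rectangle of indices by diagonals. The conditions in the inner sum remove
  those points of the diagonals that lie outside the rectangle.\<close>

lemma sum_product_diagonals:
  fixes f :: "nat \<Rightarrow> nat \<Rightarrow> 'a::comm_monoid_add"
  shows "(\<Sum>i\<le>a. \<Sum>j\<le>b. f i j) = (\<Sum>n\<le>a + b. \<Sum>i\<le>n. if i \<le> a \<and> n - i \<le> b then f i (n - i) else 0)"
proof -
  have "(\<Sum>i\<le>a. \<Sum>j\<le>b. f i j) = (\<Sum>(i, j)\<in>{..a} \<times> {..b}. f i j)" by (rule sum.cartesian_product)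
  also have "\<dots> = (\<Sum>(i, j)\<in>{(i, j). i + j \<le> a + b}. if i \<le> a \<and> j \<le> b then f i j else 0)"
  proof (rule sum.mono_neutral_cong_left)
    show "finite {(i, j). i + j \<le> a + b}"
      by (rule finite_subset[of _ "{..a + b} \<times> {..a + b}"]) auto
  qed (auto split: if_splits)
  also have "\<dots> = (\<Sum>n\<le>a + b. \<Sum>i\<le>n. if i \<le> a \<and> n - i \<le> b then f i (n - i) else 0)"
    by (rule sum.triangle_reindex_eq)
  finally show ?thesis .
qed

text \<open>The automorphisms \<open>exp (s \<partial>\<^sub>e)\<close> for the derivation \<open>\<partial>\<^sub>e \<chi>\<^sup>m = h m \<chi>\<^sup>m\<^sup>+\<^sup>e\<close>, where \<open>h\<close> is the pairing
  with the distinguished ray vector of \<open>e\<close>.\<close>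

locale root_subgroup = toric d X act x\<^sub>0
  for d :: nat and X :: "(nat \<Rightarrow> 'k::field_char_0) set" and act x\<^sub>0 +
  fixes e :: "nat \<Rightarrow> int" and h :: "(nat \<Rightarrow> int) \<Rightarrow> nat"
  assumes h_add: "m \<in> P \<Longrightarrow> m' \<in> P \<Longrightarrow> h (m + m') = h m + h m'"
    and shift_P: "m \<in> P \<Longrightarrow> 0 < h m \<Longrightarrow> e + m \<in> P"
    and h_shift: "m \<in> P \<Longrightarrow> 0 < h m \<Longrightarrow> Suc (h (e + m)) = h m"
begin

section \<open>Binomial sums along a root\<close>

definition shift :: "nat \<Rightarrow> (nat \<Rightarrow> int) \<Rightarrow> nat \<Rightarrow> int" where
  "shift k m = (\<lambda>i. int k * e i + m i)"

lemma shift_0 [simp]: "shift 0 m = m"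
  and shift_1: "shift (Suc 0) m = e + m"
  and shift_shift: "shift k (shift l m) = shift (k + l) m"
  and shift_add: "shift k m + shift l m' = shift (k + l) (m + m')"
  by (auto simp: shift_def fun_eq_iff algebra_simps)

lemma shift_in_P:
  assumes "m \<in> P" "k \<le> h m"
  shows "shift k m \<in> P \<and> h (shift k m) = h m - k"
  using assms(2)
proof (induction k)
  case 0 then show ?case using assms(1) by simp
next
  case (Suc k)
  then have IH: "shift k m \<in> P" "h (shift k m) = h m - k" by auto
  have "shift (Suc k) m = e + shift k m" using shift_shift[of 1 k m] by (simp add: shift_1)
  moreover have "Suc (h (e + shift k m)) = h m - k"
    using h_shift[OF IH(1)] IH(2) Suc.prems by simp
  moreover have "e + shift k m \<in> P" using IH(2) Suc.prems by (intro shift_P[OF IH(1)]) simp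
  ultimately show ?case by (metis Suc_diff_Suc Suc_inject Suc.prems Suc_le_lessD)
qed

lemma h_0: "h 0 = 0"
  using h_add[OF zero_in_P zero_in_P] by simp

text \<open>Stopping at k = \<open>h m\<close> keeps every weight \<open>shift k m\<close> inside P
  when m is in P, where \<gamma> is meaningful.\<close>

definition twist :: "'k \<Rightarrow> ((nat \<Rightarrow> int) \<Rightarrow> 'k) \<Rightarrow> (nat \<Rightarrow> int) \<Rightarrow> 'k" where
  "twist s \<gamma> m = (\<Sum>k\<le>h m. of_nat (h m choose k) * s ^ k * \<gamma> (shift k m))"

lemma twist_cong:
  assumes "\<And>m. m \<in> P \<Longrightarrow> \<gamma> m = \<gamma>' m" "m \<in> P"
  shows "twist s \<gamma> m = twist s \<gamma>' m"
  unfolding twist_def using assms shift_in_P by (intro sum.cong) auto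

lemma twist_0: "twist 0 \<gamma> m = \<gamma> m"
  unfolding twist_def by (subst sum.remove[of _ 0]) (auto intro!: sum.neutral)

text \<open>The exponential of a derivation is multiplicative. On coefficients, grouping the product
  by the total shift n turns this into Vandermonde's identity for heights a and b.\<close>

lemma twist_hom:
  assumes \<gamma>: "monoid_hom \<gamma>"
  shows "monoid_hom (twist s \<gamma>)"
  unfolding monoid_hom_def
proof (intro conjI ballI)
  show "twist s \<gamma> 0 = 1" using \<gamma> by (simp add: twist_def h_0 monoid_hom_def)
  fix m m' assume m: "m \<in> P" and m': "m' \<in> P"
  define a b where "a = h m" and "b = h m'"
  define g where "g n = s ^ n * \<gamma> (shift n (m + m'))" for n
  have prod: "\<gamma> (shift i m) * \<gamma> (shift j m') = \<gamma> (shift (i + j) (m + m'))" if "i \<le> a" "j \<le> b" for i j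
    using \<gamma> shift_in_P[OF m] shift_in_P[OF m'] that by (simp add: monoid_hom_def a_def b_def flip: shift_add)
  have "twist s \<gamma> m * twist s \<gamma> m'
      = (\<Sum>i\<le>a. \<Sum>j\<le>b. (of_nat (a choose i) * s ^ i * \<gamma> (shift i m)) * (of_nat (b choose j) * s ^ j * \<gamma> (shift j m')))"
    unfolding twist_def a_def b_def by (rule sum_product)
  also have "\<dots> = (\<Sum>i\<le>a. \<Sum>j\<le>b. of_nat ((a choose i) * (b choose j)) * g (i + j))"
  proof (intro sum.cong refl)
    fix i j assume "i \<in> {..a}" "j \<in> {..b}"
    then have "g (i + j) = s ^ i * s ^ j * (\<gamma> (shift i m) * \<gamma> (shift j m'))"
      using prod[of i j] by (simp add: g_def power_add)
    then show "(of_nat (a choose i) * s ^ i * \<gamma> (shift i m)) * (of_nat (b choose j) * s ^ j * \<gamma> (shift j m'))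
        = of_nat ((a choose i) * (b choose j)) * g (i + j)"
      by (simp add: mult_ac)
  qed
  also have "\<dots> = (\<Sum>n\<le>a + b. \<Sum>i\<le>n. if i \<le> a \<and> n - i \<le> b
      then of_nat ((a choose i) * (b choose (n - i))) * g (i + (n - i)) else 0)"
    by (rule sum_product_diagonals)
  also have "\<dots> = (\<Sum>n\<le>a + b. \<Sum>i\<le>n. of_nat ((a choose i) * (b choose (n - i))) * g n)"
    by (intro sum.cong refl) auto
  also have "\<dots> = (\<Sum>n\<le>a + b. of_nat ((a + b) choose n) * g n)"
    by (intro sum.cong refl)
      (simp only: sum_distrib_right[symmetric] of_nat_sum[symmetric] vandermonde)
  also have "\<dots> = twist s \<gamma> (m + m')"
    unfolding twist_def h_add[OF m m'] a_def b_def g_def by (simp add: mult.assoc)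
  finally show "twist s \<gamma> (m + m') = twist s \<gamma> m * twist s \<gamma> m'" ..
qed

text \<open>After l steps the remaining height is a - l, so the double sum runs over a triangle;
  trisecting the binomial coefficients and the binomial theorem combine the two parameters. In
  particular the parameter -s provides the inverse automorphism.\<close>

lemma twist_twist:
  assumes m: "m \<in> P"
  shows "twist s' (twist s \<gamma>) m = twist (s' + s) \<gamma> m"
proof -
  define a where "a = h m"
  define g where "g n = \<gamma> (shift n m)" for n
  have "twist s' (twist s \<gamma>) m
      = (\<Sum>l\<le>a. \<Sum>k\<le>a - l. of_nat ((a choose l) * ((a - l) choose k)) * s' ^ l * s ^ k * g (l + k))"
    unfolding twist_def a_def g_def using shift_in_P[OF m]
    by (intro sum.cong) (auto simp: sum_distrib_left shift_shift algebra_simps)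
  also have "\<dots> = (\<Sum>(l, k)\<in>(SIGMA l:{..a}. {..a - l}).
      of_nat ((a choose l) * ((a - l) choose k)) * s' ^ l * s ^ k * g (l + k))"
    by (rule sum.Sigma) auto
  also have "(SIGMA l:{..a}. {..a - l}) = {(l, k). l + k \<le> a}" by auto
  also have "(\<Sum>(l, k)\<in>{(l, k). l + k \<le> a}. of_nat ((a choose l) * ((a - l) choose k)) * s' ^ l * s ^ k * g (l + k))
      = (\<Sum>n\<le>a. \<Sum>l\<le>n. of_nat ((a choose l) * ((a - l) choose (n - l))) * s' ^ l * s ^ (n - l) * g (l + (n - l)))"
    by (rule sum.triangle_reindex_eq)
  also have "\<dots> = (\<Sum>n\<le>a. \<Sum>l\<le>n. of_nat (a choose n) * (of_nat (n choose l) * s' ^ l * s ^ (n - l)) * g n)"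
  proof (intro sum.cong refl)
    fix n l assume nl: "n \<in> {..a}" "l \<in> {..n}"
    then have "(a choose l) * ((a - l) choose (n - l)) = (a choose n) * (n choose l)"
      using choose_mult[of l n a] by simp
    then show "of_nat ((a choose l) * ((a - l) choose (n - l))) * s' ^ l * s ^ (n - l) * g (l + (n - l))
        = of_nat (a choose n) * (of_nat (n choose l) * s' ^ l * s ^ (n - l)) * g n"
      using nl by (simp add: mult.assoc)
  qed
  also have "\<dots> = (\<Sum>n\<le>a. of_nat (a choose n) * (s' + s) ^ n * g n)"
    by (simp add: binomial_ring sum_distrib_left sum_distrib_right)
  also have "\<dots> = twist (s' + s) \<gamma> m" by (simp add: twist_def a_def g_def)
  finally show ?thesis .
qed

definition root_aut :: "'k \<Rightarrow> (nat \<Rightarrow> 'k) \<Rightarrow> nat \<Rightarrow> 'k" where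
  "root_aut s x = point (twist s (\<lambda>m. chi m x))"

lemma root_aut_in: "x \<in> X \<Longrightarrow> root_aut s x \<in> X"
  unfolding root_aut_def by (intro point_in_X twist_hom monoid_hom_chi)

lemma chi_root_aut: "x \<in> X \<Longrightarrow> m \<in> P \<Longrightarrow> chi m (root_aut s x) = twist s (\<lambda>m. chi m x) m"
  unfolding root_aut_def by (intro chi_point twist_hom monoid_hom_chi)

lemma root_aut_0: "x \<in> X \<Longrightarrow> root_aut 0 x = x"
  unfolding root_aut_def twist_0 by (rule point_chi)

lemma root_aut_root_aut:
  assumes "x \<in> X"
  shows "root_aut s' (root_aut s x) = root_aut (s' + s) x"
proof (rule point_eqI)
  fix m assume m: "m \<in> P"
  have "chi m (root_aut s' (root_aut s x)) = twist s' (twist s (\<lambda>m. chi m x)) m"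
    using chi_root_aut[OF assms, of _ s] chi_root_aut[OF root_aut_in[OF assms] m]
      twist_cong[OF _ m, of "\<lambda>m. chi m (root_aut s x)" "twist s (\<lambda>m. chi m x)"] by simp
  then show "chi m (root_aut s' (root_aut s x)) = chi m (root_aut (s' + s) x)"
    using twist_twist[OF m] chi_root_aut[OF assms m] by simp
qed (use assms root_aut_in in auto)

text \<open>Polynomial jointly in parameter and point, with the parameter in coordinate 0. One
  statement covers the family over the line and, by freezing the parameter, each single
  automorphism.\<close>

lemma root_aut_poly:
  "\<exists>p\<in>gen_algebra coords2. \<forall>y\<in>D \<times> X. root_aut (fst y 0) (snd y) j = p y"
proof
  let ?p = "\<lambda>y. \<Sum>m\<in>fst (coord_expansion j). snd (coord_expansion j) m *
    (\<Sum>k\<le>h m. of_nat (h m choose k) * fst y 0 ^ k * chi (shift k m) (snd y))"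
  have "(\<lambda>y. chi (shift k m) (snd y)) \<in> gen_algebra coords2"
    if "m \<in> fst (coord_expansion j)" "k \<le> h m" for m k
  proof -
    have "shift k m \<in> P" using that coord_expansion_P shift_in_P by blast
    then show ?thesis by (intro coords_subst'[OF chi_gen] coord2_gen)
  qed
  then show "?p \<in> gen_algebra coords2"
    by (intro gen_algebra_sum gen_algebra_mult gen_algebra.const gen_algebra_power coord2_gen) auto
  show "\<forall>y\<in>D \<times> X. root_aut (fst y 0) (snd y) j = ?p y"
    by (simp add: root_aut_def point_def twist_def)
qed

lemma automorphism_root_aut: "automorphism X (root_aut s)"
proof (rule automorphismI)
  show "root_aut s x \<in> X" "root_aut (- s) x \<in> X" if "x \<in> X" for x using that by (rule root_aut_in)+
  show "root_aut (- s) (root_aut s x) = x" "root_aut s (root_aut (- s) x) = x" if "x \<in> X" for x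
    using that by (simp_all add: root_aut_root_aut root_aut_0)
  have "poly_map coords X (root_aut s)" for s
    unfolding poly_map_def
  proof
    fix j
    obtain p where p: "p \<in> gen_algebra coords2" "\<forall>y\<in>UNIV \<times> X. root_aut (fst y 0) (snd y) j = p y"
      using root_aut_poly[of UNIV j] by (rule bexE)
    have "(\<lambda>x. p (\<lambda>_. s, x)) \<in> gen_algebra coords"
      by (rule coords2_subst'[OF p(1)]) (auto intro: coord_gen gen_algebra.const)
    then show "\<exists>q\<in>gen_algebra coords. \<forall>x\<in>X. root_aut s x j = q x"
      using p(2) by (intro bexI[of _ "\<lambda>x. p (\<lambda>_. s, x)"]) auto
  qed
  then show "poly_map coords X (root_aut s)" "poly_map coords X (root_aut (- s))" by blast+
qed

lemma root_aut_Aut0: "root_aut s \<in> Aut0 X"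
proof -
  define v where "v a = (\<lambda>i::nat. if i = 0 then a else 0 :: 'k)" for a
  have "root_aut (v s 0) \<in> Aut0 X"
  proof (rule Aut0_affine_family[OF affine_variety_line irreducible_line,
        where F = "\<lambda>v. root_aut (v 0)" and v = "v s" and v\<^sub>0 = "v 0"])
    show "poly_map coords2 (affine_space 1 \<times> X) (\<lambda>(v, x). root_aut (v 0) x)"
      unfolding poly_map_def case_prod_unfold by (intro allI root_aut_poly)
  qed (auto simp: affine_space_def automorphism_root_aut root_aut_0 v_def)
  then show ?thesis by (simp add: v_def)
qed

lemma chi_root_aut_1:
  assumes "x \<in> X" "m \<in> P" "h m = 1"
  shows "chi m (root_aut 1 x) = chi m x + chi (e + m) x"
  by (simp add: chi_root_aut[OF assms(1,2)] twist_def assms(3) shift_1)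

end


section \<open>Orbit closures\<close>

context toric
begin

section \<open>Supports of points on an orbit\<close>

definition support :: "(nat \<Rightarrow> 'k) \<Rightarrow> (nat \<Rightarrow> int) set" where
  "support x = {m \<in> P. chi m x \<noteq> 0}"

lemma support_add:
  assumes "x \<in> X" "a \<in> P" "b \<in> P"
  shows "a + b \<in> support x \<longleftrightarrow> a \<in> support x \<and> b \<in> support x"
  using assms by (simp add: support_def chi_add add_in_P)

lemma support_face:
  assumes "x \<in> X"
  obtains \<tau> where "is_face P \<tau>" "\<And>m. m \<in> P \<Longrightarrow> rat_vec m \<in> \<tau> \<longleftrightarrow> m \<in> support x"
proof -
  obtain G where "fg_monoid P G" using finitely_generated by blast
  then interpret fg_monoid P G .
  have "0 \<in> support x" "support x \<subseteq> P"
    using zero_in_P chi_0[OF assms] by (auto simp: support_def)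
  from face_of_submonoid[OF this(2,1) support_add[OF assms]] show ?thesis using that by blast
qed

text \<open>Along the torus orbit of z the term of m is \<open>c m * chi m z\<close> times a
  character of the torus. Independence makes each of these factors 0, and on the support
  \<open>chi m z\<close> is nonzero.\<close>

lemma vanish_on_orbit:
  assumes z: "z \<in> X" and F: "finite F" "F \<subseteq> P" and f: "\<And>x. x \<in> X \<Longrightarrow> f x = (\<Sum>m\<in>F. c m * chi m x)"
    and zero: "\<And>a. a \<in> torus_orbit d act z \<Longrightarrow> f a = 0" and m: "m \<in> F" "m \<in> support z"
  shows "c m = 0"
proof -
  have "(\<Sum>m\<in>F. c m * chi m (act t z)) = 0" if "t \<in> torus d" for t
    using f[OF act_in[OF that z]] zero[of "act t z"] that by (auto simp: torus_orbit_def)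
  then have "\<forall>m\<in>F. c m * chi m z = 0" by (rule chi_independent[OF F z])
  then show ?thesis using m by (auto simp: support_def)
qed

lemma orbit_of_support:
  assumes z: "z \<in> X" and \<tau>: "\<And>m. m \<in> P \<Longrightarrow> rat_vec m \<in> \<tau> \<longleftrightarrow> m \<in> support z"
  shows "orbit_of_face d X act \<tau> (torus_orbit d act z)"
  unfolding orbit_of_face_def P_def[symmetric]
proof (intro conjI ballI)
  let ?Q = "torus_orbit d act z"
  show "\<exists>x\<in>X. ?Q = torus_orbit d act x" using z by blast
  have QX: "?Q \<subseteq> X" using act_in z by (auto simp: torus_orbit_def)
  fix f :: "(nat \<Rightarrow> 'k) \<Rightarrow> 'k" assume f: "f \<in> gen_algebra coords"
  have closure: "(\<forall>x\<in>zariski_on X closure_of ?Q. f x = 0) \<longleftrightarrow> (\<forall>x\<in>?Q. f x = 0)"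
    unfolding closure_of_zariski_on[OF QX] using f QX by blast
  show "(\<forall>x\<in>zariski_on X closure_of ?Q. f x = 0) \<longleftrightarrow>
    (\<exists>F c. finite F \<and> F \<subseteq> {m \<in> P. rat_vec m \<notin> \<tau>} \<and>
       (\<forall>m\<in>F. c m \<in> weight_space d X act m) \<and> (\<forall>x\<in>X. f x = (\<Sum>m\<in>F. c m x)))"
    unfolding closure
  proof
    assume zero: "\<forall>x\<in>?Q. f x = 0"
    obtain F c where F: "finite F" "F \<subseteq> P" "\<And>x. x \<in> X \<Longrightarrow> f x = (\<Sum>m\<in>F. c m * chi m x)"
      using chi_expansion[OF f] by blast
    define F' where "F' = {m \<in> F. c m \<noteq> 0}"
    have "m \<notin> support z" if "m \<in> F'" for m
      using vanish_on_orbit[OF z F, of m] zero that by (auto simp: F'_def)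
    then have "F' \<subseteq> {m \<in> P. rat_vec m \<notin> \<tau>}" using F(2) \<tau> by (auto simp: F'_def)
    moreover have "f x = (\<Sum>m\<in>F'. c m * chi m x)" if "x \<in> X" for x
      unfolding F(3)[OF that] using F(1) by (intro sum.mono_neutral_right) (auto simp: F'_def)
    moreover have "\<forall>m\<in>F'. (\<lambda>x. c m * chi m x) \<in> weight_space d X act m"
      using F(2) by (auto simp: F'_def intro: weight_space_scale chi_weight)
    ultimately show "\<exists>F c. finite F \<and> F \<subseteq> {m \<in> P. rat_vec m \<notin> \<tau>} \<and>
       (\<forall>m\<in>F. c m \<in> weight_space d X act m) \<and> (\<forall>x\<in>X. f x = (\<Sum>m\<in>F. c m x))"
      using F(1) by (intro exI[of _ F'] exI[of _ "\<lambda>m x. c m * chi m x"]) (auto simp: F'_def)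
  next
    assume "\<exists>F c. finite F \<and> F \<subseteq> {m \<in> P. rat_vec m \<notin> \<tau>} \<and>
       (\<forall>m\<in>F. c m \<in> weight_space d X act m) \<and> (\<forall>x\<in>X. f x = (\<Sum>m\<in>F. c m x))"
    then obtain F c where F: "F \<subseteq> {m \<in> P. rat_vec m \<notin> \<tau>}" "\<forall>m\<in>F. c m \<in> weight_space d X act m"
      "\<forall>x\<in>X. f x = (\<Sum>m\<in>F. c m x)" by blast
    show "\<forall>x\<in>?Q. f x = 0"
    proof
      fix x assume "x \<in> ?Q"
      then obtain t where t: "t \<in> torus d" "x = act t z" by (auto simp: torus_orbit_def)
      have "c m x = 0" if m: "m \<in> F" for m
      proof -
        have mP: "m \<in> P" and "m \<notin> support z" using F(1) m \<tau> by auto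
        then have "chi m z = 0" by (simp add: support_def)
        then show ?thesis
          using F(2) m t(1) weight_spaceD(2)[of "c m" m t z] weight_space_eq[of "c m" m z] mP z
          by (simp add: t(2))
      qed
      then show "f x = 0" using F(3) QX \<open>x \<in> ?Q\<close> by (auto intro: sum.neutral)
    qed
  qed
qed

lemma Aut0_orbit_closed:
  assumes "z \<in> Aut0_orbit X y" "y \<in> X" "\<phi> \<in> Aut0 X"
  shows "\<phi> z \<in> Aut0_orbit X y"
proof -
  obtain \<psi> where \<psi>: "\<psi> \<in> Aut0 X" "z = \<psi> y" using assms(1) by (auto simp: Aut0_orbit_def)
  have "\<phi> z = (\<lambda>x. \<phi> (\<psi> x)) y" using \<psi>(2) by simp
  then show ?thesis unfolding Aut0_orbit_def
    by (intro CollectI exI[of _ "\<lambda>x. \<phi> (\<psi> x)"] conjI Aut0_comp[OF assms(3) \<psi>(1)])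
qed

text \<open>Two points of an orbit lie in a common irreducible family of points of that orbit, in which the
  non-vanishing of finitely many characters is an open condition.\<close>

lemma support_directed:
  assumes G: "finite G" "G \<subseteq> P" and y: "y \<in> X"
    and z: "z \<in> Aut0_orbit X y" and z': "z' \<in> Aut0_orbit X y"
  obtains w where "w \<in> Aut0_orbit X y" "G \<inter> support z \<union> G \<inter> support z' \<subseteq> support w"
proof -
  obtain \<phi> \<psi> where \<phi>: "\<phi> \<in> Aut0 X" "z = \<phi> y" and \<psi>: "\<psi> \<in> Aut0 X" "z' = \<psi> y"
    using z z' by (auto simp: Aut0_orbit_def)
  obtain B \<A> f where fam: "in_irreducible_family X B \<A> f"
    and ex: "\<exists>b\<in>B. \<forall>x\<in>X. f b x = \<phi> x" "\<exists>b\<in>B. \<forall>x\<in>X. f b x = \<psi> x"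
    using Aut0_common_family[OF \<phi>(1) \<psi>(1)] .
  have B: "variety B \<A>" "irreducible_space (variety_topology B \<A>)" "algebraic_family B \<A> X f"
    using fam by (auto simp: in_irreducible_family_def)
  \<comment> \<open>The product over the generators in the support expresses all the non-vanishing
    conditions by a single polynomial.\<close>
  define U where "U x = {b \<in> B. (\<Prod>g\<in>G \<inter> support x. chi g (f b y)) \<noteq> 0}" for x
  have "openin (variety_topology B \<A>) (U x)" for x
    unfolding U_def using G(2) chi_gen
    by (intro openin_family_nonzero[OF B(1,3) _ y] gen_algebra_prod) auto
  moreover have "U z \<noteq> {}" "U z' \<noteq> {}"
    using ex y G(1) \<phi>(2) \<psi>(2) by (force simp: U_def support_def)+
  ultimately obtain b where b: "b \<in> U z" "b \<in> U z'"
    using irreducible_spaceD[OF B(2)] by blast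
  have "f b y \<in> X"
    using b B(3) y by (auto simp: U_def algebraic_family_def intro: automorphism_in)
  have "f b y \<in> Aut0_orbit X y"
    using Aut0_memberI[OF fam, of b] b(1) by (auto simp: U_def Aut0_orbit_def)
  moreover have "G \<inter> support z \<union> G \<inter> support z' \<subseteq> support (f b y)"
    using b G by (auto simp: U_def support_def)
  ultimately show ?thesis by (rule that)
qed

lemma dominant_orbit:
  assumes y: "y \<in> X"
  obtains z where "z \<in> Aut0_orbit X y" "\<And>z'. z' \<in> Aut0_orbit X y \<Longrightarrow> support z' \<subseteq> support z"
proof -
  obtain G where "fg_monoid P G" using finitely_generated by blast
  then interpret fg_monoid P G .
  have OX: "Aut0_orbit X y \<subseteq> X"
    using y Aut0_automorphism automorphism_in by (fastforce simp: Aut0_orbit_def)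
  have "\<exists>x. x \<in> Aut0_orbit X y" using act_Aut0[OF torus_1] unfolding Aut0_orbit_def by blast
  \<comment> \<open>A strict upper bound on the number of generators in a support, which is what
    guarantees a maximum.\<close>
  moreover have "\<forall>x. x \<in> Aut0_orbit X y \<longrightarrow> card (G \<inter> support x) < Suc (card G)"
    using finite_G by (auto simp: less_Suc_eq_le intro: card_mono)
  ultimately obtain z where z: "z \<in> Aut0_orbit X y"
    "\<And>x. x \<in> Aut0_orbit X y \<Longrightarrow> card (G \<inter> support x) \<le> card (G \<inter> support z)"
    using ex_has_greatest_nat[of "\<lambda>x. x \<in> Aut0_orbit X y" _ "\<lambda>x. card (G \<inter> support x)" "Suc (card G)"]
    by (metis nat_less_le)
  have "support z' \<subseteq> support z" if z': "z' \<in> Aut0_orbit X y" for z'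
  proof -
    obtain w where w: "w \<in> Aut0_orbit X y" "G \<inter> support z \<union> G \<inter> support z' \<subseteq> support w"
      using support_directed[OF finite_G G_subset y z(1) z'] .
    have "G \<inter> support z = G \<inter> support w"
      using w(2) z(2)[OF w(1)] finite_G by (intro card_seteq) auto
    then have G: "G \<inter> support z' \<subseteq> support z" using w(2) by blast
    \<comment> \<open>A sum lies in a support exactly when both summands do, so the inclusion passes
      from the generators to all weights.\<close>
    have "P \<subseteq> {m \<in> P. m \<in> support z' \<longrightarrow> m \<in> support z}"
    proof (rule P_least)
      show "G \<subseteq> {m \<in> P. m \<in> support z' \<longrightarrow> m \<in> support z}" using G G_subset by blast
      have "chi 0 z = 1" using OX z(1) by (intro chi_0) blast
      then show "0 \<in> {m \<in> P. m \<in> support z' \<longrightarrow> m \<in> support z}"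
        using zero_in_P by (simp add: support_def)
      show "a + b \<in> {m \<in> P. m \<in> support z' \<longrightarrow> m \<in> support z}"
        if "a \<in> {m \<in> P. m \<in> support z' \<longrightarrow> m \<in> support z}" "b \<in> {m \<in> P. m \<in> support z' \<longrightarrow> m \<in> support z}" for a b
        using that OX z(1) z' support_add[of z a b] support_add[of z' a b] add_in_P by auto
    qed
    then show ?thesis by (auto simp: support_def)
  qed
  then show ?thesis using z(1) that by blast
qed

lemma no_admissible_root:
  assumes y: "y \<in> X" and z: "z \<in> Aut0_orbit X y" "z \<in> X"
    and dominant: "\<And>z'. z' \<in> Aut0_orbit X y \<Longrightarrow> support z' \<subseteq> support z"
    and \<tau>: "is_face P \<tau>" "\<And>m. m \<in> P \<Longrightarrow> rat_vec m \<in> \<tau> \<longleftrightarrow> m \<in> support z"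
    and e: "admissible P e" "tau_root P \<tau> e"
  shows False
proof -
  obtain G where "fg_monoid P G" using finitely_generated by blast
  then interpret fg_monoid P G .
  obtain p m where p: "p \<in> ray_vectors P" "p (rat_vec e) = -1" and m: "m \<in> P" "p (rat_vec m) = 1"
    "rat_vec m \<notin> \<tau>" "e + m \<in> P" "rat_vec (e + m) \<in> \<tau>"
    using tau_root_witness[OF \<tau>(1) e] .
  obtain h where h: "\<And>m. m \<in> P \<Longrightarrow> p (rat_vec m) = of_nat (h m)"
    by (rule ray_multiplicity[OF p(1)]) blast
  have pd: "p \<in> dual_rat P" by (rule dual_coneD(1)[OF ray_vectors_dual_cone[OF p(1)]])
  have eL: "e \<in> lattice_gen P" using e(1) by (auto simp: admissible_def demazure_root_def)
  interpret root_subgroup d X act x\<^sub>0 e h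
  proof
    fix m m' assume mm: "m \<in> P" "m' \<in> P"
    have "(of_nat (h (m + m')) :: rat) = of_nat (h m + h m')"
      using add_P[OF pd mm] h mm add_in_P by simp
    then show "h (m + m') = h m + h m'" by (simp only: of_nat_eq_iff)
  next
    fix m assume m: "m \<in> P" "0 < h m"
    show P: "e + m \<in> P" using m h by (intro admissible_step[OF e(1) p m(1)]) simp
    have "p (rat_vec (e + m)) = -1 + p (rat_vec m)"
      using dual_rat_rat_vec_add[OF pd eL P_lattice[OF m(1)]] p(2) by simp
    then have "(of_nat (Suc (h (e + m))) :: rat) = of_nat (h m)" using h[OF P] h[OF m(1)] by simp
    then show "Suc (h (e + m)) = h m" by (simp only: of_nat_eq_iff)
  qed
  have "(of_nat (h m) :: rat) = of_nat 1" using h[OF m(1)] m(2) by simp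
  then have h1: "h m = 1" by (simp only: of_nat_eq_iff)
  have "m \<notin> support z" "e + m \<in> support z" using \<tau>(2) m by auto
  \<comment> \<open>The value is \<open>chi m z + chi (e + m) z\<close>, where the first term is 0
    and the second is not, so no cancellation can occur.\<close>
  then have "chi m (root_aut 1 z) \<noteq> 0"
    using chi_root_aut_1[OF z(2) m(1) h1] m(1) by (simp add: support_def)
  then have "m \<in> support (root_aut 1 z)" using m(1) by (simp add: support_def)
  moreover have "root_aut 1 z \<in> Aut0_orbit X y" by (rule Aut0_orbit_closed[OF z(1) y root_aut_Aut0])
  ultimately show False using dominant \<open>m \<notin> support z\<close> by blast
qed

theorem Aut0_orbit_closure:
  assumes y: "y \<in> X"
  shows "\<exists>\<tau> Q. is_face P \<tau> \<and> orbit_of_face d X act \<tau> Q \<and>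
    zariski_on X closure_of (Aut0_orbit X y) = zariski_on X closure_of Q \<and>
    \<not> (\<exists>e. admissible P e \<and> tau_root P \<tau> e)"
proof -
  obtain z where z: "z \<in> Aut0_orbit X y" and dominant: "\<And>z'. z' \<in> Aut0_orbit X y \<Longrightarrow> support z' \<subseteq> support z"
    by (rule dominant_orbit[OF y]) blast
  have OX: "Aut0_orbit X y \<subseteq> X"
    using y Aut0_automorphism automorphism_in by (fastforce simp: Aut0_orbit_def)
  then have zX: "z \<in> X" using z by blast
  obtain \<tau> where \<tau>: "is_face P \<tau>" "\<And>m. m \<in> P \<Longrightarrow> rat_vec m \<in> \<tau> \<longleftrightarrow> m \<in> support z"
    by (rule support_face[OF zX]) blast
  let ?Q = "torus_orbit d act z"
  have QO: "?Q \<subseteq> Aut0_orbit X y"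
  proof
    fix x assume "x \<in> ?Q"
    then obtain t where t: "t \<in> torus d" "x = act t z" by (auto simp: torus_orbit_def)
    obtain \<phi> where "\<phi> \<in> Aut0 X" "\<phi> z = act t z" using act_Aut0[OF t(1)] zX by blast
    then show "x \<in> Aut0_orbit X y" using Aut0_orbit_closed[OF z y] t(2) by metis
  qed
  have "(\<forall>a\<in>Aut0_orbit X y. p a = 0) \<longleftrightarrow> (\<forall>a\<in>?Q. p a = 0)" if p: "p \<in> gen_algebra coords" for p
  proof
    assume zero: "\<forall>a\<in>?Q. p a = 0"
    obtain F c where F: "finite F" "F \<subseteq> P" "\<And>x. x \<in> X \<Longrightarrow> p x = (\<Sum>m\<in>F. c m * chi m x)"
      using chi_expansion[OF p] by blast
    show "\<forall>a\<in>Aut0_orbit X y. p a = 0"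
    proof
      fix a assume a: "a \<in> Aut0_orbit X y"
      \<comment> \<open>On the support of \<open>z\<close> the coefficient is 0 by independence
        along the torus orbit; off it the character vanishes at \<open>a\<close>, because the
        support of \<open>a\<close> is contained in that of \<open>z\<close>.\<close>
      have "c m * chi m a = 0" if m: "m \<in> F" for m
      proof (cases "m \<in> support z")
        case True
        then show ?thesis using vanish_on_orbit[OF zX F, of m] zero m by simp
      next
        case False
        then show ?thesis using dominant[OF a] m F(2) by (auto simp: support_def)
      qed
      then have "(\<Sum>m\<in>F. c m * chi m a) = 0" by (intro sum.neutral ballI)
      then show "p a = 0" using F(3) a OX by auto
    qed
  qed (use QO in blast)
  then have "zariski_on X closure_of (Aut0_orbit X y) = zariski_on X closure_of ?Q"
    using OX QO by (auto simp: closure_of_zariski_on)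
  then show ?thesis
    using \<tau> orbit_of_support[OF zX \<tau>(2)] no_admissible_root[OF y z zX dominant \<tau>] by blast
qed

end

theorem corollary6:
  fixes X :: "(nat \<Rightarrow> 'k::{alg_closed_field,field_char_0}) set"
    and act :: "(nat \<Rightarrow> 'k) \<Rightarrow> (nat \<Rightarrow> 'k) \<Rightarrow> nat \<Rightarrow> 'k"
    and d :: nat
    and P :: "(nat \<Rightarrow> int) set"
  assumes "affine_toric_variety d X act"
    and "P = weight_monoid d X act"
  shows "\<forall>x\<in>X. \<exists>\<tau> Q. is_face P \<tau> \<and> orbit_of_face d X act \<tau> Q \<and>
           zariski_on X closure_of (Aut0_orbit X x) = zariski_on X closure_of Q \<and>
           \<not> (\<exists>e. admissible P e \<and> tau_root P \<tau> e)"
proof -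
  obtain x\<^sub>0 where "toric d X act x\<^sub>0"
    using assms(1) unfolding affine_toric_variety_def toric_def by blast
  then interpret toric d X act x\<^sub>0 .
  show ?thesis using Aut0_orbit_closure unfolding assms(2) P_def by blast
qed

end
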